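(* Let the Hilbert space $\mathfrak H$ be decomposed as $\mathfrak H=\mathfrak H_1\oplus\mathfrak H_2$ and let $T_1=\begin{pmatrix} T_{11} \\ T_{21} \end{pmatrix}\in[\mathfrak H_1,\mathfrak H]$ be a symmetric operator (so $T_{11}=T_{11}^*\in[\mathfrak H_1]$, $T_{21}\in[\mathfrak H_1,\mathfrak H_2]$) with $\nu_-(I-T_{11}^2)<\infty$, satisfying $$\nu_-(I-T_{11}^2)=\nu_-(I-T_1^*T_1).$$ Then $T_m=T_M$ if and only if $$\sup_{f\in\mathfrak H_1}\frac{|(T_1f,\varphi)|^2}{(|I-T_1^*T_1|f,f)}=\infty\quad\text{for every }\varphi\in\mathfrak H_2\setminus\{0\}.$$
   Context: $[\mathfrak H,\mathfrak K]$ denotes bounded everywhere defined operators. For bounded selfadjoint $X$, $\nu_-(X)$ is the dimension of its spectral subspace for $(-\infty,0)$, $|X|=(X^2)^{1/2}$, $\operatorname{sign}(X)$ is defined by the functional calculus with $\operatorname{sign}(t)=1$ for $t\ge0$, $-1$ for $t<0$. That the supremum equals $\infty$ means: there is no constant $0\le C<\infty$ such that $|(T_1f,\varphi)|^2\le C\,(|I-T_1^*T_1|f,f)$ for all $f\in\mathfrak H_1$. Let $J=\operatorname{sign}(I-T_{11}^2)$, $D_{T_{11}}=|I-T_{11}^2|^{1/2}$ and $V=\operatorname{clos}(T_{21}D_{T_{11}}^{[-1]})$ (a bounded operator under the stated condition), where $D_{T_{11}}^{[-1]}$ is the Moore–Penrose inverse (inverse of $D_{T_{11}}\restriction(\ker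 D_{T_{11}})^\perp$ on $\operatorname{ran}D_{T_{11}}$, zero on $\ker D_{T_{11}}$). The operators $T_m,T_M$ are $$T_m=\begin{pmatrix} T_{11} & D_{T_{11}}V^* \\ V D_{T_{11}} & -I+V(I-T_{11})JV^* \end{pmatrix},\quad T_M=\begin{pmatrix} T_{11} & D_{T_{11}}V^* \\ V D_{T_{11}} & I-V(I+T_{11})JV^* \end{pmatrix};$$ they are the smallest and largest selfadjoint extensions $T\in[\mathfrak H]$ of $T_1$ with $\nu_-(I-T^2)=\nu_-(I-T_{11}^2)$. *)

theory Defs
  imports "HOL-Analysis.Analysis"
begin

text \<open>A complex inner product space is a real one (whose inner product is the real part of the
  complex one, so that norm and topology are the usual ones) together with a compatible complex
  structure. The complex inner product is linear in its first argument.\<close>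

class complex_inner = real_inner +
  fixes scaleC :: "complex \<Rightarrow> 'a \<Rightarrow> 'a"  (infixr \<open>*\<^sub>C\<close> 75)
    and cinner :: "'a \<Rightarrow> 'a \<Rightarrow> complex"
  assumes scaleC_add_right: "c *\<^sub>C (x + y) = c *\<^sub>C x + c *\<^sub>C y"
    and scaleC_add_left: "(c + d) *\<^sub>C x = c *\<^sub>C x + d *\<^sub>C x"
    and scaleC_scaleC: "c *\<^sub>C d *\<^sub>C x = (c * d) *\<^sub>C x"
    and scaleC_one: "1 *\<^sub>C x = x"
    and scaleR_scaleC: "r *\<^sub>R x = complex_of_real r *\<^sub>C x"
    and cinner_commute: "cinner x y = cnj (cinner y x)"
    and cinner_add_left: "cinner (x + y) z = cinner x z + cinner y z"
    and cinner_scaleC_left: "cinner (c *\<^sub>C x) y = c * cinner x y"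
    and inner_eq_Re_cinner: "inner x y = Re (cinner x y)"

class chilbert_space = complex_inner + complete_space

instantiation complex :: complex_inner
begin
definition scaleC_complex :: "complex \<Rightarrow> complex \<Rightarrow> complex" where
  "scaleC_complex c x = c * x"
definition cinner_complex :: "complex \<Rightarrow> complex \<Rightarrow> complex" where
  "cinner_complex x y = x * cnj y"
instance
  by standard
    (auto simp: scaleC_complex_def cinner_complex_def algebra_simps scaleR_conv_of_real
      inner_complex_def)
end

instance complex :: chilbert_space ..

text \<open>The orthogonal sum of two spaces; the norm is the library's norm on products.\<close>

instantiation prod :: (complex_inner, complex_inner) complex_inner
begin
definition scaleC_prod :: "complex \<Rightarrow> 'a \<times> 'b \<Rightarrow> 'a \<times> 'b" where
  "scaleC_prod c x = (c *\<^sub>C fst x, c *\<^sub>C snd x)"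
definition cinner_prod :: "'a \<times> 'b \<Rightarrow> 'a \<times> 'b \<Rightarrow> complex" where
  "cinner_prod x y = cinner (fst x) (fst y) + cinner (snd x) (snd y)"
instance
proof
  fix x y :: "'a \<times> 'b"
  show "cinner x y = cnj (cinner y x)"
    unfolding cinner_prod_def complex_cnj_add
    by (metis cinner_commute)
qed (auto simp: scaleC_prod_def cinner_prod_def scaleC_add_right scaleC_add_left scaleC_scaleC
      scaleC_one scaleR_prod_def scaleR_scaleC cinner_add_left cinner_scaleC_left
      inner_prod_def inner_eq_Re_cinner algebra_simps)
end

instance prod :: (chilbert_space, chilbert_space) chilbert_space ..

global_interpretation complex_vector:
  vector_space "scaleC :: complex \<Rightarrow> 'a \<Rightarrow> 'a::complex_inner"
  defines cspan = complex_vector.span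
    and cdependent = complex_vector.dependent
    and cdim_nat = complex_vector.dim
    and crepresentation = complex_vector.representation
    and cextend_basis = complex_vector.extend_basis
  by unfold_locales (simp_all add: scaleC_add_right scaleC_add_left scaleC_scaleC scaleC_one)

text \<open>The library's dimension is a natural number (0 for infinite-dimensional sets).\<close>

definition cdimension :: "'a::complex_inner set \<Rightarrow> enat" where
  "cdimension S = (if \<exists>B. finite B \<and> S \<subseteq> cspan B then enat (cdim_nat S) else \<infinity>)"

definition bounded_clinear :: "('a::complex_inner \<Rightarrow> 'b::complex_inner) \<Rightarrow> bool" where
  "bounded_clinear T \<longleftrightarrow> bounded_linear T \<and> (\<forall>c x. T (c *\<^sub>C x) = c *\<^sub>C T x)"

definition cadjoint :: "('a::complex_inner \<Rightarrow> 'b::complex_inner) \<Rightarrow> 'b \<Rightarrow> 'a" where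
  "cadjoint T = (THE S. \<forall>x y. cinner (T x) y = cinner x (S y))"

definition selfadjoint :: "('a::complex_inner \<Rightarrow> 'a) \<Rightarrow> bool" where
  "selfadjoint X \<longleftrightarrow> bounded_clinear X \<and> cadjoint X = X"

definition orth_projection :: "('a::complex_inner \<Rightarrow> 'a) \<Rightarrow> bool" where
  "orth_projection P \<longleftrightarrow> selfadjoint P \<and> P \<circ> P = P"

definition op_sqrt :: "('a::complex_inner \<Rightarrow> 'a) \<Rightarrow> 'a \<Rightarrow> 'a" where
  "op_sqrt X = (THE S. selfadjoint S \<and> (\<forall>f. 0 \<le> Re (cinner (S f) f)) \<and> S \<circ> S = X)"

definition op_abs :: "('a::complex_inner \<Rightarrow> 'a) \<Rightarrow> 'a \<Rightarrow> 'a" where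
  "op_abs X = op_sqrt (X \<circ> X)"

text \<open>The (right-continuous) spectral family of a bounded selfadjoint operator \<open>X\<close>, with
  \<open>(X f, f) = \<integral> t d(E t f, f)\<close>. The Stieltjes measure of a nondecreasing right-continuous function
  is the library's \<open>interval_measure\<close>; it is a finite measure with compact support here, so all
  bounded Borel functions and the identity are integrable.\<close>

definition spectral_family :: "('a::complex_inner \<Rightarrow> 'a) \<Rightarrow> (real \<Rightarrow> 'a \<Rightarrow> 'a) \<Rightarrow> bool" where
  "spectral_family X E \<longleftrightarrow>
     (\<forall>t. orth_projection (E t)) \<and>
     (\<forall>s t. s \<le> t \<longrightarrow> E s \<circ> E t = E s \<and> E t \<circ> E s = E s) \<and>
     (\<forall>t f. ((\<lambda>s. E s f) \<longlongrightarrow> E t f) (at_right t)) \<and>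
     (\<exists>M. (\<forall>t < - M. E t = (\<lambda>_. 0)) \<and> (\<forall>t \<ge> M. E t = id)) \<and>
     (\<forall>f. cinner (X f) f =
        of_real (LINT t|interval_measure (\<lambda>t. Re (cinner (E t f) f)). t))"

text \<open>By the spectral theorem every bounded selfadjoint operator has exactly one spectral family,
  so the choice below is no choice.\<close>

definition spectral_measure :: "('a::complex_inner \<Rightarrow> 'a) \<Rightarrow> 'a \<Rightarrow> real measure" where
  "spectral_measure X f =
     interval_measure (\<lambda>t. Re (cinner ((SOME E. spectral_family X E) t f) f))"

text \<open>\<open>\<phi>(X) = \<integral> \<phi>(t) dE t\<close> for bounded real Borel functions, in the weak sense; on a complex space
  an operator is determined by its quadratic form.\<close>

definition functional_calculus :: "(real \<Rightarrow> real) \<Rightarrow> ('a::complex_inner \<Rightarrow> 'a) \<Rightarrow> 'a \<Rightarrow> 'a" where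
  "functional_calculus \<phi> X =
     (THE S. bounded_clinear S \<and>
        (\<forall>f. cinner (S f) f = of_real (LINT t|spectral_measure X f. \<phi> t)))"

definition spectral_subspace :: "('a::complex_inner \<Rightarrow> 'a) \<Rightarrow> real set \<Rightarrow> 'a set" where
  "spectral_subspace X A = range (functional_calculus (indicat_real A) X)"

definition neg_index :: "('a::complex_inner \<Rightarrow> 'a) \<Rightarrow> enat"  (\<open>\<nu>\<^sub>-\<close>) where
  "\<nu>\<^sub>- X = cdimension (spectral_subspace X {..<0})"

text \<open>Unlike the library's \<open>sgn\<close>, the value at 0 is 1.\<close>

definition op_sign :: "('a::complex_inner \<Rightarrow> 'a) \<Rightarrow> 'a \<Rightarrow> 'a" where
  "op_sign X = functional_calculus (\<lambda>t. if t \<ge> 0 then 1 else - 1) X"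

text \<open>Operators that need not be everywhere defined are given by their graphs.\<close>

definition op_graph :: "('a \<Rightarrow> 'b) \<Rightarrow> ('a \<times> 'b) set" where
  "op_graph T = {(x, T x) | x. True}"

definition op_ker :: "('a \<Rightarrow> 'b::zero) \<Rightarrow> 'a set" where
  "op_ker T = {x. T x = 0}"

definition orth_compl :: "'a::complex_inner set \<Rightarrow> 'a set" where
  "orth_compl S = {x. \<forall>y\<in>S. cinner x y = 0}"

text \<open>For selfadjoint \<open>D\<close>: the linear operator with domain \<open>ran D + ker D\<close> that inverts the
  restriction of \<open>D\<close> to the orthogonal complement of \<open>ker D\<close> and vanishes on \<open>ker D\<close>.\<close>

definition moore_penrose :: "('a::complex_inner \<Rightarrow> 'a) \<Rightarrow> ('a \<times> 'a) set" where
  "moore_penrose D = {(D x + k, x) | x k. x \<in> orth_compl (op_ker D) \<and> k \<in> op_ker D}"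

definition closure_op ::
    "('a::topological_space \<times> 'b::topological_space) set \<Rightarrow> 'a \<Rightarrow> 'b" where
  "closure_op G = (THE V. op_graph V = closure G)"

definition block_op ::
    "('a \<Rightarrow> 'a) \<Rightarrow> ('b \<Rightarrow> 'a) \<Rightarrow> ('a \<Rightarrow> 'b) \<Rightarrow> ('b \<Rightarrow> 'b)
     \<Rightarrow> 'a::complex_inner \<times> 'b::complex_inner \<Rightarrow> 'a \<times> 'b" where
  "block_op A B C D = (\<lambda>(f, g). (A f + B g, C f + D g))"

definition J_op :: "('a::complex_inner \<Rightarrow> 'a) \<Rightarrow> 'a \<Rightarrow> 'a" where
  "J_op T11 = op_sign (\<lambda>f. f - T11 (T11 f))"

definition D_op :: "('a::complex_inner \<Rightarrow> 'a) \<Rightarrow> 'a \<Rightarrow> 'a" where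
  "D_op T11 = op_sqrt (op_abs (\<lambda>f. f - T11 (T11 f)))"

text \<open>The relational composition \<open>r O s\<close> applies \<open>r\<close> first.\<close>

definition V_op ::
    "('a::complex_inner \<Rightarrow> 'a) \<Rightarrow> ('a \<Rightarrow> 'b::complex_inner) \<Rightarrow> 'a \<Rightarrow> 'b" where
  "V_op T11 T21 = closure_op (moore_penrose (D_op T11) O op_graph T21)"

definition T_m ::
    "('a::complex_inner \<Rightarrow> 'a) \<Rightarrow> ('a \<Rightarrow> 'b::complex_inner) \<Rightarrow> 'a \<times> 'b \<Rightarrow> 'a \<times> 'b" where
  "T_m T11 T21 =
     (let J = J_op T11; D = D_op T11; V = V_op T11 T21
      in block_op T11 (D \<circ> cadjoint V)
           (V \<circ> D) (\<lambda>g. - g + (V \<circ> (\<lambda>f. f - T11 f) \<circ> J \<circ> cadjoint V) g))"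

definition T_M ::
    "('a::complex_inner \<Rightarrow> 'a) \<Rightarrow> ('a \<Rightarrow> 'b::complex_inner) \<Rightarrow> 'a \<times> 'b \<Rightarrow> 'a \<times> 'b" where
  "T_M T11 T21 =
     (let J = J_op T11; D = D_op T11; V = V_op T11 T21
      in block_op T11 (D \<circ> cadjoint V)
           (V \<circ> D) (\<lambda>g. g - (V \<circ> (\<lambda>f. f + T11 f) \<circ> J \<circ> cadjoint V) g))"

end

theory Submission
  imports Defs
begin

text \<open>Write \<open>A = T11\<close>, \<open>X = I - A\<^sup>2 = D J D\<close> and \<open>Y = I - T1\<^sup>* T1 = X - T21\<^sup>* T21\<close>. Since \<open>Y\<close> has no more
  negative squares than \<open>X\<close>, dimension counting on the negative subspaces gives
  \<open>\<parallel>T21 f\<parallel> \<le> C \<parallel>D f\<parallel>\<close>. Hence \<open>V\<close> is bounded with \<open>V D = T21\<close>, and \<open>Y = D K D\<close> with \<open>K = J - V\<^sup>* V\<close>.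
  The operators \<open>T_m\<close> and \<open>T_M\<close> differ only in the lower right corner, and they agree iff
  \<open>V J V\<^sup>* = I\<close>. The equivalence with the supremum condition rests on the identity
  \<open>K J V\<^sup>* = V\<^sup>* (I - V J V\<^sup>*)\<close> and on the estimate
  \<open>(|Y| f, f) \<le> |(K D f, D f)| + c \<parallel>K D f\<parallel>\<^sup>2\<close>, which holds because \<open>Y\<close> is bounded away from \<open>0\<close> on its
  finite-dimensional negative subspace; both are applied to vectors \<open>f\<close> with \<open>D f\<close> close to
  \<open>J V\<^sup>* g\<close>.\<close>

section \<open>Bounded operators on complex Hilbert spaces\<close>

text \<open>Let \<open>S\<close> be the adjoint of \<open>V\<close>, so that \<open>D S\<close> is
  the adjoint of \<open>T21\<close>. A finite supremum at phi says that \<open>D S\<close> sends phi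
  into the range of the square root of |Y|. For phi = (I - V J S) g the identity gives D S phi = D K
  J S g, a limit of vectors \<open>Y (x n)\<close>, and the Cauchy-Schwarz inequality for |Y| bounds
  the quotient. Conversely, if V J S = I, then along such a sequence the majorant of the denominator
  tends to 0 while the numerator tends to the fourth power of the norm of phi. The obstacle is that
  \<open>J (S g)\<close> lies only in the closure of the range of \<open>D\<close>, and that |Y|,
  unlike \<open>Y\<close>, does not visibly factor through \<open>D\<close>. Its form is therefore
  replaced by a majorant that is continuous in \<open>D f\<close>. The error term must be quadratic
  in \<open>K (D f)\<close> so that it vanishes in the limit together with the main term. Square
  roots and adjoints are given by unique description, so they are constructed and then identified by
  uniqueness. The spectral family is picked by choice, so only its defining properties are
  available.\<close>

lemma cinner_add_right: "cinner x (y + z) = cinner x y + cinner x z"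
  by (metis cinner_add_left cinner_commute complex_cnj_add)

lemma cinner_scaleC_right: "cinner x (c *\<^sub>C y) = cnj c * cinner x y"
  by (metis cinner_scaleC_left cinner_commute complex_cnj_mult)

lemma cinner_zero_left [simp]: "cinner 0 x = 0"
  by (metis add_cancel_right_right cinner_add_left)

lemma cinner_zero_right [simp]: "cinner x 0 = 0"
  by (metis cinner_zero_left cinner_commute complex_cnj_zero)

lemma cinner_minus_left: "cinner (- x) y = - cinner x y"
  by (metis add.right_inverse add_eq_0_iff cinner_add_left cinner_zero_left)

lemma cinner_minus_right: "cinner x (- y) = - cinner x y"
  by (metis cinner_minus_left cinner_commute complex_cnj_minus)

lemma cinner_diff_left: "cinner (x - y) z = cinner x z - cinner y z"
  by (metis add_uminus_conv_diff cinner_add_left cinner_minus_left)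

lemma cinner_diff_right: "cinner x (y - z) = cinner x y - cinner x z"
  by (metis add_uminus_conv_diff cinner_add_right cinner_minus_right)

lemma cinner_scaleR_left: "cinner (r *\<^sub>R x) y = of_real r * cinner x y"
  by (simp add: scaleR_scaleC cinner_scaleC_left)

lemma cinner_scaleR_right: "cinner x (r *\<^sub>R y) = of_real r * cinner x y"
  by (simp add: scaleR_scaleC cinner_scaleC_right)

lemmas cinner_algebra = cinner_add_left cinner_add_right cinner_diff_left cinner_diff_right
  cinner_minus_left cinner_minus_right cinner_scaleC_left cinner_scaleC_right
  cinner_scaleR_left cinner_scaleR_right

lemma Re_cinner_self: "Re (cinner x x) = (norm x)\<^sup>2"
  by (metis inner_eq_Re_cinner power2_norm_eq_inner)

lemma cinner_self: "cinner x x = of_real ((norm x)\<^sup>2)"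
proof -
  have "Im (cinner x x) = 0"
    by (metis cinner_commute cnj.simps(2) neg_equal_zero)
  then show ?thesis
    by (simp add: complex_eq_iff Re_cinner_self)
qed

lemma cinner_self_eq_0 [simp]: "cinner x x = 0 \<longleftrightarrow> x = 0"
  by (simp add: cinner_self)

lemma norm_scaleC: "norm (c *\<^sub>C x) = cmod c * norm x"
proof -
  have "(norm (c *\<^sub>C x))\<^sup>2 = (cmod c * norm x)\<^sup>2"
    unfolding Re_cinner_self[symmetric] cinner_scaleC_left cinner_scaleC_right
    by (simp add: cinner_self power_mult_distrib mult.assoc[symmetric] complex_mult_cnj cmod_power2
        power2_eq_square[symmetric])
  then show ?thesis by simp
qed

lemma cinner_ext_left: "(\<And>y. cinner x y = cinner x' y) \<Longrightarrow> x = x'"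
  by (metis cinner_diff_left cinner_self_eq_0 right_minus_eq)

lemma cinner_ext_right: "(\<And>y. cinner y x = cinner y x') \<Longrightarrow> x = x'"
  by (metis cinner_diff_right cinner_self_eq_0 right_minus_eq)

lemma bounded_clinearI:
  assumes "\<And>x y. T (x + y) = T x + T y" "\<And>c x. T (c *\<^sub>C x) = c *\<^sub>C T x"
    "\<And>x. norm (T x) \<le> norm x * K"
  shows "bounded_clinear T"
  unfolding bounded_clinear_def using assms
  by (auto intro!: bounded_linear_intro simp: scaleR_scaleC)

lemma bounded_clinear_simps:
  assumes "bounded_clinear T"
  shows "T (x + y) = T x + T y" "T (x - y) = T x - T y" "T 0 = 0" "T (- x) = - T x"
    "T (c *\<^sub>C x) = c *\<^sub>C T x" "T (r *\<^sub>R x) = r *\<^sub>R T x"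
  using assms unfolding bounded_clinear_def
  by (auto simp: linear_simps bounded_linear.linear)

lemma bounded_clinear_imp: "bounded_clinear T \<Longrightarrow> bounded_linear T"
  by (simp add: bounded_clinear_def)

lemma bounded_clinear_bound:
  assumes "bounded_clinear T"
  obtains K where "K > 0" "\<And>x. norm (T x) \<le> K * norm x"
  using bounded_linear.pos_bounded[OF bounded_clinear_imp[OF assms]]
  by (metis mult.commute)

lemma bounded_clinear_id: "bounded_clinear (\<lambda>x. x)"
  by (simp add: bounded_clinear_def)

lemma bounded_clinear_zero: "bounded_clinear (\<lambda>x. 0)"
  by (simp add: bounded_clinear_def)

lemma scaleC_scaleR_commute: "c *\<^sub>C (r *\<^sub>R x) = r *\<^sub>R (c *\<^sub>C x)"
  by (simp add: scaleR_scaleC scaleC_scaleC mult.commute)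

lemma bounded_clinear_add:
  "bounded_clinear S \<Longrightarrow> bounded_clinear T \<Longrightarrow> bounded_clinear (\<lambda>x. S x + T x)"
  by (auto simp: bounded_clinear_def bounded_linear_add scaleC_add_right)

lemma bounded_clinear_diff:
  "bounded_clinear S \<Longrightarrow> bounded_clinear T \<Longrightarrow> bounded_clinear (\<lambda>x. S x - T x)"
  by (auto simp: bounded_clinear_def bounded_linear_sub complex_vector.scale_right_diff_distrib)

lemma bounded_clinear_scaleR:
  "bounded_clinear T \<Longrightarrow> bounded_clinear (\<lambda>x. r *\<^sub>R T x)"
  by (auto simp: bounded_clinear_def bounded_linear_const_scaleR scaleC_scaleR_commute)

lemma bounded_clinear_compose:
  "bounded_clinear S \<Longrightarrow> bounded_clinear T \<Longrightarrow> bounded_clinear (\<lambda>x. S (T x))"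
  by (auto simp: bounded_clinear_def bounded_linear_compose)

lemma bounded_clinear_scaleC: "bounded_clinear (\<lambda>x. c *\<^sub>C x)"
  by (rule bounded_clinearI[where K = "cmod c"])
    (simp_all add: scaleC_add_right scaleC_scaleC norm_scaleC mult.commute)

lemma bounded_clinear_tendsto:
  "bounded_clinear T \<Longrightarrow> (f \<longlongrightarrow> a) F \<Longrightarrow> ((\<lambda>x. T (f x)) \<longlongrightarrow> T a) F"
  by (rule bounded_linear.tendsto[OF bounded_clinear_imp])

text \<open>Polarization: this is where the complex scalars matter.\<close>

lemma quadratic_form_eqI:
  assumes "bounded_clinear S" "bounded_clinear T" "\<And>f. cinner (S f) f = cinner (T f) f"
  shows "S = T"
proof
  fix f
  let ?U = "\<lambda>x. S x - T x"
  have U: "bounded_clinear ?U" by (intro bounded_clinear_diff assms)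
  have q: "cinner (?U x) x = 0" for x
    using assms(3)[of x] by (simp add: cinner_diff_left)
  have "cinner (?U x) y = 0" for x y
  proof -
    have 1: "cinner (?U x) y + cinner (?U y) x = 0"
      using q[of "x + y"] q[of x] q[of y]
      unfolding bounded_clinear_simps(1)[OF U] cinner_add_left cinner_add_right
      by (simp add: add.commute)
    have "\<i> * cinner (?U y) x - \<i> * cinner (?U x) y = 0"
      using q[of "x + \<i> *\<^sub>C y"] q[of x] q[of y]
      by (simp only: bounded_clinear_simps[OF U] cinner_add_left cinner_add_right
          cinner_scaleC_left cinner_scaleC_right) simp
    then have "cinner (?U y) x = cinner (?U x) y" by simp
    with 1 show ?thesis by simp
  qed
  then have "?U f = 0" using cinner_self_eq_0 by blast
  then show "S f = T f" by simp
qed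

text \<open>Nonnegativity at \<open>x - (s * z) *\<^sub>C y\<close>, with \<open>s\<close> real and
  \<open>z = cinner (B x) y\<close>, is a real quadratic inequality in \<open>s\<close>, because the
  phase of \<open>z\<close> makes both cross terms real. The form may be degenerate, hence the
  separate case \<open>b = 0\<close>.\<close>

lemma positive_form_Cauchy_Schwarz:
  assumes "bounded_clinear B" "\<And>x y. cinner (B x) y = cinner x (B y)"
    and pos: "\<And>x. 0 \<le> Re (cinner (B x) x)"
  shows "(cmod (cinner (B x) y))\<^sup>2 \<le> Re (cinner (B x) x) * Re (cinner (B y) y)"
proof -
  define a b z where "a = Re (cinner (B x) x)" and "b = Re (cinner (B y) y)"
    and "z = cinner (B x) y"
  have z': "cinner (B y) x = cnj z"
    unfolding z_def using assms(2) cinner_commute by metis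
  have ineq: "0 \<le> a - 2 * s * (cmod z)\<^sup>2 + s\<^sup>2 * (cmod z)\<^sup>2 * b" for s :: real
  proof -
    let ?l = "of_real s * z"
    have "cinner (B (x - ?l *\<^sub>C y)) (x - ?l *\<^sub>C y)
        = cinner (B x) x - cnj ?l * z - ?l * cnj z + ?l * cnj ?l * cinner (B y) y"
      by (simp add: bounded_clinear_simps[OF assms(1)] cinner_algebra z' z_def[symmetric]
          algebra_simps)
    also have "\<dots> = cinner (B x) x - 2 * s * (cmod z)\<^sup>2 + s\<^sup>2 * (cmod z)\<^sup>2 * cinner (B y) y"
    proof -
      have "cnj ?l * z = of_real (s * (cmod z)\<^sup>2)" "?l * cnj z = of_real (s * (cmod z)\<^sup>2)"
        "?l * cnj ?l = of_real (s\<^sup>2 * (cmod z)\<^sup>2)"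
        by (simp_all add: complex_norm_square power2_eq_square[symmetric] of_real_power[symmetric] mult_ac del: of_real_power)
      then show ?thesis by simp
    qed
    finally have "Re (cinner (B (x - ?l *\<^sub>C y)) (x - ?l *\<^sub>C y))
        = Re (cinner (B x) x - of_real (2 * s * (cmod z)\<^sup>2)
            + of_real (s\<^sup>2 * (cmod z)\<^sup>2) * cinner (B y) y)"
      by simp
    also have "\<dots> = a - 2 * s * (cmod z)\<^sup>2 + s\<^sup>2 * (cmod z)\<^sup>2 * b"
      by (simp only: minus_complex.sel plus_complex.sel Re_complex_of_real a_def b_def
          complex_scaleR scaleR_conv_of_real[symmetric] scaleR_complex.sel)
    finally show ?thesis using pos by metis
  qed
  have "a \<ge> 0" "b \<ge> 0" using pos by (auto simp: a_def b_def)
  have "(cmod z)\<^sup>2 \<le> a * b"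
  proof (cases "b = 0")
    case True
    have "(cmod z)\<^sup>2 = 0"
    proof (rule ccontr)
      assume "(cmod z)\<^sup>2 \<noteq> 0"
      \<comment> \<open>This value of \<open>s\<close> makes the right side of \<open>ineq\<close>
        equal to -1.\<close>
      then show False
        using ineq[of "(a + 1) / (2 * (cmod z)\<^sup>2)"] True by (simp add: field_simps)
    qed
    then show ?thesis using True by simp
  next
    case False
    with \<open>b \<ge> 0\<close> have "b > 0" by simp
    have "0 \<le> a - (cmod z)\<^sup>2 / b"
      using ineq[of "1 / b"] \<open>b > 0\<close> by (simp add: field_simps power2_eq_square)
    then show ?thesis using \<open>b > 0\<close> by (simp add: field_simps)
  qed
  then show ?thesis by (simp add: a_def b_def z_def)
qed

lemma cinner_Cauchy_Schwarz: "cmod (cinner x y) \<le> norm x * norm y"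
proof -
  have "(cmod (cinner x y))\<^sup>2 \<le> (norm x * norm y)\<^sup>2"
    using positive_form_Cauchy_Schwarz[of "\<lambda>x. x" x y]
    by (simp add: bounded_clinear_id Re_cinner_self power_mult_distrib)
  then show ?thesis by (rule power2_le_imp_le) simp
qed

lemma Re_cinner_le: "\<bar>Re (cinner x y)\<bar> \<le> norm x * norm y"
  using cinner_Cauchy_Schwarz abs_Re_le_cmod order_trans by blast

lemma bounded_bilinear_cinner: "bounded_bilinear cinner"
proof
  show "\<exists>K. \<forall>a b. norm (cinner a b) \<le> norm a * norm b * K"
    by (metis cinner_Cauchy_Schwarz mult.right_neutral)
qed (simp_all add: cinner_algebra scaleR_conv_of_real)

lemmas tendsto_cinner = bounded_bilinear.tendsto[OF bounded_bilinear_cinner]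

lemma bounded_clinear_cinner_left: "bounded_clinear (\<lambda>x. cinner x y)"
  by (rule bounded_clinearI[where K = "norm y"])
    (simp_all add: cinner_algebra scaleC_complex_def cinner_Cauchy_Schwarz)

text \<open>A minimizing sequence for the distance is Cauchy by the parallelogram law.\<close>

lemma closed_subspace_decomposition:
  fixes x :: "'a::chilbert_space"
  assumes "closed S" and "0 \<in> S" and add: "\<And>y z. y \<in> S \<Longrightarrow> z \<in> S \<Longrightarrow> y + z \<in> S"
    and scale: "\<And>c y. y \<in> S \<Longrightarrow> c *\<^sub>C y \<in> S"
  shows "\<exists>y\<in>S. \<forall>z\<in>S. cinner (x - y) z = 0"
proof -
  define d where "d = infdist x S"
  have ne: "S \<noteq> {}" using assms(2) by auto
  have d_le: "d \<le> norm (x - y)" if "y \<in> S" for y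
    using infdist_le[OF that, of x] by (simp add: d_def dist_norm)
  have scaleR: "r *\<^sub>R y \<in> S" if "y \<in> S" for r :: real and y
    using scale[OF that, of "of_real r"] by (simp add: scaleR_scaleC)
  have d0: "d \<ge> 0" by (simp add: d_def infdist_nonneg)
  have "\<exists>y\<in>S. norm (x - y) < d + 1 / real (Suc n)" for n
  proof -
    have "\<exists>y\<in>S. dist x y < d + 1 / real (Suc n)"
    proof (rule ccontr)
      assume "\<not> ?thesis"
      then have "d + 1 / real (Suc n) \<le> infdist x S"
        unfolding infdist_notempty[OF ne] by (intro cINF_greatest ne) force
      then show False by (simp add: d_def)
    qed
    then show ?thesis by (simp add: dist_norm)
  qed
  then obtain u where uS: "\<And>n. u n \<in> S" and u: "\<And>n. norm (x - u n) < d + 1 / real (Suc n)"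
    by metis
  define a where "a n = (d + 1 / real (Suc n))\<^sup>2 - d\<^sup>2" for n
  have "(\<lambda>n. (d + 1 / real (Suc n))\<^sup>2 - d\<^sup>2) \<longlonglongrightarrow> (d + 0)\<^sup>2 - d\<^sup>2"
    using LIMSEQ_inverse_real_of_nat
    by (intro tendsto_intros) (simp add: inverse_eq_divide)
  then have a: "a \<longlonglongrightarrow> 0" by (simp add: a_def[abs_def])
  \<comment> \<open>The midpoint of \<open>u m\<close> and \<open>u n\<close> lies in
    \<open>S\<close>, so its distance from \<open>x\<close> is at least \<open>d\<close>;
    near-minimality thus forces closeness.\<close>
  have par: "(norm (u m - u n))\<^sup>2 \<le> 2 * a m + 2 * a n" for m n
  proof -
    let ?p = "x - u m" and ?q = "x - u n"
    have "(norm (u m - u n))\<^sup>2 = 2 * (norm ?p)\<^sup>2 + 2 * (norm ?q)\<^sup>2 - (norm (?p + ?q))\<^sup>2"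
    proof -
      have "u m - u n = ?q - ?p" by simp
      then show ?thesis
        by (simp only:) (simp add: power2_norm_eq_inner inner_add inner_diff inner_commute)
    qed
    moreover have "?p + ?q = 2 *\<^sub>R (x - (1/2) *\<^sub>R (u m + u n))"
      by (simp add: algebra_simps scaleR_2)
    moreover have "d \<le> norm (x - (1/2) *\<^sub>R (u m + u n))"
      by (intro d_le scaleR add uS)
    then have "4 * d\<^sup>2 \<le> (norm (2 *\<^sub>R (x - (1/2) *\<^sub>R (u m + u n))))\<^sup>2"
      using power_mono[OF _ d0, of _ 2] by (simp add: power_mult_distrib)
    moreover have "(norm ?p)\<^sup>2 \<le> (d + 1 / real (Suc m))\<^sup>2" "(norm ?q)\<^sup>2 \<le> (d + 1 / real (Suc n))\<^sup>2"
      using less_imp_le[OF u] by (auto intro!: power_mono simp del: of_nat_Suc)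
    ultimately show ?thesis by (simp add: a_def)
  qed
  have "Cauchy u"
  proof (rule CauchyI)
    fix e :: real assume "e > 0"
    then have "e\<^sup>2 / 4 > 0" by simp
    then obtain N where N: "\<And>n. n \<ge> N \<Longrightarrow> a n < e\<^sup>2 / 4"
      using a order_tendstoD(2)[of a 0 sequentially "e\<^sup>2 / 4"] unfolding eventually_sequentially
      by blast
    have "norm (u m - u n) < e" if "m \<ge> N" "n \<ge> N" for m n
    proof -
      have "(norm (u m - u n))\<^sup>2 < e\<^sup>2"
        using par[of m n] N[OF that(1)] N[OF that(2)] by linarith
      then show ?thesis using \<open>e > 0\<close> by (simp add: power2_less_imp_less)
    qed
    then show "\<exists>M. \<forall>m\<ge>M. \<forall>n\<ge>M. norm (u m - u n) < e" by blast
  qed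
  then obtain y where y: "u \<longlonglongrightarrow> y"
    using Cauchy_convergent convergent_def by blast
  have yS: "y \<in> S" using closed_sequentially[OF assms(1) _ y] uS by blast
  have yd: "norm (x - y) \<le> d"
  proof (rule LIMSEQ_le)
    show "(\<lambda>n. norm (x - u n)) \<longlonglongrightarrow> norm (x - y)" by (intro tendsto_intros y)
    show "(\<lambda>n. d + inverse (real (Suc n))) \<longlonglongrightarrow> d"
      using tendsto_add[OF tendsto_const LIMSEQ_inverse_real_of_nat, of d] by simp
    show "\<exists>N. \<forall>n\<ge>N. norm (x - u n) \<le> d + inverse (real (Suc n))"
      using u by (auto simp: inverse_eq_divide less_imp_le)
  qed
  have real: "inner (x - y) z = 0" if "z \<in> S" for z
  proof (cases "z = 0")
    case False
    \<comment> \<open>The minimizer over real \<open>s\<close> of the distance from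
      \<open>x - y\<close> to \<open>s *\<^sub>R z\<close>.\<close>
    define s where "s = inner (x - y) z / (norm z)\<^sup>2"
    have "d \<le> norm (x - (y + s *\<^sub>R z))" by (intro d_le add yS scaleR that)
    then have "(norm (x - y))\<^sup>2 \<le> (norm (x - y - s *\<^sub>R z))\<^sup>2"
      using yd by (intro power_mono) (auto simp: diff_diff_eq)
    also have "\<dots> = (norm (x - y))\<^sup>2 - 2 * s * inner (x - y) z + s\<^sup>2 * (norm z)\<^sup>2"
      by (simp only: power2_norm_eq_inner)
        (simp add: inner_diff_left inner_diff_right inner_commute power2_eq_square algebra_simps)
    finally have "2 * s * inner (x - y) z \<le> s\<^sup>2 * (norm z)\<^sup>2" by simp
    then have "(inner (x - y) z)\<^sup>2 \<le> 0"
      using False by (simp add: s_def field_simps power2_eq_square)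
    then show ?thesis by simp
  qed simp
  \<comment> \<open>\<open>real\<close> gives only the real part; applied to
    \<open>\<i> *\<^sub>C z\<close> it gives the imaginary part.\<close>
  have "cinner (x - y) z = 0" if "z \<in> S" for z
    using real[OF that] real[OF scale[OF that, of \<i>]]
    by (simp add: inner_eq_Re_cinner cinner_scaleC_right complex_eq_iff)
  with yS show ?thesis by blast
qed

text \<open>The kernel of a nonzero functional has codimension one: for \<open>e\<close> orthogonal
  to it with \<open>F e\<close> nonzero, \<open>x - (F x / F e) *\<^sub>C e\<close> lies in the
  kernel, and pairing with \<open>e\<close> computes \<open>F x\<close>.\<close>

lemma riesz_representation:
  fixes F :: "'a::chilbert_space \<Rightarrow> complex"
  assumes "bounded_clinear F"
  shows "\<exists>y. \<forall>x. F x = cinner x y"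
proof (cases "\<forall>x. F x = 0")
  case True
  then show ?thesis by (intro exI[of _ 0]) simp
next
  case False
  then obtain x0 where x0: "F x0 \<noteq> 0" by blast
  note F = bounded_clinear_simps[OF assms]
  have "closed {x. F x = 0}"
    using continuous_closed_preimage_constant[of UNIV F 0]
      bounded_linear.continuous_on[OF bounded_clinear_imp[OF assms] continuous_on_id]
    by simp
  then obtain y where y: "F y = 0" "\<And>z. F z = 0 \<Longrightarrow> cinner (x0 - y) z = 0"
    using closed_subspace_decomposition[of "{x. F x = 0}" x0]
    by (auto simp: F scaleC_complex_def)
  define e where "e = x0 - y"
  have Fe: "F e \<noteq> 0" using x0 y(1) by (simp add: e_def F)
  then have "e \<noteq> 0" using F(3) by auto
  have "F x = cinner x ((cnj (F e) / of_real ((norm e)\<^sup>2)) *\<^sub>C e)" for x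
  proof -
    have "F (x - (F x / F e) *\<^sub>C e) = 0" using Fe by (simp add: F scaleC_complex_def)
    then have "cinner e (x - (F x / F e) *\<^sub>C e) = 0" using y(2) by (simp add: e_def)
    then have "cinner (x - (F x / F e) *\<^sub>C e) e = 0"
      using cinner_commute complex_cnj_zero by metis
    then have "cinner x e = F x / F e * of_real ((norm e)\<^sup>2)"
      by (simp add: cinner_algebra cinner_self)
    then show ?thesis using Fe \<open>e \<noteq> 0\<close> by (simp add: cinner_scaleC_right)
  qed
  then show ?thesis by blast
qed

section \<open>Adjoints, selfadjoint operators and orthogonal projections\<close>

lemma cadjoint_eqI:
  assumes "\<And>x y. cinner (T x) y = cinner x (S y)"
  shows "cadjoint T = S"
  unfolding cadjoint_def
proof (rule the_equality)
  fix S' assume "\<forall>x y. cinner (T x) y = cinner x (S' y)"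
  then have "cinner x (S' y) = cinner x (S y)" for x y by (metis assms)
  then show "S' = S" by (blast intro: cinner_ext_right)
qed (use assms in blast)

lemma cinner_cadjoint:
  fixes T :: "'a::chilbert_space \<Rightarrow> 'b::complex_inner"
  assumes "bounded_clinear T"
  shows "cinner (T x) y = cinner x (cadjoint T y)"
proof -
  have "\<exists>z. \<forall>x. cinner (T x) y = cinner x z" for y
    by (intro riesz_representation bounded_clinear_compose[OF bounded_clinear_cinner_left assms])
  then obtain S where S: "\<And>x y. cinner (T x) y = cinner x (S y)" by metis
  show ?thesis using S cadjoint_eqI[of T S] by simp
qed

lemma cinner_cadjoint':
  fixes T :: "'a::chilbert_space \<Rightarrow> 'b::complex_inner"
  assumes "bounded_clinear T"
  shows "cinner (cadjoint T y) x = cinner y (T x)"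
  by (metis assms cinner_cadjoint cinner_commute)

lemma bounded_clinear_cadjoint:
  fixes T :: "'a::chilbert_space \<Rightarrow> 'b::complex_inner"
  assumes "bounded_clinear T"
  shows "bounded_clinear (cadjoint T)"
proof -
  obtain K where K: "K > 0" "\<And>x. norm (T x) \<le> K * norm x"
    using bounded_clinear_bound[OF assms] by blast
  note adj = cinner_cadjoint[OF assms]
  show ?thesis
  proof (rule bounded_clinearI[where K = K])
    fix y
    let ?s = "cadjoint T y"
    have "(norm ?s)\<^sup>2 = Re (cinner (T ?s) y)"
      by (simp add: adj Re_cinner_self)
    also have "\<dots> \<le> norm (T ?s) * norm y"
      using Re_cinner_le abs_le_D1 by blast
    also have "\<dots> \<le> K * norm ?s * norm y"
      by (intro mult_right_mono K) simp
    finally have "norm ?s * norm ?s \<le> norm ?s * (norm y * K)"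
      by (simp add: power2_eq_square mult_ac)
    then show "norm ?s \<le> norm y * K"
      by (cases "?s = 0") (use K in \<open>auto simp: mult_le_cancel_left\<close>)
  qed (rule cinner_ext_right, simp add: adj[symmetric] cinner_algebra)+
qed

lemma selfadjointI:
  "bounded_clinear X \<Longrightarrow> (\<And>x y. cinner (X x) y = cinner x (X y)) \<Longrightarrow> selfadjoint X"
  by (simp add: selfadjoint_def cadjoint_eqI)

lemma selfadjoint_bounded_clinear: "selfadjoint X \<Longrightarrow> bounded_clinear X"
  by (simp add: selfadjoint_def)

lemma selfadjoint_cinner:
  fixes X :: "'a::chilbert_space \<Rightarrow> 'a"
  shows "selfadjoint X \<Longrightarrow> cinner (X x) y = cinner x (X y)"
  by (metis selfadjoint_def cinner_cadjoint)

lemma selfadjoint_form_real: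
  fixes X :: "'a::chilbert_space \<Rightarrow> 'a"
  assumes "selfadjoint X"
  shows "cinner (X x) x = of_real (Re (cinner (X x) x))"
proof -
  have "cinner (X x) x = cnj (cinner (X x) x)"
    using selfadjoint_cinner[OF assms, of x x] cinner_commute[of "X x" x] by simp
  then have "Im (cinner (X x) x) = - Im (cinner (X x) x)"
    by (metis cnj.simps(2))
  then show ?thesis by (simp add: complex_eq_iff)
qed

lemma selfadjoint_id: "selfadjoint (\<lambda>x. x)"
  by (simp add: selfadjointI bounded_clinear_id)

lemma selfadjoint_zero: "selfadjoint (\<lambda>x. 0)"
  by (simp add: selfadjointI bounded_clinear_zero)

lemma selfadjoint_add:
  fixes X :: "'a::chilbert_space \<Rightarrow> 'a"
  assumes "selfadjoint X" "selfadjoint Y"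
  shows "selfadjoint (\<lambda>x. X x + Y x)"
  by (rule selfadjointI[OF bounded_clinear_add[OF assms[THEN selfadjoint_bounded_clinear]]])
    (simp add: cinner_algebra selfadjoint_cinner[OF assms(1)] selfadjoint_cinner[OF assms(2)])

lemma selfadjoint_diff:
  fixes X :: "'a::chilbert_space \<Rightarrow> 'a"
  assumes "selfadjoint X" "selfadjoint Y"
  shows "selfadjoint (\<lambda>x. X x - Y x)"
  by (rule selfadjointI[OF bounded_clinear_diff[OF assms[THEN selfadjoint_bounded_clinear]]])
    (simp add: cinner_algebra selfadjoint_cinner[OF assms(1)] selfadjoint_cinner[OF assms(2)])

lemma selfadjoint_scaleR:
  fixes X :: "'a::chilbert_space \<Rightarrow> 'a"
  assumes "selfadjoint X"
  shows "selfadjoint (\<lambda>x. r *\<^sub>R X x)"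
  by (rule selfadjointI[OF bounded_clinear_scaleR[OF assms[THEN selfadjoint_bounded_clinear]]])
    (simp add: cinner_algebra selfadjoint_cinner[OF assms])

lemma selfadjoint_commuting_compose:
  fixes X :: "'a::chilbert_space \<Rightarrow> 'a"
  assumes "selfadjoint X" "selfadjoint Y" "\<And>x. X (Y x) = Y (X x)"
  shows "selfadjoint (\<lambda>x. X (Y x))"
  by (rule selfadjointI[OF bounded_clinear_compose[OF assms(1,2)[THEN selfadjoint_bounded_clinear]]])
    (simp add: selfadjoint_cinner[OF assms(1)] selfadjoint_cinner[OF assms(2)] assms(3))

lemma selfadjoint_square:
  fixes X :: "'a::chilbert_space \<Rightarrow> 'a"
  shows "selfadjoint X \<Longrightarrow> selfadjoint (\<lambda>x. X (X x))"
  by (rule selfadjoint_commuting_compose[of X X]) (simp_all only:)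

lemma selfadjoint_nilpotent:
  fixes X :: "'a::chilbert_space \<Rightarrow> 'a"
  assumes "selfadjoint X" "X (X x) = 0"
  shows "X x = 0"
  using selfadjoint_cinner[OF assms(1), of x "X x"] assms(2) by simp

text \<open>The decomposition is chosen pointwise; its uniqueness then yields linearity and
  idempotence.\<close>

lemma orth_projection_exists:
  fixes S :: "'a::chilbert_space set"
  assumes "closed S" and "0 \<in> S" and add: "\<And>y z. y \<in> S \<Longrightarrow> z \<in> S \<Longrightarrow> y + z \<in> S"
    and scale: "\<And>c y. y \<in> S \<Longrightarrow> c *\<^sub>C y \<in> S"
  obtains P where "orth_projection P" "range P = S"
proof -
  have ex: "\<exists>y. y \<in> S \<and> (\<forall>z\<in>S. cinner (x - y) z = 0)" for x
    using closed_subspace_decomposition[OF assms(1,2), of x] add scale unfolding Bex_def by blast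
  define P where "P x = (SOME y. y \<in> S \<and> (\<forall>z\<in>S. cinner (x - y) z = 0))" for x
  have "P x \<in> S \<and> (\<forall>z\<in>S. cinner (x - P x) z = 0)" for x
    unfolding P_def by (rule someI_ex[OF ex])
  then have PS: "P x \<in> S" and P: "z \<in> S \<Longrightarrow> cinner (x - P x) z = 0" for x z
    by blast+
  have P1: "cinner x z = cinner (P x) z" if "z \<in> S" for x z
    using P[OF that, of x] by (simp add: cinner_diff_left)
  have P2: "cinner z x = cinner z (P x)" if "z \<in> S" for x z
    using P1[OF that, of x] cinner_commute by metis
  have sub: "y - z \<in> S" if "y \<in> S" "z \<in> S" for y z
    using add[OF that(1) scale[OF that(2), of "of_real (-1)"]]
    by (simp only: scaleR_scaleC[symmetric]) simp
  have uniq: "y = P x" if "y \<in> S" "\<And>z. z \<in> S \<Longrightarrow> cinner (x - y) z = 0" for x y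
  proof -
    have "y - P x \<in> S" by (intro sub PS that(1))
    then have "cinner (x - y) (y - P x) = 0" "cinner (x - P x) (y - P x) = 0"
      using that(2) P by blast+
    moreover have "y - P x = (x - P x) - (x - y)" by simp
    ultimately have "cinner (y - P x) (y - P x) = 0" by (metis cinner_diff_left diff_self)
    then show ?thesis by simp
  qed
  have lin: "bounded_clinear P"
  proof (rule bounded_clinearI[where K = 1])
    show "P (x + y) = P x + P y" for x y
      by (rule uniq[symmetric]) (auto intro: add PS simp: cinner_algebra P1[symmetric])
    show "P (c *\<^sub>C x) = c *\<^sub>C P x" for c x
      by (rule uniq[symmetric]) (auto intro: scale PS simp: cinner_algebra P1[symmetric])
    fix x
    have "(norm (P x))\<^sup>2 \<le> norm x * norm (P x)"
      using P1[OF PS, of x x] Re_cinner_le[of x "P x"] by (simp add: Re_cinner_self)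
    then show "norm (P x) \<le> norm x * 1"
      by (cases "P x = 0") (auto simp: power2_eq_square)
  qed
  have "selfadjoint P"
    by (rule selfadjointI[OF lin]) (metis P1 P2 PS)
  moreover have idem: "P y = y" if "y \<in> S" for y
    by (rule uniq[symmetric]) (use that in auto)
  moreover have "range P = S" using PS idem by (auto simp: image_iff) (metis)
  ultimately show ?thesis by (intro that[of P]) (simp_all add: orth_projection_def fun_eq_iff PS)
qed

section \<open>Positive square roots\<close>

definition positive_op :: "('a::complex_inner \<Rightarrow> 'a) \<Rightarrow> bool" where
  "positive_op X \<longleftrightarrow> selfadjoint X \<and> (\<forall>f. 0 \<le> Re (cinner (X f) f))"

lemma positive_op_selfadjoint: "positive_op X \<Longrightarrow> selfadjoint X"
  by (simp add: positive_op_def)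

lemma positive_op_form: "positive_op X \<Longrightarrow> 0 \<le> Re (cinner (X f) f)"
  by (simp add: positive_op_def)

lemma positive_op_Cauchy_Schwarz:
  fixes X :: "'a::chilbert_space \<Rightarrow> 'a"
  assumes "positive_op X"
  shows "(cmod (cinner (X x) y))\<^sup>2 \<le> Re (cinner (X x) x) * Re (cinner (X y) y)"
  using assms by (intro positive_form_Cauchy_Schwarz)
    (auto simp: positive_op_def selfadjoint_bounded_clinear selfadjoint_cinner[of X])

text \<open>Cauchy-Schwarz for the form of \<open>X\<close> at \<open>x\<close> and
  \<open>X x\<close> bounds the fourth power of the norm of \<open>X x\<close> by 0.\<close>

lemma positive_op_null:
  fixes X :: "'a::chilbert_space \<Rightarrow> 'a"
  assumes "positive_op X" "Re (cinner (X x) x) = 0"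
  shows "X x = 0"
  using positive_op_Cauchy_Schwarz[OF assms(1), of x "X x"] assms(2) by simp

text \<open>Pairing \<open>X x\<close> with itself again, Cauchy-Schwarz bounds the fourth power of
  its norm by the product of the forms at \<open>x\<close> and \<open>X x\<close>. This converts a
  form bound into a norm bound.\<close>

lemma positive_contraction_norm_le:
  fixes X :: "'a::chilbert_space \<Rightarrow> 'a"
  assumes "positive_op X" and le: "\<And>x. Re (cinner (X x) x) \<le> (norm x)\<^sup>2"
  shows "norm (X x) \<le> norm x"
proof -
  have "((norm (X x))\<^sup>2)\<^sup>2 = (cmod (cinner (X x) (X x)))\<^sup>2"
    by (simp add: cinner_self norm_power)
  also have "\<dots> \<le> Re (cinner (X x) x) * Re (cinner (X (X x)) (X x))"
    by (rule positive_op_Cauchy_Schwarz[OF assms(1)])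
  also have "\<dots> \<le> (norm x)\<^sup>2 * (norm (X x))\<^sup>2"
    using positive_op_form[OF assms(1)] by (intro mult_mono le) auto
  finally have "(norm (X x))\<^sup>2 * (norm (X x))\<^sup>2 \<le> (norm x)\<^sup>2 * (norm (X x))\<^sup>2"
    by (simp only: power2_eq_square[of "(norm (X x))\<^sup>2"])
  then have "X x = 0 \<or> (norm (X x))\<^sup>2 \<le> (norm x)\<^sup>2"
    by (simp only: mult_le_cancel_right) auto
  then show ?thesis by auto
qed

text \<open>Iteration \<open>Y \<mapsto> (A + Y\<^sup>2) / 2\<close> for \<open>Y = I - sqrt (I - A)\<close>. Its increments are dominated in norm by
  those of the same scalar iteration with \<open>A = 1\<close>, hence it converges in norm for every contraction
  \<open>A\<close>.\<close>

fun sqrt_iter :: "('a::complex_inner \<Rightarrow> 'a) \<Rightarrow> nat \<Rightarrow> 'a \<Rightarrow> 'a" where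
  "sqrt_iter A 0 = (\<lambda>x. 0)"
| "sqrt_iter A (Suc n) = (\<lambda>x. (1/2) *\<^sub>R (A x + sqrt_iter A n (sqrt_iter A n x)))"

fun sqrt_majorant :: "nat \<Rightarrow> real" where
  "sqrt_majorant 0 = 0"
| "sqrt_majorant (Suc n) = (1 + (sqrt_majorant n)\<^sup>2) / 2"

lemma sqrt_majorant_bounds: "0 \<le> sqrt_majorant n \<and> sqrt_majorant n \<le> 1"
proof (induction n)
  case (Suc n)
  then have "(sqrt_majorant n)\<^sup>2 \<le> 1" by (simp add: power_le_one)
  then show ?case by simp
qed simp

lemma sqrt_majorant_mono: "sqrt_majorant n \<le> sqrt_majorant (Suc n)"
  using sum_squares_ge_zero[of "sqrt_majorant n - 1" 0]
  by (simp add: power2_eq_square algebra_simps)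

lemma bounded_clinear_sqrt_iter: "bounded_clinear A \<Longrightarrow> bounded_clinear (sqrt_iter A n)"
proof (induction n)
  case (Suc n)
  then have "bounded_clinear (sqrt_iter A n)" by blast
  from bounded_clinear_compose[OF this this] Suc.prems show ?case
    unfolding sqrt_iter.simps by (intro bounded_clinear_scaleR bounded_clinear_add)
qed (simp add: bounded_clinear_zero)

text \<open>The iterates are polynomials in \<open>A\<close>. With \<open>C\<close> an iterate this
  makes iterates commute with each other; with general \<open>C\<close> it passes to the square root
  in the limit.\<close>

lemma sqrt_iter_commute:
  assumes "bounded_clinear C" "bounded_clinear A" "\<And>x. C (A x) = A (C x)"
  shows "C (sqrt_iter A n x) = sqrt_iter A n (C x)"
  by (induction n arbitrary: x) (simp_all add: bounded_clinear_simps[OF assms(1)] assms(3))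

lemma selfadjoint_sqrt_iter:
  fixes A :: "'a::chilbert_space \<Rightarrow> 'a"
  assumes "selfadjoint A"
  shows "selfadjoint (sqrt_iter A n)"
proof (induction n)
  case (Suc n)
  show ?case
    unfolding sqrt_iter.simps
    by (intro selfadjoint_scaleR selfadjoint_add assms selfadjoint_square[OF Suc])
qed (simp add: selfadjoint_zero)

lemma sqrt_iter_norm_le:
  assumes "bounded_clinear A" "\<And>x. norm (A x) \<le> norm x"
  shows "norm (sqrt_iter A n x) \<le> sqrt_majorant n * norm x"
proof (induction n arbitrary: x)
  case (Suc n)
  let ?r = "sqrt_majorant n"
  have "norm (sqrt_iter A n (sqrt_iter A n x)) \<le> ?r * norm (sqrt_iter A n x)"
    by (rule Suc)
  also have "\<dots> \<le> ?r * (?r * norm x)"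
    using sqrt_majorant_bounds by (intro mult_left_mono Suc) auto
  finally have "norm (A x + sqrt_iter A n (sqrt_iter A n x)) \<le> norm x + ?r * (?r * norm x)"
    using add_mono[OF assms(2)[of x]] norm_triangle_ineq[of "A x"] order_trans by blast
  then show ?case
    unfolding sqrt_iter.simps sqrt_majorant.simps norm_scaleR
    by (simp add: power2_eq_square field_simps)
qed simp

text \<open>Since consecutive iterates \<open>Y\<close> and \<open>Z\<close> commute, the difference
  of their squares is \<open>Y + Z\<close> applied to \<open>Y - Z\<close>. The scalar iteration
  factors in the same way with equality, so the domination is inherited at each step.\<close>

lemma sqrt_iter_diff_norm_le:
  assumes A: "bounded_clinear A" "\<And>x. norm (A x) \<le> norm x"
  shows "norm (sqrt_iter A (Suc n) x - sqrt_iter A n x)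
    \<le> (sqrt_majorant (Suc n) - sqrt_majorant n) * norm x"
proof (induction n arbitrary: x)
  case 0
  then show ?case using A(2)[of x] by simp
next
  case (Suc n)
  let ?Y = "sqrt_iter A (Suc n)" and ?Z = "sqrt_iter A n"
  let ?r = "sqrt_majorant (Suc n)" and ?s = "sqrt_majorant n"
  let ?w = "?Y x - ?Z x"
  have comm: "?Y (?Z x) = ?Z (?Y x)" for x
    by (intro sqrt_iter_commute bounded_clinear_sqrt_iter A(1))
      (simp only: sqrt_iter_commute[OF A(1) A(1), symmetric])
  have lin: "?Y (u - v) = ?Y u - ?Y v" "?Z (u - v) = ?Z u - ?Z v" for u v
    using bounded_clinear_simps(2) bounded_clinear_sqrt_iter[OF A(1)] by blast+
  have "sqrt_iter A (Suc (Suc n)) x - ?Y x = (1/2) *\<^sub>R (?Y (?Y x) - ?Z (?Z x))"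
    unfolding sqrt_iter.simps(2)[of A "Suc n"] by (simp add: algebra_simps)
  also have "?Y (?Y x) - ?Z (?Z x) = ?Y ?w + ?Z ?w"
    by (simp only: lin comm) simp
  finally have "norm (sqrt_iter A (Suc (Suc n)) x - ?Y x) \<le> (1/2) * (norm (?Y ?w) + norm (?Z ?w))"
    using norm_triangle_ineq[of "?Y ?w" "?Z ?w"] by simp
  also have "\<dots> \<le> (1/2) * (?r * norm ?w + ?s * norm ?w)"
    by (intro mult_left_mono add_mono sqrt_iter_norm_le A) auto
  also have "\<dots> = (1/2) * (?r + ?s) * norm ?w" by (simp add: algebra_simps)
  also have "\<dots> \<le> (1/2) * (?r + ?s) * ((?r - ?s) * norm x)"
    using sqrt_majorant_bounds[of n] sqrt_majorant_bounds[of "Suc n"]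
    by (intro mult_left_mono Suc) (auto simp del: sqrt_majorant.simps)
  also have "\<dots> = (sqrt_majorant (Suc (Suc n)) - ?r) * norm x"
  proof -
    have diff_squares: "(1/2) * (a + b) * (a - b) = (a\<^sup>2 - b\<^sup>2) / 2" for a b :: real
      by (simp add: power2_eq_square algebra_simps)
    have step: "(b\<^sup>2 - c\<^sup>2) / 2 = a - b" if "a = (1 + b\<^sup>2) / 2" "b = (1 + c\<^sup>2) / 2" for a b c :: real
      unfolding that(1) by (subst (2) that(2)) (simp add: diff_divide_distrib add_divide_distrib)
    have "(1/2) * (?r + ?s) * (?r - ?s) = (?r\<^sup>2 - ?s\<^sup>2) / 2"
      by (rule diff_squares)
    also have "\<dots> = sqrt_majorant (Suc (Suc n)) - ?r"
      by (rule step[OF sqrt_majorant.simps(2) sqrt_majorant.simps(2)])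
    finally show ?thesis by simp
  qed
  finally show ?case .
qed

lemma sqrt_iter_convergent:
  fixes A :: "'a::chilbert_space \<Rightarrow> 'a"
  assumes A: "bounded_clinear A" "\<And>x. norm (A x) \<le> norm x"
  shows "\<exists>y. (\<lambda>n. sqrt_iter A n x) \<longlonglongrightarrow> y"
proof -
  have mono: "incseq sqrt_majorant" by (rule incseq_SucI) (rule sqrt_majorant_mono)
  then obtain l where "sqrt_majorant \<longlonglongrightarrow> l"
    using incseq_convergent[of sqrt_majorant 1] sqrt_majorant_bounds by blast
  then have C: "Cauchy sqrt_majorant" by (rule LIMSEQ_imp_Cauchy)
  have bd: "norm (sqrt_iter A (m + k) x - sqrt_iter A m x)
      \<le> (sqrt_majorant (m + k) - sqrt_majorant m) * norm x" for m k
  proof (induction k)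
    case (Suc k)
    have "sqrt_iter A (m + Suc k) x - sqrt_iter A m x
        = (sqrt_iter A (Suc (m + k)) x - sqrt_iter A (m + k) x)
          + (sqrt_iter A (m + k) x - sqrt_iter A m x)" by simp
    then have "norm (sqrt_iter A (m + Suc k) x - sqrt_iter A m x)
        \<le> norm (sqrt_iter A (Suc (m + k)) x - sqrt_iter A (m + k) x)
          + norm (sqrt_iter A (m + k) x - sqrt_iter A m x)"
      by (simp only: norm_triangle_ineq)
    also have "\<dots> \<le> (sqrt_majorant (Suc (m + k)) - sqrt_majorant (m + k)) * norm x
        + (sqrt_majorant (m + k) - sqrt_majorant m) * norm x"
      by (intro add_mono sqrt_iter_diff_norm_le A Suc)
    finally show ?case by (simp only: add_Suc_right) (simp only: algebra_simps; simp)
  qed simp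
  have "Cauchy (\<lambda>n. sqrt_iter A n x)"
  proof (rule CauchyI')
    fix e :: real assume "e > 0"
    then have "e / (norm x + 1) > 0" by (simp add: add_nonneg_pos)
    from CauchyD[OF C this] obtain M where
      M: "\<And>m n. m \<ge> M \<Longrightarrow> n \<ge> M \<Longrightarrow> norm (sqrt_majorant m - sqrt_majorant n) < e / (norm x + 1)"
      by blast
    have "norm (sqrt_iter A m x - sqrt_iter A n x) < e" if "m \<ge> M" "n > m" for m n
    proof -
      have "norm (sqrt_iter A n x - sqrt_iter A m x) \<le> (sqrt_majorant n - sqrt_majorant m) * norm x"
        using bd[of m "n - m"] that(2) by simp
      also have "\<dots> \<le> (sqrt_majorant n - sqrt_majorant m) * (norm x + 1)"
        using incseqD[OF mono, of m n] that by (intro mult_left_mono) auto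
      also have "\<dots> < e"
        using M[of n m] that by (simp add: pos_less_divide_eq add_nonneg_pos abs_less_iff)
      finally show ?thesis by (simp add: norm_minus_commute)
    qed
    then show "\<exists>M. \<forall>m\<ge>M. \<forall>n>m. dist (sqrt_iter A m x) (sqrt_iter A n x) < e"
      unfolding dist_norm by blast
  qed
  then show ?thesis using Cauchy_convergent convergent_def by blast
qed

text \<open>The limit \<open>Y\<close> satisfies Y = (A + Y Y) / 2, that is (I - Y)(I - Y) = I - A,
  and \<open>I - Y\<close> is positive because \<open>Y\<close> is a contraction. The commutation
  property is carried along because the uniqueness of positive roots will rest on it.\<close>

lemma contraction_sqrt:
  fixes A :: "'a::chilbert_space \<Rightarrow> 'a"
  assumes A: "selfadjoint A" "\<And>x. norm (A x) \<le> norm x"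
  shows "\<exists>S. positive_op S \<and> (\<forall>x. S (S x) = x - A x) \<and>
    (\<forall>C. bounded_clinear C \<longrightarrow> (\<forall>x. C (A x) = A (C x)) \<longrightarrow> (\<forall>x. C (S x) = S (C x)))"
proof -
  have bA: "bounded_clinear A" using A(1) by (rule selfadjoint_bounded_clinear)
  obtain Y where Y: "\<And>x. (\<lambda>n. sqrt_iter A n x) \<longlonglongrightarrow> Y x"
    using sqrt_iter_convergent[OF bA A(2)] by metis
  note bI = bounded_clinear_sqrt_iter[OF bA]
  have I1: "norm (sqrt_iter A n x) \<le> norm x" for n x
    using sqrt_iter_norm_le[OF bA A(2), of n x] sqrt_majorant_bounds[of n]
      mult_right_mono[of "sqrt_majorant n" 1 "norm x"] by auto
  have Yn: "norm (Y x) \<le> norm x" for x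
    by (rule LIMSEQ_le_const2[OF tendsto_norm[OF Y]]) (use I1 in blast)
  have bY: "bounded_clinear Y"
  proof (rule bounded_clinearI[where K = 1])
    fix x y
    have "(\<lambda>n. sqrt_iter A n (x + y)) \<longlonglongrightarrow> Y x + Y y"
      unfolding bounded_clinear_simps(1)[OF bI] by (intro tendsto_add Y)
    then show "Y (x + y) = Y x + Y y" using LIMSEQ_unique Y by blast
  next
    fix c x
    have "(\<lambda>n. sqrt_iter A n (c *\<^sub>C x)) \<longlonglongrightarrow> c *\<^sub>C Y x"
      unfolding bounded_clinear_simps(5)[OF bI] by (rule bounded_clinear_tendsto[OF bounded_clinear_scaleC Y])
    then show "Y (c *\<^sub>C x) = c *\<^sub>C Y x" using LIMSEQ_unique Y by blast
  qed (simp add: Yn)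
  have sY: "selfadjoint Y"
  proof (rule selfadjointI[OF bY])
    fix x y
    have "(\<lambda>n. cinner (sqrt_iter A n x) y) \<longlonglongrightarrow> cinner (Y x) y"
      by (intro tendsto_cinner Y tendsto_const)
    moreover have "(\<lambda>n. cinner (sqrt_iter A n x) y) \<longlonglongrightarrow> cinner x (Y y)"
      unfolding selfadjoint_cinner[OF selfadjoint_sqrt_iter[OF A(1)]]
      by (intro tendsto_cinner Y tendsto_const)
    ultimately show "cinner (Y x) y = cinner x (Y y)" by (rule LIMSEQ_unique)
  qed
  \<comment> \<open>Pointwise convergence survives squaring because all iterates are
    contractions.\<close>
  have Y2: "(\<lambda>n. sqrt_iter A n (sqrt_iter A n x)) \<longlonglongrightarrow> Y (Y x)" for x
  proof (rule Lim_transform)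
    show "(\<lambda>n. sqrt_iter A n (Y x)) \<longlonglongrightarrow> Y (Y x)" by (rule Y)
    have "(\<lambda>n. sqrt_iter A n x - Y x) \<longlonglongrightarrow> Y x - Y x"
      by (intro tendsto_diff Y tendsto_const)
    then have z: "(\<lambda>n. norm (sqrt_iter A n x - Y x)) \<longlonglongrightarrow> 0" by (simp add: tendsto_norm_zero)
    show "(\<lambda>n. sqrt_iter A n (sqrt_iter A n x) - sqrt_iter A n (Y x)) \<longlonglongrightarrow> 0"
      by (rule Lim_null_comparison[OF _ z])
        (simp add: bounded_clinear_simps(2)[OF bI, symmetric] I1)
  qed
  have fix_eq: "Y x = (1/2) *\<^sub>R (A x + Y (Y x))" for x
  proof -
    have "(\<lambda>n. sqrt_iter A (Suc n) x) \<longlonglongrightarrow> (1/2) *\<^sub>R (A x + Y (Y x))"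
      unfolding sqrt_iter.simps by (intro tendsto_intros Y2)
    then show ?thesis using LIMSEQ_unique[OF LIMSEQ_Suc[OF Y]] by blast
  qed
  define S where "S x = x - Y x" for x
  have "selfadjoint S" unfolding S_def[abs_def] by (intro selfadjoint_diff selfadjoint_id sY)
  moreover have "0 \<le> Re (cinner (S x) x)" for x
  proof -
    have "Re (cinner (Y x) x) \<le> norm (Y x) * norm x"
      using Re_cinner_le abs_le_D1 by blast
    also have "\<dots> \<le> norm x * norm x" by (intro mult_right_mono Yn) simp
    finally show ?thesis by (simp add: S_def cinner_diff_left Re_cinner_self power2_eq_square)
  qed
  moreover have "S (S x) = x - A x" for x
  proof -
    have "S (S x) = x - 2 *\<^sub>R Y x + Y (Y x)"
      by (simp add: S_def bounded_clinear_simps[OF bY] scaleR_2)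
    also have "2 *\<^sub>R Y x = A x + Y (Y x)" by (subst fix_eq) simp
    finally show ?thesis by simp
  qed
  moreover have "C (S x) = S (C x)" if C: "bounded_clinear C" "\<forall>x. C (A x) = A (C x)" for C x
  proof -
    have "(\<lambda>n. C (sqrt_iter A n x)) \<longlonglongrightarrow> C (Y x)" by (rule bounded_clinear_tendsto[OF C(1) Y])
    moreover have "(\<lambda>n. C (sqrt_iter A n x)) \<longlonglongrightarrow> Y (C x)"
      unfolding sqrt_iter_commute[OF C(1) bA C(2)[rule_format]] by (rule Y)
    ultimately have "C (Y x) = Y (C x)" by (rule LIMSEQ_unique)
    then show ?thesis by (simp add: S_def bounded_clinear_simps[OF C(1)])
  qed
  ultimately show ?thesis unfolding positive_op_def by blast
qed

text \<open>If \<open>K\<close> bounds the norm of \<open>B\<close>, then I - B/K is a positive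
  contraction. The root obtained for B/K is rescaled by \<open>sqrt K\<close>.\<close>

lemma positive_op_sqrt_exists:
  fixes B :: "'a::chilbert_space \<Rightarrow> 'a"
  assumes "positive_op B"
  shows "\<exists>S. positive_op S \<and> (\<forall>x. S (S x) = B x) \<and>
    (\<forall>C. bounded_clinear C \<longrightarrow> (\<forall>x. C (B x) = B (C x)) \<longrightarrow> (\<forall>x. C (S x) = S (C x)))"
proof -
  have sB: "selfadjoint B" using assms by (rule positive_op_selfadjoint)
  then have bB: "bounded_clinear B" by (rule selfadjoint_bounded_clinear)
  obtain K where K: "K > 0" "\<And>x. norm (B x) \<le> K * norm x"
    using bounded_clinear_bound[OF bB] by blast
  define A where "A x = x - (1 / K) *\<^sub>R B x" for x
  have sA: "selfadjoint A"
    unfolding A_def[abs_def] by (intro selfadjoint_diff selfadjoint_id selfadjoint_scaleR sB)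
  have form: "Re (cinner (A x) x) = (norm x)\<^sup>2 - Re (cinner (B x) x) / K" for x
    by (simp add: A_def cinner_algebra Re_cinner_self)
  have "Re (cinner (B x) x) \<le> K * (norm x)\<^sup>2" for x
  proof -
    have "Re (cinner (B x) x) \<le> norm (B x) * norm x" using Re_cinner_le abs_le_D1 by blast
    also have "\<dots> \<le> K * norm x * norm x" by (intro mult_right_mono K) simp
    finally show ?thesis by (simp add: power2_eq_square)
  qed
  then have pA: "positive_op A"
    using K(1) by (simp add: positive_op_def sA form pos_divide_le_eq mult.commute)
  have "norm (A x) \<le> norm x" for x
    using K(1) positive_op_form[OF assms]
    by (intro positive_contraction_norm_le pA) (simp add: form)
  from contraction_sqrt[OF sA this] obtain S where S: "positive_op S" "\<And>x. S (S x) = x - A x"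
    "\<And>C x. bounded_clinear C \<Longrightarrow> (\<And>x. C (A x) = A (C x)) \<Longrightarrow> C (S x) = S (C x)"
    by metis
  have bS: "bounded_clinear S" using S(1) positive_op_selfadjoint selfadjoint_bounded_clinear by blast
  define R where "R x = sqrt K *\<^sub>R S x" for x
  have "positive_op R"
    using S(1) K(1) unfolding positive_op_def R_def[abs_def]
    by (auto intro: selfadjoint_scaleR simp: cinner_algebra)
  moreover have "R (R x) = B x" for x
    using K(1) by (simp add: R_def bounded_clinear_simps[OF bS] S(2) A_def)
  moreover have "C (R x) = R (C x)" if C: "bounded_clinear C" "\<forall>x. C (B x) = B (C x)" for C x
    using S(3)[OF C(1)] C(2) by (simp add: A_def R_def bounded_clinear_simps[OF C(1)])
  ultimately show ?thesis by blast
qed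

text \<open>For \<open>U = S - T\<close>, the product of \<open>S + T\<close> and \<open>U\<close>
  is 0. So the forms of \<open>S\<close> and \<open>T\<close> at \<open>U x\<close>, both
  nonnegative, add up to 0; both operators kill \<open>U x\<close>, and \<open>U\<close> squares to
  0.\<close>

lemma positive_op_sqrt_unique:
  fixes S T :: "'a::chilbert_space \<Rightarrow> 'a"
  assumes S: "positive_op S" and T: "positive_op T" and eq: "\<And>x. S (S x) = T (T x)"
    and comm: "\<And>x. S (T x) = T (S x)"
  shows "S = T"
proof
  fix x
  note bS = bounded_clinear_simps[OF selfadjoint_bounded_clinear[OF positive_op_selfadjoint[OF S]]]
  note bT = bounded_clinear_simps[OF selfadjoint_bounded_clinear[OF positive_op_selfadjoint[OF T]]]
  define U where "U x = S x - T x" for x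
  have sU: "selfadjoint U"
    unfolding U_def[abs_def] using S T by (intro selfadjoint_diff positive_op_selfadjoint)
  have null: "S (U x) + T (U x) = 0" for x
    by (simp add: U_def bS bT eq comm)
  have "U (U x) = 0" for x
  proof -
    let ?y = "U x"
    have "Re (cinner (S ?y) ?y) + Re (cinner (T ?y) ?y) = 0"
      using null[of x] by (metis cinner_add_left cinner_zero_left plus_complex.sel(1) zero_complex.sel(1))
    then have "S ?y = 0" "T ?y = 0"
      using positive_op_form[OF S, of ?y] positive_op_form[OF T, of ?y]
      by (auto intro!: positive_op_null[OF S] positive_op_null[OF T])
    then show ?thesis by (simp add: U_def)
  qed
  then have "U x = 0" by (rule selfadjoint_nilpotent[OF sU])
  then show "S x = T x" by (simp add: U_def)
qed

text \<open>Two positive roots are not known to commute in advance. The constructed root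
  \<open>R\<close> commutes with everything that commutes with \<open>B\<close>, in particular with
  any other root, so every root equals \<open>R\<close>.\<close>

lemma op_sqrt_eqI:
  fixes B :: "'a::chilbert_space \<Rightarrow> 'a"
  assumes "positive_op S" "\<And>x. S (S x) = B x"
  shows "op_sqrt B = S"
proof -
  have sS: "selfadjoint S" using assms(1) by (rule positive_op_selfadjoint)
  have "B = (\<lambda>x. S (S x))" using assms(2) by auto
  moreover have "selfadjoint (\<lambda>x. S (S x))" by (rule selfadjoint_square[OF sS])
  moreover have "0 \<le> Re (cinner (S (S x)) x)" for x
    by (simp add: selfadjoint_cinner[OF sS, of "S x" x] Re_cinner_self)
  ultimately have "positive_op B" by (simp add: positive_op_def)
  from positive_op_sqrt_exists[OF this] obtain R where R: "positive_op R" "\<And>x. R (R x) = B x"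
    "\<And>C x. bounded_clinear C \<Longrightarrow> (\<And>x. C (B x) = B (C x)) \<Longrightarrow> C (R x) = R (C x)"
    by metis
  have eq: "T = R" if T: "positive_op T" "\<And>x. T (T x) = B x" for T
  proof (rule positive_op_sqrt_unique[OF T(1) R(1)])
    show "T (T x) = R (R x)" for x by (simp add: T(2) R(2))
    show "T (R x) = R (T x)" for x
      using T by (intro R(3) selfadjoint_bounded_clinear positive_op_selfadjoint) (simp_all flip: T(2))
  qed
  show ?thesis
    unfolding op_sqrt_def
  proof (rule the_equality)
    show "selfadjoint S \<and> (\<forall>f. 0 \<le> Re (cinner (S f) f)) \<and> S \<circ> S = B"
      using assms by (auto simp: positive_op_def)
    fix T assume "selfadjoint T \<and> (\<forall>f. 0 \<le> Re (cinner (T f) f)) \<and> T \<circ> T = B"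
    then have "T = R" by (intro eq) (auto simp: positive_op_def)
    moreover have "S = R" by (intro eq assms)
    ultimately show "T = S" by simp
  qed
qed

lemma op_sqrt:
  fixes B :: "'a::chilbert_space \<Rightarrow> 'a"
  assumes "positive_op B"
  shows "positive_op (op_sqrt B)" "op_sqrt B (op_sqrt B x) = B x"
    "bounded_clinear C \<Longrightarrow> (\<And>x. C (B x) = B (C x)) \<Longrightarrow> C (op_sqrt B x) = op_sqrt B (C x)"
proof -
  from positive_op_sqrt_exists[OF assms] obtain R where R: "positive_op R" "\<And>x. R (R x) = B x"
    "\<And>C x. bounded_clinear C \<Longrightarrow> (\<And>x. C (B x) = B (C x)) \<Longrightarrow> C (R x) = R (C x)"
    by metis
  have eq: "op_sqrt B = R" by (rule op_sqrt_eqI[OF R(1,2)])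
  show "positive_op (op_sqrt B)" "op_sqrt B (op_sqrt B x) = B x"
    "bounded_clinear C \<Longrightarrow> (\<And>x. C (B x) = B (C x)) \<Longrightarrow> C (op_sqrt B x) = op_sqrt B (C x)"
    unfolding eq using R by auto
qed

lemma op_abs:
  fixes X :: "'a::chilbert_space \<Rightarrow> 'a"
  assumes "selfadjoint X"
  shows "positive_op (op_abs X)" "op_abs X (op_abs X x) = X (X x)"
    "bounded_clinear C \<Longrightarrow> (\<And>x. C (X x) = X (C x)) \<Longrightarrow> C (op_abs X x) = op_abs X (C x)"
proof -
  have *: "positive_op (X \<circ> X)"
    using selfadjoint_square[OF assms]
    by (simp add: positive_op_def comp_def selfadjoint_cinner[OF assms, of "X _" _] Re_cinner_self)
  show "positive_op (op_abs X)" "op_abs X (op_abs X x) = X (X x)"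
    "bounded_clinear C \<Longrightarrow> (\<And>x. C (X x) = X (C x)) \<Longrightarrow> C (op_abs X x) = op_abs X (C x)"
    unfolding op_abs_def using op_sqrt[OF *] by auto
qed

section \<open>Projections and Stieltjes integrals\<close>

lemma orth_projection_simps:
  fixes P :: "'a::chilbert_space \<Rightarrow> 'a"
  assumes "orth_projection P"
  shows "selfadjoint P" "bounded_clinear P" "P (P x) = P x" "cinner (P x) y = cinner x (P y)"
    "Re (cinner (P x) x) = (norm (P x))\<^sup>2" "(norm x)\<^sup>2 = (norm (P x))\<^sup>2 + (norm (x - P x))\<^sup>2"
    "norm (P x) \<le> norm x"
proof -
  show s: "selfadjoint P" using assms by (simp add: orth_projection_def)
  then show "bounded_clinear P" by (rule selfadjoint_bounded_clinear)
  have "(P \<circ> P) x = P x" using assms unfolding orth_projection_def by metis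
  then show i: "P (P x) = P x" by simp
  show c: "cinner (P x) y = cinner x (P y)" for x y by (rule selfadjoint_cinner[OF s])
  show q: "Re (cinner (P x) x) = (norm (P x))\<^sup>2"
    using c[of "P x" x] i by (simp add: Re_cinner_self)
  have "Re (cinner x (P x)) = (norm (P x))\<^sup>2" using q c[of x x] by simp
  then show d: "(norm x)\<^sup>2 = (norm (P x))\<^sup>2 + (norm (x - P x))\<^sup>2"
    using q by (simp only: Re_cinner_self[symmetric] cinner_diff_left cinner_diff_right) simp
  then have "(norm (P x))\<^sup>2 \<le> (norm x)\<^sup>2" by simp
  then show "norm (P x) \<le> norm x" by (rule power2_le_imp_le) simp
qed

lemma orth_projection_complement:
  fixes P :: "'a::chilbert_space \<Rightarrow> 'a"
  assumes "orth_projection P"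
  shows "orth_projection (\<lambda>x. x - P x)"
proof -
  note P = orth_projection_simps[OF assms]
  have "selfadjoint (\<lambda>x. x - P x)" by (intro selfadjoint_diff selfadjoint_id P(1))
  then show ?thesis by (auto simp: orth_projection_def bounded_clinear_simps[OF P(2)] P(3))
qed

lemma orth_projection_diff_norm:
  fixes P Q :: "'a::chilbert_space \<Rightarrow> 'a"
  assumes "orth_projection P" "orth_projection Q" and PQ: "P (Q x) = P x"
  shows "(norm (Q x - P x))\<^sup>2 = (norm (Q x))\<^sup>2 - (norm (P x))\<^sup>2" "norm (P x) \<le> norm (Q x)"
proof -
  show *: "(norm (Q x - P x))\<^sup>2 = (norm (Q x))\<^sup>2 - (norm (P x))\<^sup>2"
    using orth_projection_simps(6)[OF assms(1), of "Q x"] PQ by simp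
  then have "(norm (P x))\<^sup>2 \<le> (norm (Q x))\<^sup>2" using zero_le_power2[of "norm (Q x - P x)"] by linarith
  then show "norm (P x) \<le> norm (Q x)" by (rule power2_le_imp_le) simp
qed

text \<open>The squared norm of \<open>Q n x\<close> increases and is bounded, and its increments
  are the squared norms of the increments of \<open>Q n x\<close>. The limit serves for right limits
  (through complements) and for left limits of a spectral family.\<close>

lemma increasing_projections_limit:
  fixes Q :: "nat \<Rightarrow> 'a::chilbert_space \<Rightarrow> 'a"
  assumes Q: "\<And>n. orth_projection (Q n)" and mono: "\<And>m n x. m \<le> n \<Longrightarrow> Q m (Q n x) = Q m x"
    "\<And>m n x. m \<le> n \<Longrightarrow> Q n (Q m x) = Q m x"
  obtains P where "orth_projection P" "\<And>x. (\<lambda>n. Q n x) \<longlonglongrightarrow> P x"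
    "\<And>n x. Q n (P x) = Q n x" "\<And>n x. P (Q n x) = Q n x"
proof -
  note lin = bounded_clinear_simps[OF orth_projection_simps(2)[OF Q]]
  have "convergent (\<lambda>n. Q n x)" for x
  proof -
    let ?a = "\<lambda>n. (norm (Q n x))\<^sup>2"
    have inc: "incseq ?a"
      by (intro incseq_SucI power_mono orth_projection_diff_norm Q mono) auto
    have "?a n \<le> (norm x)\<^sup>2" for n
      using orth_projection_simps(7)[OF Q] by (intro power_mono) auto
    then obtain l where "?a \<longlonglongrightarrow> l" using incseq_convergent[OF inc] by blast
    then have C: "Cauchy ?a" by (rule LIMSEQ_imp_Cauchy)
    have "Cauchy (\<lambda>n. Q n x)"
    proof (rule CauchyI')
      fix e :: real assume "e > 0"
      then have "e\<^sup>2 > 0" by simp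
      from CauchyD[OF C this] obtain M where
        M: "\<And>m n. m \<ge> M \<Longrightarrow> n \<ge> M \<Longrightarrow> norm (?a m - ?a n) < e\<^sup>2" by blast
      have "dist (Q m x) (Q n x) < e" if "m \<ge> M" "n > m" for m n
      proof -
        have "(norm (Q n x - Q m x))\<^sup>2 = ?a n - ?a m"
          using that by (intro orth_projection_diff_norm Q mono) auto
        also have "\<dots> < e\<^sup>2" using M[of n m] that by (simp add: abs_less_iff)
        finally show ?thesis using \<open>e > 0\<close>
          by (simp add: dist_norm norm_minus_commute power2_less_imp_less)
      qed
      then show "\<exists>M. \<forall>m\<ge>M. \<forall>n>m. dist (Q m x) (Q n x) < e" by blast
    qed
    then show ?thesis by (rule Cauchy_convergent)
  qed
  then obtain P where P: "\<And>x. (\<lambda>n. Q n x) \<longlonglongrightarrow> P x" unfolding convergent_def by metis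
  have bP: "bounded_clinear P"
  proof (rule bounded_clinearI[where K = 1])
    fix x y
    have "(\<lambda>n. Q n (x + y)) \<longlonglongrightarrow> P x + P y" unfolding lin by (intro tendsto_add P)
    then show "P (x + y) = P x + P y" using LIMSEQ_unique P by blast
  next
    fix c x
    have "(\<lambda>n. Q n (c *\<^sub>C x)) \<longlonglongrightarrow> c *\<^sub>C P x"
      unfolding lin by (rule bounded_clinear_tendsto[OF bounded_clinear_scaleC P])
    then show "P (c *\<^sub>C x) = c *\<^sub>C P x" using LIMSEQ_unique P by blast
  next
    fix x show "norm (P x) \<le> norm x * 1"
      using LIMSEQ_le_const2[OF tendsto_norm[OF P[of x]], of "norm x"] orth_projection_simps(7)[OF Q]
      by auto
  qed
  have sP: "selfadjoint P"
  proof (rule selfadjointI[OF bP])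
    fix x y
    have "(\<lambda>n. cinner (Q n x) y) \<longlonglongrightarrow> cinner (P x) y"
      by (intro tendsto_cinner P tendsto_const)
    moreover have "(\<lambda>n. cinner (Q n x) y) \<longlonglongrightarrow> cinner x (P y)"
      unfolding orth_projection_simps(4)[OF Q] by (intro tendsto_cinner P tendsto_const)
    ultimately show "cinner (P x) y = cinner x (P y)" by (rule LIMSEQ_unique)
  qed
  have PQ: "P (Q n x) = Q n x" for n x
  proof -
    have "(\<lambda>k. Q k (Q n x)) \<longlonglongrightarrow> Q n x"
      using mono(2)[of n _ x] by (intro tendsto_eventually) (auto simp: eventually_sequentially)
    then show ?thesis using LIMSEQ_unique P by blast
  qed
  have QP: "Q n (P x) = Q n x" for n x
  proof -
    have "(\<lambda>k. Q n (Q k x)) \<longlonglongrightarrow> Q n (P x)"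
      by (rule bounded_clinear_tendsto[OF orth_projection_simps(2)[OF Q] P])
    moreover have "(\<lambda>k. Q n (Q k x)) \<longlonglongrightarrow> Q n x"
      using mono(1)[of n _ x] by (intro tendsto_eventually) (auto simp: eventually_sequentially)
    ultimately show ?thesis by (rule LIMSEQ_unique)
  qed
  have "P (P x) = P x" for x using P[of "P x"] P[of x] unfolding QP by (rule LIMSEQ_unique)
  then have "orth_projection P" using sP by (auto simp: orth_projection_def)
  then show ?thesis using that P QP PQ by blast
qed

text \<open>\<open>F\<close> is constant up to and including \<open>a\<close>, so all mass sits in
  the half-open interval \<open>{a<..b}\<close>.\<close>

locale distribution_on =
  fixes F :: "real \<Rightarrow> real" and a b :: real
  assumes mono: "\<And>s t. s \<le> t \<Longrightarrow> F s \<le> F t" and right_cont: "\<And>t. continuous (at_right t) F"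
    and less: "a < b" and left: "\<And>t. t \<le> a \<Longrightarrow> F t = F a" and right: "\<And>t. b \<le> t \<Longrightarrow> F t = F b"
begin

lemma emeasure_Ioc: "s \<le> t \<Longrightarrow> emeasure (interval_measure F) {s<..t} = ennreal (F t - F s)"
  by (rule emeasure_interval_measure_Ioc) (auto intro: mono right_cont)

lemma measure_Ioc: "s \<le> t \<Longrightarrow> measure (interval_measure F) {s<..t} = F t - F s"
  unfolding measure_def by (simp add: emeasure_Ioc mono)

lemma AE_support: "AE t in interval_measure F. t \<in> {a<..b}"
proof -
  have "(\<Union>n. {a - real n<..a}) \<in> null_sets (interval_measure F)"
    by (intro null_sets_UN) (auto simp: null_sets_def emeasure_Ioc left[of "a - real n" for n])
  moreover have "(\<Union>n. {b<..b + real n}) \<in> null_sets (interval_measure F)"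
    by (intro null_sets_UN) (auto simp: null_sets_def emeasure_Ioc right[of "b + real n" for n])
  ultimately have "(\<Union>n. {a - real n<..a}) \<union> (\<Union>n. {b<..b + real n}) \<in> null_sets (interval_measure F)"
    by (rule null_sets.Un)
  moreover have "t \<in> (\<Union>n. {a - real n<..a}) \<union> (\<Union>n. {b<..b + real n})" if "t \<notin> {a<..b}" for t
  proof (cases "t \<le> a")
    case True
    obtain n where "a - t < real n" using reals_Archimedean2 by blast
    then show ?thesis using True by (auto intro!: exI[of _ n])
  next
    case False
    obtain n where "t - b < real n" using reals_Archimedean2 by blast
    then show ?thesis using False that by (auto intro!: exI[of _ n])
  qed
  ultimately show ?thesis
    by (intro AE_I'[of "(\<Union>n. {a - real n<..a}) \<union> (\<Union>n. {b<..b + real n})"]) blast+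
qed

lemma emeasure_space: "emeasure (interval_measure F) UNIV = ennreal (F b - F a)"
proof -
  have "emeasure (interval_measure F) UNIV = emeasure (interval_measure F) {a<..b}"
    by (rule emeasure_eq_AE) (use AE_support in auto)
  then show ?thesis using emeasure_Ioc less by simp
qed

lemma measure_space: "measure (interval_measure F) UNIV = F b - F a"
  unfolding measure_def using mono[of a b] less by (simp add: emeasure_space)

sublocale finite_measure "interval_measure F"
  by standard (simp add: emeasure_space)

lemma integrable_id: "integrable (interval_measure F) (\<lambda>t. t)"
proof (rule integrable_const_bound)
  show "AE t in interval_measure F. norm t \<le> \<bar>a\<bar> + \<bar>b\<bar>"
    using AE_support by eventually_elim auto
qed simp

lemma integral_bounds:
  "a * (F b - F a) \<le> (LINT t|interval_measure F. t)"
  "(LINT t|interval_measure F. t) \<le> b * (F b - F a)"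
proof -
  have "(LINT t|interval_measure F. a) \<le> (LINT t|interval_measure F. t)"
    by (rule integral_mono_AE) (use AE_support in \<open>auto simp: integrable_id elim: eventually_mono\<close>)
  then show "a * (F b - F a) \<le> (LINT t|interval_measure F. t)"
    by (simp add: measure_space mult.commute)
  have "(LINT t|interval_measure F. t) \<le> (LINT t|interval_measure F. b)"
    by (rule integral_mono_AE) (use AE_support in \<open>auto simp: integrable_id elim: eventually_mono\<close>)
  then show "(LINT t|interval_measure F. t) \<le> b * (F b - F a)"
    by (simp add: measure_space mult.commute)
qed

end

definition grid :: "real \<Rightarrow> real \<Rightarrow> nat \<Rightarrow> nat \<Rightarrow> real" where
  "grid a b n i = a + real i * ((b - a) / real (Suc n))"

text \<open>Left tags make it a lower sum. On a fixed grid it is additive in \<open>F\<close>, which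
  allows integrals against different Stieltjes measures to be added through it.\<close>

definition riemann_sum :: "(real \<Rightarrow> real) \<Rightarrow> real \<Rightarrow> real \<Rightarrow> nat \<Rightarrow> real" where
  "riemann_sum F a b n =
    (\<Sum>i<Suc n. grid a b n i * (F (grid a b n (Suc i)) - F (grid a b n i)))"

lemma grid_ends: "grid a b n 0 = a" "grid a b n (Suc n) = b"
  by (simp_all add: grid_def del: of_nat_Suc)

lemma grid_step: "grid a b n (Suc i) = grid a b n i + (b - a) / real (Suc n)"
  unfolding grid_def of_nat_Suc[of i] distrib_right by (simp del: of_nat_Suc)

lemma grid_mono: "a \<le> b \<Longrightarrow> grid a b n i \<le> grid a b n (Suc i)"
  unfolding grid_step by simp

lemma grid_error_tendsto: "(\<lambda>n. (b - a) / real (Suc n) * c) \<longlonglongrightarrow> 0"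
  using tendsto_mult[OF tendsto_mult[OF tendsto_const[of "b - a"] LIMSEQ_inverse_real_of_nat] tendsto_const[of c]]
  by (simp add: divide_inverse)

lemma sum_indicator_Ioc:
  fixes p :: "nat \<Rightarrow> real"
  assumes "\<And>i. p i \<le> p (Suc i)"
  shows "(\<Sum>i<n. indicat_real {p i<..p (Suc i)} t) = indicat_real {p 0<..p n} t"
proof (induction n)
  case (Suc n)
  have "p 0 \<le> p n" using lift_Suc_mono_le[of p 0 n] assms by blast
  then show ?case using Suc assms[of n] by (auto simp: indicator_def)
qed simp

text \<open>The sum is the integral of the step function that sends each grid cell to its left end,
  and on \<open>{a<..b}\<close> this moves \<open>t\<close> by at most the mesh.\<close>

lemma (in distribution_on) riemann_sum_error:
  "\<bar>(LINT t|interval_measure F. t) - riemann_sum F a b n\<bar> \<le> (b - a) / real (Suc n) * (F b - F a)"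
proof -
  define p where "p = grid a b n"
  define h where "h = (b - a) / real (Suc n)"
  have p: "p 0 = a" "p (Suc n) = b" "p i \<le> p (Suc i)" "p (Suc i) = p i + h" for i
    using grid_mono[of a b n i] less by (auto simp: p_def grid_ends grid_step h_def)
  define s where "s t = (\<Sum>i<Suc n. p i * indicat_real {p i<..p (Suc i)} t)" for t
  have int_s: "(LINT t|interval_measure F. s t) = riemann_sum F a b n"
    unfolding s_def riemann_sum_def p_def[symmetric]
    by (subst Bochner_Integration.integral_sum)
      (auto simp: measure_Ioc p(3) emeasure_eq_measure integrable_real_mult_indicator
        simp del: sum.lessThan_Suc intro!: integrable_real_indicator)
  have [measurable]: "s \<in> borel_measurable (interval_measure F)"
    unfolding s_def[abs_def] by (intro borel_measurable_sum borel_measurable_times) auto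
  have bd: "\<bar>t - s t\<bar> \<le> h" if t: "t \<in> {a<..b}" for t
  proof -
    have one: "(\<Sum>i<Suc n. indicat_real {p i<..p (Suc i)} t) = 1"
      using sum_indicator_Ioc[of p t "Suc n"] p t by (simp del: sum.lessThan_Suc)
    have "t - s t = (\<Sum>i<Suc n. t * indicat_real {p i<..p (Suc i)} t) - s t"
      by (simp only: sum_distrib_left[symmetric] one mult_1_right)
    also have "\<dots> = (\<Sum>i<Suc n. (t - p i) * indicat_real {p i<..p (Suc i)} t)"
      unfolding s_def by (simp only: sum_subtractf[symmetric] left_diff_distrib)
    also have "\<bar>\<dots>\<bar> \<le> (\<Sum>i<Suc n. \<bar>(t - p i) * indicat_real {p i<..p (Suc i)} t\<bar>)"
      by (rule sum_abs)
    also have "\<dots> \<le> (\<Sum>i<Suc n. h * indicat_real {p i<..p (Suc i)} t)"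
      by (rule sum_mono) (auto simp: p(4) indicator_def)
    also have "\<dots> = h" by (simp only: sum_distrib_left[symmetric] one mult_1_right)
    finally show ?thesis .
  qed
  have int_step: "integrable (interval_measure F) s"
  proof (rule integrable_const_bound)
    show "AE t in interval_measure F. norm (s t) \<le> \<bar>a\<bar> + \<bar>b\<bar> + h"
      using AE_support
    proof eventually_elim
      case (elim t)
      then show ?case using bd[OF elim] by auto
    qed
  qed simp
  have "\<bar>(LINT t|interval_measure F. t) - riemann_sum F a b n\<bar>
      = \<bar>LINT t|interval_measure F. t - s t\<bar>"
    by (simp add: int_s Bochner_Integration.integral_diff[OF integrable_id int_step])
  also have "\<dots> \<le> (LINT t|interval_measure F. \<bar>t - s t\<bar>)"
    by (rule integral_abs_bound)
  also have "\<dots> \<le> (LINT t|interval_measure F. h)"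
    by (rule integral_mono_AE)
      (use AE_support bd in \<open>auto simp: integrable_id int_step elim: eventually_mono\<close>)
  finally show ?thesis by (simp add: measure_space h_def mult.commute)
qed

lemma (in distribution_on) riemann_sum_tendsto:
  "riemann_sum F a b \<longlonglongrightarrow> (LINT t|interval_measure F. t)"
proof -
  have "(\<lambda>n. riemann_sum F a b n - (LINT t|interval_measure F. t)) \<longlonglongrightarrow> 0"
    by (rule Lim_null_comparison[OF always_eventually grid_error_tendsto[of b a "F b - F a"]])
      (use riemann_sum_error in \<open>auto simp: abs_minus_commute\<close>)
  then show ?thesis by (simp add: LIM_zero_iff)
qed

section \<open>The spectral theorem\<close>

text \<open>\<open>zero\<close> and \<open>one\<close> concern the single vector \<open>f\<close>,
  so the interval can be cut at \<open>s\<close> whenever \<open>E s\<close> kills or fixes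
  \<open>f\<close>.\<close>

lemma spectral_family_distribution:
  fixes E :: "real \<Rightarrow> 'a::chilbert_space \<Rightarrow> 'a"
  assumes E: "\<And>t. orth_projection (E t)"
    and mono: "\<And>s t x. s \<le> t \<Longrightarrow> E s (E t x) = E s x"
    and right: "\<And>t x. ((\<lambda>s. E s x) \<longlongrightarrow> E t x) (at_right t)"
    and "a < b" and zero: "\<And>t. t \<le> a \<Longrightarrow> E t f = 0" and one: "\<And>t. b \<le> t \<Longrightarrow> E t f = f"
  shows "distribution_on (\<lambda>t. Re (cinner (E t f) f)) a b"
proof
  fix s t :: real assume "s \<le> t"
  then show "Re (cinner (E s f) f) \<le> Re (cinner (E t f) f)"
    unfolding orth_projection_simps(5)[OF E]
    by (intro power_mono orth_projection_diff_norm(2) E mono) auto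
next
  fix t
  have "((\<lambda>s. Re (cinner (E s f) f)) \<longlongrightarrow> Re (cinner (E t f) f)) (at_right t)"
    by (intro tendsto_Re tendsto_cinner right tendsto_const)
  then show "continuous (at_right t) (\<lambda>t. Re (cinner (E t f) f))"
    by (simp add: continuous_within)
qed (use assms in auto)

lemma spectral_familyD:
  fixes X :: "'a::chilbert_space \<Rightarrow> 'a"
  assumes "spectral_family X E"
  shows "orth_projection (E t)" "s \<le> t \<Longrightarrow> E s (E t x) = E s x" "s \<le> t \<Longrightarrow> E t (E s x) = E s x"
    "((\<lambda>s. E s x) \<longlongrightarrow> E t x) (at_right t)"
    "cinner (X x) x = of_real (LINT t|interval_measure (\<lambda>t. Re (cinner (E t x) x)). t)"
    "\<exists>L>0. (\<forall>t\<le>-L. \<forall>x. E t x = 0) \<and> (\<forall>t\<ge>L. \<forall>x. E t x = x)"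
proof -
  obtain M where M: "\<And>t. t < - M \<Longrightarrow> E t = (\<lambda>_. 0)" "\<And>t. t \<ge> M \<Longrightarrow> E t = id"
    using assms unfolding spectral_family_def by blast
  have "\<bar>M\<bar> + 1 > 0 \<and> (\<forall>t\<le>-(\<bar>M\<bar> + 1). \<forall>x. E t x = 0) \<and> (\<forall>t\<ge>\<bar>M\<bar> + 1. \<forall>x. E t x = x)"
    using M by auto
  then show "\<exists>L>0. (\<forall>t\<le>-L. \<forall>x. E t x = 0) \<and> (\<forall>t\<ge>L. \<forall>x. E t x = x)" by blast
qed (use assms in \<open>auto simp: spectral_family_def fun_eq_iff\<close>)

text \<open>If \<open>E s\<close> fixes \<open>f\<close>, the distribution function of
  \<open>f\<close> is constant from \<open>s\<close> on, so no mass lies above \<open>s\<close>; if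
  \<open>E s\<close> kills \<open>f\<close>, no mass lies at or below \<open>s\<close>.\<close>

lemma spectral_family_integral_bounds:
  fixes X :: "'a::chilbert_space \<Rightarrow> 'a"
  assumes E: "spectral_family X E"
  shows "E s f = f \<Longrightarrow> Re (cinner (X f) f) \<le> s * (norm f)\<^sup>2"
    and "E s f = 0 \<Longrightarrow> s * (norm f)\<^sup>2 \<le> Re (cinner (X f) f)"
proof -
  note E' = spectral_familyD[OF E]
  obtain L where L: "L > 0" "\<And>t x. t \<le> - L \<Longrightarrow> E t x = 0" "\<And>t x. t \<ge> L \<Longrightarrow> E t x = x"
    using E'(6) by blast
  have q: "Re (cinner (E t f) f) = (norm (E t f))\<^sup>2" for t
    by (rule orth_projection_simps(5)[OF E'(1)])
  have int: "Re (cinner (X f) f) = (LINT t|interval_measure (\<lambda>t. Re (cinner (E t f) f)). t)"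
    by (simp add: E'(5))
  show "Re (cinner (X f) f) \<le> s * (norm f)\<^sup>2" if s: "E s f = f"
  proof -
    \<comment> \<open>At most \<open>- L\<close>, where the family vanishes, and strictly below
      \<open>s\<close>, as the interval must not be empty.\<close>
    define a where "a = min (- L) (s - 1)"
    have up: "E t f = f" if "s \<le> t" for t using E'(3)[OF that, of f] s by simp
    have "distribution_on (\<lambda>t. Re (cinner (E t f) f)) a s"
      by (rule spectral_family_distribution[OF E'(1,2,4)]) (auto simp: a_def L(2) up)
    from distribution_on.integral_bounds(2)[OF this] show ?thesis
      unfolding int by (simp add: q up L(2) a_def Re_cinner_self)
  qed
  show "s * (norm f)\<^sup>2 \<le> Re (cinner (X f) f)" if s: "E s f = 0"
  proof -
    define b where "b = max L (s + 1)"
    have down: "E t f = 0" if "t \<le> s" for t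
      using E'(2)[OF that, of f] s bounded_clinear_simps(3)[OF orth_projection_simps(2)[OF E'(1)]]
      by metis
    have "distribution_on (\<lambda>t. Re (cinner (E t f) f)) s b"
      by (rule spectral_family_distribution[OF E'(1,2,4)]) (auto simp: b_def L(3) down)
    from distribution_on.integral_bounds(1)[OF this] show ?thesis
      unfolding int by (simp add: q down L(3) b_def Re_cinner_self)
  qed
qed

text \<open>The Riemann sums are additive in the distribution function, and the distribution function of
  \<open>u + v\<close> is the sum of those of \<open>u\<close> and \<open>v\<close> when \<open>E s\<close> separates them.\<close>

lemma spectral_family_reduces:
  fixes X :: "'a::chilbert_space \<Rightarrow> 'a"
  assumes X: "selfadjoint X" and E: "spectral_family X E"
  shows "X (E s x) = E s (X x)"
proof -
  note E' = spectral_familyD[OF E]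
  note linE = bounded_clinear_simps[OF orth_projection_simps(2)[OF E'(1)]]
  note linX = bounded_clinear_simps[OF selfadjoint_bounded_clinear[OF X]]
  obtain L where L: "L > 0" "\<And>t x. t \<le> - L \<Longrightarrow> E t x = 0" "\<And>t x. t \<ge> L \<Longrightarrow> E t x = x"
    using E'(6) by blast
  let ?F = "\<lambda>f t. Re (cinner (E t f) f)"
  have lim: "riemann_sum (?F f) (- L) L \<longlonglongrightarrow> Re (cinner (X f) f)" for f
  proof -
    have "distribution_on (?F f) (- L) L"
      by (rule spectral_family_distribution[OF E'(1,2,4)]) (use L in auto)
    from distribution_on.riemann_sum_tendsto[OF this] show ?thesis by (simp add: E'(5))
  qed
  have ortho: "Re (cinner (X u) v) = 0" if u: "E s u = u" and v: "E s v = 0" for u v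
  proof -
    \<comment> \<open>For every \<open>t\<close> the vector \<open>E t u\<close> stays in the range
      of \<open>E s\<close>, to which \<open>v\<close> is orthogonal.\<close>
    have z: "cinner (E t u) v = 0" for t
    proof (cases "t \<le> s")
      case True
      have "cinner (E t u) v = cinner (E s (E t u)) v" using E'(3)[OF True] by simp
      also have "\<dots> = 0" by (simp add: orth_projection_simps(4)[OF E'(1)] v)
      finally show ?thesis .
    next
      case False
      then have "E t u = u" using E'(3)[of s t u] u by simp
      then have "cinner (E t u) v = cinner (E s u) v" using u by simp
      also have "\<dots> = 0" by (simp add: orth_projection_simps(4)[OF E'(1)] v)
      finally show ?thesis .
    qed
    have z': "cinner (E t v) u = 0" for t
      using z[of t] orth_projection_simps(4)[OF E'(1)] cinner_commute complex_cnj_zero by metis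
    have F: "?F (u + v) = (\<lambda>t. ?F u t + ?F v t)"
      by (rule ext) (simp add: linE(1) cinner_add_left cinner_add_right z z')
    have "riemann_sum (?F (u + v)) (- L) L
        = (\<lambda>n. riemann_sum (?F u) (- L) L n + riemann_sum (?F v) (- L) L n)"
      unfolding F riemann_sum_def sum.distrib[symmetric]
      by (intro ext sum.cong refl) (simp add: algebra_simps)
    then have "riemann_sum (?F (u + v)) (- L) L \<longlonglongrightarrow> Re (cinner (X u) u) + Re (cinner (X v) v)"
      by (simp only:) (intro tendsto_add lim)
    then have "Re (cinner (X (u + v)) (u + v)) = Re (cinner (X u) u) + Re (cinner (X v) v)"
      using LIMSEQ_unique lim by blast
    moreover have "Re (cinner (X v) u) = Re (cinner (X u) v)"
      using selfadjoint_cinner[OF X, of u v] cinner_commute[of "X v" u] by simp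
    ultimately show ?thesis by (simp add: linX(1) cinner_add_left cinner_add_right)
  qed
  have ortho': "cinner (X u) v = 0" if u: "E s u = u" and v: "E s v = 0" for u v
    using ortho[OF u v] ortho[OF u, of "\<i> *\<^sub>C v"] v
    by (simp add: linE(5) cinner_scaleC_right complex_eq_iff)
  have EX: "E s (X u) = X u" if u: "E s u = u" for u
  proof -
    let ?v = "X u - E s (X u)"
    have v: "E s ?v = 0" by (simp add: linE(2) orth_projection_simps(3)[OF E'(1)])
    have "cinner (E s (X u)) ?v = 0" by (simp add: orth_projection_simps(4)[OF E'(1)] v)
    then have "cinner ?v ?v = 0" using ortho'[OF u v] by (simp add: cinner_diff_left)
    then show ?thesis by simp
  qed
  have EX0: "E s (X v) = 0" if v: "E s v = 0" for v
  proof -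
    let ?u = "E s (X v)"
    have u: "E s ?u = ?u" by (simp add: orth_projection_simps(3)[OF E'(1)])
    have "cinner ?u ?u = cinner (X v) ?u"
      using u by (simp add: orth_projection_simps(4)[OF E'(1)])
    also have "\<dots> = cinner v (X ?u)" by (rule selfadjoint_cinner[OF X])
    also have "\<dots> = cnj (cinner (X ?u) v)" by (rule cinner_commute)
    also have "\<dots> = 0" using ortho'[OF u v] by simp
    finally show ?thesis by simp
  qed
  have "E s (X (E s x)) = X (E s x)" by (rule EX) (rule orth_projection_simps(3)[OF E'(1)])
  moreover have "E s (X (x - E s x)) = 0"
    by (rule EX0) (simp add: linE(2) orth_projection_simps(3)[OF E'(1)])
  ultimately show ?thesis by (simp add: linX(2) linE(2))
qed

text \<open>The spectral projection for \<open>(-\<infinity>, t]\<close> is the projection onto the kernel of \<open>2 (X - t)\<^sub>+\<close>.\<close>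

lemma spectral_projection_exists:
  fixes X :: "'a::chilbert_space \<Rightarrow> 'a"
  assumes X: "selfadjoint X"
  shows "\<exists>E. orth_projection E \<and> (\<forall>C. selfadjoint C \<longrightarrow> (\<forall>x. C (X x) = X (C x)) \<longrightarrow> (\<forall>x. C (E x) = E (C x)))
    \<and> (\<forall>f. E f = f \<longrightarrow> Re (cinner (X f) f) \<le> t * (norm f)\<^sup>2)
    \<and> (\<forall>f. E f = 0 \<longrightarrow> f \<noteq> 0 \<longrightarrow> t * (norm f)\<^sup>2 < Re (cinner (X f) f))"
proof -
  note linX = bounded_clinear_simps[OF selfadjoint_bounded_clinear[OF X]]
  define B where "B x = X x - t *\<^sub>R x" for x
  have B: "selfadjoint B"
    unfolding B_def[abs_def] by (intro selfadjoint_diff selfadjoint_scaleR X selfadjoint_id)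
  note linB = bounded_clinear_simps[OF selfadjoint_bounded_clinear[OF B]]
  have form: "Re (cinner (X f) f) = t * (norm f)\<^sup>2 + Re (cinner (B f) f)" for f
    by (simp add: B_def cinner_algebra Re_cinner_self)
  define A where "A = op_abs B"
  note A = op_abs[OF B, folded A_def]
  have sA: "selfadjoint A" using A(1) by (rule positive_op_selfadjoint)
  note linA = bounded_clinear_simps[OF selfadjoint_bounded_clinear[OF sA]]
  have AB: "A (B x) = B (A x)" for x
    by (rule A(3)[symmetric]) (use selfadjoint_bounded_clinear[OF B] in auto)
  define W where "W x = A x + B x" for x
  have W: "selfadjoint W" unfolding W_def[abs_def] by (intro selfadjoint_add sA B)
  have bW: "bounded_clinear W" using W by (rule selfadjoint_bounded_clinear)
  note linW = bounded_clinear_simps[OF bW]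
  have "closed {x. W x = 0}"
    using continuous_closed_preimage_constant[of UNIV W 0]
      bounded_linear.continuous_on[OF bounded_clinear_imp[OF bW] continuous_on_id]
    by simp
  then obtain E where E: "orth_projection E" "range E = {x. W x = 0}"
    using orth_projection_exists[of "{x. W x = 0}"] by (auto simp: linW)
  note E' = orth_projection_simps[OF E(1)]
  note linE = bounded_clinear_simps[OF E'(2)]
  have WE: "W (E x) = 0" for x using E(2) by blast
  have fixE: "E x = x" if "W x = 0" for x
  proof -
    have "x \<in> range E" using E(2) that by blast
    then show ?thesis using E'(3) by auto
  qed
  have comm: "C (E x) = E (C x)" if C: "selfadjoint C" "\<And>x. C (X x) = X (C x)" for C x
  proof -
    have bC: "bounded_clinear C" using C(1) by (rule selfadjoint_bounded_clinear)
    note linC = bounded_clinear_simps[OF bC]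
    have CB: "C (B x) = B (C x)" for x by (simp add: B_def linC C(2))
    have CW: "C (W x) = W (C x)" for x using A(3)[OF bC CB] by (simp add: W_def linC CB)
    have ECE: "E (C (E x)) = C (E x)" for x
      by (rule fixE) (simp add: CW[symmetric] WE linC)
    \<comment> \<open>By \<open>ECE\<close> the range of \<open>E\<close> is invariant under
      \<open>C\<close>; as \<open>C\<close> is selfadjoint, so is its orthogonal complement.\<close>
    have "E (C (x - E x)) = 0"
    proof -
      let ?u = "E (C (x - E x))"
      have "cinner ?u ?u = cinner (C (x - E x)) ?u" by (metis E'(3,4))
      also have "\<dots> = cinner (x - E x) (E (C ?u))"
        using ECE[of "C (x - E x)"] by (simp add: selfadjoint_cinner[OF C(1)])
      also have "\<dots> = cinner (E (x - E x)) (C ?u)" by (simp add: E'(4))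
      also have "\<dots> = 0" by (simp add: linE E'(3))
      finally show ?thesis by simp
    qed
    then show ?thesis by (simp add: linC linE ECE)
  qed
  have ran: "Re (cinner (X f) f) \<le> t * (norm f)\<^sup>2" if "E f = f" for f
  proof -
    have "W f = 0" using WE[of f] that by simp
    then have "B f = - A f" by (simp add: W_def add_eq_0_iff)
    then show ?thesis using positive_op_form[OF A(1), of f] by (simp add: form cinner_minus_left)
  qed
  have ker: "t * (norm f)\<^sup>2 < Re (cinner (X f) f)" if f: "E f = 0" "f \<noteq> 0" for f
  proof -
    \<comment> \<open>As \<open>A\<close> and \<open>B\<close> commute and have equal squares,
      \<open>W = A + B\<close> annihilates \<open>?g\<close>, so \<open>E\<close> fixes it. Since
      \<open>E\<close> commutes with \<open>A\<close> and \<open>B\<close> and kills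
      \<open>f\<close>, it also kills \<open>?g\<close>. Hence \<open>A f = B f\<close>.\<close>
    let ?g = "A f - B f"
    have "W ?g = 0" by (simp add: W_def linA linB AB A(2))
    then have "E ?g = ?g" by (rule fixE)
    moreover have "E ?g = A (E f) - B (E f)"
    proof -
      have "B (E x) = E (B x)" for x
        by (rule comm[OF B]) (simp add: B_def linX)
      moreover have "A (E x) = E (A x)" for x
        by (intro comm[OF sA] A(3)[symmetric] selfadjoint_bounded_clinear[OF X]) (simp add: B_def linX)
      ultimately show ?thesis by (simp add: linE)
    qed
    ultimately have eq: "A f = B f" using f(1) by (simp add: linA linB)
    \<comment> \<open>Otherwise \<open>f\<close> would lie in the kernel of \<open>W\<close>, which
      is the range of \<open>E\<close>. The strict inequality obtained here is what later forces
      right continuity.\<close>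
    have "Re (cinner (A f) f) \<noteq> 0"
    proof
      assume "Re (cinner (A f) f) = 0"
      then have "A f = 0" by (rule positive_op_null[OF A(1)])
      then have "W f = 0" using eq by (simp add: W_def)
      then have "E f = f" by (rule fixE)
      then show False using f by simp
    qed
    then have "0 < Re (cinner (B f) f)" using positive_op_form[OF A(1), of f] eq by simp
    then show ?thesis by (simp add: form)
  qed
  show ?thesis using E(1) comm ran ker by blast
qed

text \<open>Order and right continuity follow from the form bounds: a vector with \<open>E s\<close>
  fixing it and \<open>E t\<close> killing it, for \<open>s\<close> at most \<open>t\<close>,
  satisfies contradictory bounds unless it is 0. The integral formula traps the increments of the
  form of \<open>X\<close> between multiples of those of the distribution function.\<close>

lemma spectral_family_exists:
  fixes X :: "'a::chilbert_space \<Rightarrow> 'a"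
  assumes X: "selfadjoint X"
  shows "\<exists>E. spectral_family X E"
proof -
  have bX: "bounded_clinear X" using X by (rule selfadjoint_bounded_clinear)
  note linX = bounded_clinear_simps[OF bX]
  obtain E where E: "\<And>t. orth_projection (E t)"
    and comm: "\<And>t C x. selfadjoint C \<Longrightarrow> (\<And>x. C (X x) = X (C x)) \<Longrightarrow> C (E t x) = E t (C x)"
    and ran: "\<And>t f. E t f = f \<Longrightarrow> Re (cinner (X f) f) \<le> t * (norm f)\<^sup>2"
    and ker: "\<And>t f. E t f = 0 \<Longrightarrow> f \<noteq> 0 \<Longrightarrow> t * (norm f)\<^sup>2 < Re (cinner (X f) f)"
    using spectral_projection_exists[OF X] by metis
  note E' = orth_projection_simps[OF E]
  note linE = bounded_clinear_simps[OF E'(2)]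
  have EX: "E t (X x) = X (E t x)" for t x by (rule comm[OF X, symmetric]) simp
  have EE: "E s (E t x) = E t (E s x)" for s t x by (rule comm[OF E'(1)]) (rule EX)
  have mono1: "E t (E s x) = E s x" if "s \<le> t" for s t x
  proof (rule ccontr)
    let ?g = "E s x - E t (E s x)"
    assume "E t (E s x) \<noteq> E s x"
    then have "?g \<noteq> 0" by simp
    moreover have "E t ?g = 0" by (simp add: linE E'(3))
    ultimately have "t * (norm ?g)\<^sup>2 < Re (cinner (X ?g) ?g)" by (intro ker)
    moreover have "E s ?g = ?g" by (simp add: linE EE[of s t] E'(3))
    then have "Re (cinner (X ?g) ?g) \<le> s * (norm ?g)\<^sup>2" by (rule ran)
    moreover have "s * (norm ?g)\<^sup>2 \<le> t * (norm ?g)\<^sup>2" using that by (intro mult_right_mono) auto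
    ultimately show False by linarith
  qed
  have mono2: "E s (E t x) = E s x" if "s \<le> t" for s t x
    using mono1[OF that] EE by metis
  obtain K where K: "K > 0" "\<And>x. norm (X x) \<le> K * norm x"
    using bounded_clinear_bound[OF bX] by blast
  have form_le: "\<bar>Re (cinner (X f) f)\<bar> \<le> K * (norm f)\<^sup>2" for f
  proof -
    have "\<bar>Re (cinner (X f) f)\<bar> \<le> norm (X f) * norm f" by (rule Re_cinner_le)
    also have "\<dots> \<le> K * norm f * norm f" by (intro mult_right_mono K) simp
    finally show ?thesis by (simp add: power2_eq_square)
  qed
  have top: "E t f = f" if "t \<ge> K" for t f
  proof (rule ccontr)
    let ?g = "f - E t f"
    assume "E t f \<noteq> f"
    then have "?g \<noteq> 0" by simp
    moreover have "E t ?g = 0" by (simp add: linE E'(3))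
    ultimately have "t * (norm ?g)\<^sup>2 < Re (cinner (X ?g) ?g)" by (intro ker)
    moreover have "K * (norm ?g)\<^sup>2 \<le> t * (norm ?g)\<^sup>2" using that by (intro mult_right_mono) auto
    ultimately show False using form_le[of ?g] by linarith
  qed
  have bot: "E t f = 0" if "t < - K" for t f
  proof -
    let ?g = "E t f"
    have "Re (cinner (X ?g) ?g) \<le> t * (norm ?g)\<^sup>2" by (rule ran) (rule E'(3))
    then have "0 \<le> (t + K) * (norm ?g)\<^sup>2" using form_le[of ?g] by (simp add: algebra_simps)
    then have "(norm ?g)\<^sup>2 \<le> 0" using that by (simp add: zero_le_mult_iff)
    then show ?thesis by simp
  qed
  have right: "((\<lambda>s. E s f) \<longlongrightarrow> E t f) (at_right t)" for t f
  proof -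
    define s where "s n = t + 1 / real (Suc n)" for n
    have s: "s n > t" "m \<le> n \<Longrightarrow> s n \<le> s m" for m n
      by (auto simp: s_def frac_le)
    have "s \<longlonglongrightarrow> t + 0"
      unfolding s_def[abs_def] using LIMSEQ_inverse_real_of_nat
      by (intro tendsto_add tendsto_const) (simp add: inverse_eq_divide)
    then have lim_s: "s \<longlonglongrightarrow> t" by simp
    \<comment> \<open>As \<open>s n\<close> decreases to \<open>t\<close> the complements increase,
      so their pointwise limit exists.\<close>
    have compl: "orth_projection (\<lambda>x. x - E (s n) x)" for n by (rule orth_projection_complement[OF E])
    have chain: "(x - E (s n) x) - E (s m) (x - E (s n) x) = x - E (s m) x"
      "(x - E (s m) x) - E (s n) (x - E (s m) x) = x - E (s m) x" if "m \<le> n" for m n x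
      using s(2)[OF that] by (simp_all add: linE mono1 mono2)
    obtain P where P: "orth_projection P" "\<And>x. (\<lambda>n. x - E (s n) x) \<longlonglongrightarrow> P x"
      "\<And>n x. P x - E (s n) (P x) = x - E (s n) x" "\<And>n x. P (x - E (s n) x) = x - E (s n) x"
      by (rule increasing_projections_limit[of "\<lambda>n x. x - E (s n) x", OF compl chain])
        (assumption | (rule that, assumption+))+
    \<comment> \<open>The jump of the family at \<open>t\<close> from the right: every
      \<open>E (s n)\<close> fixes it and \<open>E t\<close> kills it.\<close>
    define g where "g = (f - P f) - E t f"
    have "(\<lambda>n. f - (f - E (s n) f)) \<longlonglongrightarrow> f - P f"
      by (intro tendsto_diff tendsto_const P(2))
    then have lim: "(\<lambda>n. E (s n) f) \<longlonglongrightarrow> f - P f" by simp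
    have g1: "E (s n) g = g" for n
      using P(3)[of f n] mono1[OF less_imp_le[OF s(1)[of n]], of f]
      by (simp add: g_def linE algebra_simps)
    have g0: "E t g = 0"
    proof -
      have "E t (E (s n) f) = E t f" for n using s(1)[of n] by (intro mono2) simp
      then have "E t (f - P f) = E t f"
        using LIMSEQ_unique[OF bounded_clinear_tendsto[OF E'(2)[of t] lim]] by simp
      then show ?thesis by (simp add: g_def linE E'(3))
    qed
    have "Re (cinner (X g) g) \<le> t * (norm g)\<^sup>2"
    proof (rule LIMSEQ_le_const)
      show "(\<lambda>n. s n * (norm g)\<^sup>2) \<longlonglongrightarrow> t * (norm g)\<^sup>2" by (intro tendsto_mult lim_s tendsto_const)
      show "\<exists>N. \<forall>n\<ge>N. Re (cinner (X g) g) \<le> s n * (norm g)\<^sup>2" using ran[OF g1] by blast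
    qed
    then have "g = 0" using ker[OF g0] by (metis not_less)
    then have lim': "(\<lambda>n. E (s n) f) \<longlonglongrightarrow> E t f" using lim by (simp add: g_def)
    \<comment> \<open>The distance of \<open>E r f\<close> from \<open>E t f\<close> is
      nondecreasing in \<open>r\<close>, so a single term of the sequence controls a whole right
      neighbourhood of \<open>t\<close>.\<close>
    show ?thesis
    proof (rule tendstoI)
      fix e :: real assume "e > 0"
      then obtain n where n: "dist (E (s n) f) (E t f) < e"
        using tendstoD[OF lim' \<open>e > 0\<close>] unfolding eventually_sequentially by blast
      have "dist (E r f) (E t f) < e" if "t < r" "r < s n" for r
      proof -
        have "(norm (E r f - E t f))\<^sup>2 = (norm (E r f))\<^sup>2 - (norm (E t f))\<^sup>2"
          using that by (intro orth_projection_diff_norm E mono2) simp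
        also have "\<dots> \<le> (norm (E (s n) f))\<^sup>2 - (norm (E t f))\<^sup>2"
          using that by (intro diff_right_mono power_mono orth_projection_diff_norm(2) E mono2) auto
        also have "\<dots> = (norm (E (s n) f - E t f))\<^sup>2"
          using s(1)[of n] by (intro orth_projection_diff_norm(1)[symmetric] E mono2) simp
        finally have "norm (E r f - E t f) \<le> norm (E (s n) f - E t f)"
          by (rule power2_le_imp_le) simp
        then show ?thesis using n by (simp add: dist_norm)
      qed
      then show "\<forall>\<^sub>F r in at_right t. dist (E r f) (E t f) < e"
        unfolding eventually_at_right_field using s(1)[of n] by blast
    qed
  qed
  have int: "cinner (X f) f = of_real (LINT t|interval_measure (\<lambda>t. Re (cinner (E t f) f)). t)" for f
  proof -
    \<comment> \<open>\<open>bot\<close> is strict at \<open>- K\<close>, whereas the family has to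
      vanish at \<open>- L\<close> itself.\<close>
    define L where "L = K + 1"
    have L: "L > 0" "\<And>t x. t \<le> - L \<Longrightarrow> E t x = 0" "\<And>t x. t \<ge> L \<Longrightarrow> E t x = x"
      using K(1) bot top by (auto simp: L_def)
    let ?F = "\<lambda>t. Re (cinner (E t f) f)"
    have q: "?F t = (norm (E t f))\<^sup>2" for t by (rule E'(5))
    interpret distribution_on ?F "- L" L
      by (rule spectral_family_distribution[OF E mono2 right]) (use L in auto)
    define G where "G t = Re (cinner (X (E t f)) (E t f))" for t
    \<comment> \<open>The increment \<open>d\<close> of \<open>E\<close> applied to \<open>f\<close>
      is orthogonal to \<open>E s f\<close> for the form of \<open>X\<close> too, so
      \<open>G\<close> grows exactly by the form at \<open>d\<close>, to which \<open>ran\<close>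
      and \<open>ker\<close> apply.\<close>
    have step: "s * (?F t - ?F s) \<le> G t - G s \<and> G t - G s \<le> t * (?F t - ?F s)" if "s \<le> t" for s t
    proof -
      define d where "d = E t f - E s f"
      have d: "E t d = d" "E s d = 0"
        by (simp_all add: d_def linE E'(3) mono1[OF that] mono2[OF that])
      have n: "(norm d)\<^sup>2 = ?F t - ?F s"
        unfolding q d_def by (rule orth_projection_diff_norm(1)[OF E E mono2[OF that]])
      have c1: "cinner (X (E s f)) d = 0"
      proof -
        have "cinner (X (E s f)) d = cinner (E s (X f)) d" by (simp add: EX)
        then show ?thesis by (simp add: E'(4) d(2))
      qed
      have c2: "cinner (X d) (E s f) = 0"
      proof -
        have "cinner (X d) (E s f) = cinner (E s (X d)) f" by (simp add: E'(4))
        then show ?thesis by (simp add: EX d(2) linX)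
      qed
      have "E t f = E s f + d" by (simp add: d_def)
      then have "G t = G s + Re (cinner (X d) d)"
        by (simp add: G_def linX cinner_add_left cinner_add_right c1 c2)
      moreover have "Re (cinner (X d) d) \<le> t * (norm d)\<^sup>2" by (rule ran[OF d(1)])
      moreover have "s * (norm d)\<^sup>2 \<le> Re (cinner (X d) d)"
        using ker[OF d(2)] by (cases "d = 0") auto
      ultimately show ?thesis using n by simp
    qed
    have err: "\<bar>riemann_sum ?F (- L) L n - Re (cinner (X f) f)\<bar> \<le> (L - (- L)) / real (Suc n) * (norm f)\<^sup>2"
      for n
    proof -
      define p where "p = grid (- L) L n"
      define h where "h = (L - (- L)) / real (Suc n)"
      have p: "p 0 = - L" "p (Suc n) = L" "p i \<le> p (Suc i)" "p (Suc i) = p i + h" for i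
        using grid_mono[of "- L" L n i] L(1) by (auto simp: p_def grid_ends grid_step h_def)
      have tel: "(\<Sum>i<Suc n. G (p (Suc i)) - G (p i)) = Re (cinner (X f) f)"
        using sum_lessThan_telescope[of "\<lambda>i. G (p i)" "Suc n"] L
        by (simp add: p(1,2) G_def linX(3) del: sum.lessThan_Suc)
      have tel': "(\<Sum>i<Suc n. ?F (p (Suc i)) - ?F (p i)) = (norm f)\<^sup>2"
        using sum_lessThan_telescope[of "\<lambda>i. ?F (p i)" "Suc n"] L
        by (simp add: p(1,2) Re_cinner_self del: sum.lessThan_Suc)
      have R: "riemann_sum ?F (- L) L n = (\<Sum>i<Suc n. p i * (?F (p (Suc i)) - ?F (p i)))"
        by (simp add: riemann_sum_def p_def del: sum.lessThan_Suc)
      have "riemann_sum ?F (- L) L n \<le> Re (cinner (X f) f)"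
        unfolding R tel[symmetric] using step p(3) by (intro sum_mono) blast
      moreover have "Re (cinner (X f) f) - riemann_sum ?F (- L) L n
          = (\<Sum>i<Suc n. (G (p (Suc i)) - G (p i)) - p i * (?F (p (Suc i)) - ?F (p i)))"
        unfolding R tel[symmetric] sum_subtractf ..
      moreover have "\<dots> \<le> (\<Sum>i<Suc n. h * (?F (p (Suc i)) - ?F (p i)))"
      proof (rule sum_mono)
        fix i
        show "(G (p (Suc i)) - G (p i)) - p i * (?F (p (Suc i)) - ?F (p i))
            \<le> h * (?F (p (Suc i)) - ?F (p i))"
          using step[OF p(3)[of i]] unfolding p(4)[of i] distrib_right by linarith
      qed
      moreover have "\<dots> = h * (norm f)\<^sup>2" by (simp only: sum_distrib_left[symmetric] tel')
      ultimately show ?thesis by (simp only: h_def)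
    qed
    have "(\<lambda>n. riemann_sum ?F (- L) L n - Re (cinner (X f) f)) \<longlonglongrightarrow> 0"
      by (rule Lim_null_comparison[OF always_eventually grid_error_tendsto[of L "- L" "(norm f)\<^sup>2"]])
        (use err in simp)
    then have "riemann_sum ?F (- L) L \<longlonglongrightarrow> Re (cinner (X f) f)" by (simp add: LIM_zero_iff)
    then have "(LINT t|interval_measure ?F. t) = Re (cinner (X f) f)"
      using LIMSEQ_unique riemann_sum_tendsto by blast
    then show ?thesis using selfadjoint_form_real[OF X, of f] by simp
  qed
  have "spectral_family X E"
    unfolding spectral_family_def
    using E mono1 mono2 right int bot top
    by (auto simp: fun_eq_iff intro!: exI[of _ K])
  then show ?thesis by blast
qed

section \<open>Bases of finite-dimensional subspaces\<close>

lemma cdimension_basis: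
  assumes "cdimension S \<noteq> \<infinity>"
  obtains B where "finite B" "B \<subseteq> S" "\<not> cdependent B" "S \<subseteq> cspan B" "enat (card B) = cdimension S"
proof -
  obtain B0 where B0: "finite B0" "S \<subseteq> cspan B0"
    using assms by (auto simp: cdimension_def split: if_splits)
  obtain B where B: "B \<subseteq> S" "\<not> cdependent B" "S \<subseteq> cspan B" "card B = cdim_nat S"
    using complex_vector.basis_exists by blast
  have "finite B"
    using complex_vector.independent_span_bound[OF B0(1) B(2)] B(1) B0(2) by blast
  moreover have "enat (card B) = cdimension S" using B(4) B0 by (auto simp: cdimension_def)
  ultimately show ?thesis using that B(1-3) by blast
qed

text \<open>A vector in the difference would enlarge a basis of \<open>S\<close> beyond the
  dimension of \<open>T\<close>. The finite spanning set excludes the default value 0 of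
  \<open>cdim_nat\<close>.\<close>

lemma subspace_eq_of_cdim_le:
  assumes "S \<subseteq> T" "finite B0" "T \<subseteq> cspan B0" "complex_vector.subspace S"
    and "cdim_nat T \<le> cdim_nat S"
  shows "S = T"
proof (rule ccontr)
  assume "S \<noteq> T"
  then obtain x where x: "x \<in> T" "x \<notin> S" using assms(1) by blast
  obtain B where B: "B \<subseteq> S" "\<not> cdependent B" "S \<subseteq> cspan B" "card B = cdim_nat S"
    using complex_vector.basis_exists by blast
  obtain C where C: "C \<subseteq> T" "\<not> cdependent C" "T \<subseteq> cspan C" "card C = cdim_nat T"
    using complex_vector.basis_exists by blast
  have fC: "finite C"
    using complex_vector.independent_span_bound[OF assms(2) C(2)] C(1) assms(3) by blast
  have "x \<notin> cspan B" using x(2) B(1) complex_vector.span_minimal[OF B(1) assms(4)] by blast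
  then have ind: "\<not> cdependent (insert x B)"
    using B(2) complex_vector.independent_insertI by blast
  have "finite (insert x B)" "card (insert x B) \<le> card C"
    using complex_vector.independent_span_bound[OF fC ind] B(1) C(3) assms(1) x(1) by auto
  moreover have "x \<notin> B" using x(2) B(1) by blast
  ultimately show False using B(4) C(4) assms(5) by simp
qed

section \<open>The negative spectral subspace\<close>

text \<open>Selfadjointness takes care of the imaginary parts, and polarization gives the uniqueness
  that \<open>THE\<close> requires.\<close>

lemma functional_calculus_eqI:
  fixes X :: "'a::chilbert_space \<Rightarrow> 'a"
  assumes "selfadjoint S"
    and "\<And>f. Re (cinner (S f) f) = (LINT t|spectral_measure X f. \<phi> t)"
  shows "functional_calculus \<phi> X = S"
  unfolding functional_calculus_def
proof (rule the_equality)
  have bS: "bounded_clinear S" using assms(1) by (rule selfadjoint_bounded_clinear)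
  have S: "cinner (S f) f = of_real (LINT t|spectral_measure X f. \<phi> t)" for f
    using selfadjoint_form_real[OF assms(1), of f] assms(2)[of f] by simp
  show "bounded_clinear S \<and> (\<forall>f. cinner (S f) f = of_real (LINT t|spectral_measure X f. \<phi> t))"
    using bS S by blast
  fix T assume "bounded_clinear T \<and> (\<forall>f. cinner (T f) f = of_real (LINT t|spectral_measure X f. \<phi> t))"
  then show "T = S" using S by (intro quadratic_form_eqI bS) auto
qed

text \<open>\<open>P\<close> is the left limit at 0 of the spectral family picked by
  \<open>SOME\<close>; commutation with \<open>X\<close> is inherited from
  \<open>spectral_family_reduces\<close>. If the range of \<open>P\<close> is finite-dimensional, it
  is exhausted already by the spectral projection for some negative number, and this number gives
  the gap.\<close>

lemma negative_spectral_projection: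
  fixes X :: "'a::chilbert_space \<Rightarrow> 'a"
  assumes X: "selfadjoint X"
  shows "\<exists>P. orth_projection P \<and> op_sign X = (\<lambda>f. f - 2 *\<^sub>R P f) \<and> \<nu>\<^sub>- X = cdimension (range P)
    \<and> (\<forall>f. X (P f) = P (X f)) \<and> (\<forall>f. P f = 0 \<longrightarrow> 0 \<le> Re (cinner (X f) f))
    \<and> (\<forall>f. P f = f \<longrightarrow> Re (cinner (X f) f) \<le> 0)
    \<and> (\<nu>\<^sub>- X \<noteq> \<infinity> \<longrightarrow> (\<exists>\<delta>>0. \<forall>f. P f = f \<longrightarrow> Re (cinner (X f) f) \<le> - \<delta> * (norm f)\<^sup>2))"
proof -
  have bX: "bounded_clinear X" using X by (rule selfadjoint_bounded_clinear)
  define E where "E = (SOME E. spectral_family X E)"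
  have E: "spectral_family X E" unfolding E_def by (rule someI_ex[OF spectral_family_exists[OF X]])
  note E' = spectral_familyD[OF E]
  \<comment> \<open>Strictly below 0, so that the kernel of \<open>X\<close> stays outside the range
    of \<open>P\<close>.\<close>
  define s where "s n = - (1 / real (Suc n))" for n
  have s: "s n < 0" "- 1 \<le> s n" "m \<le> n \<Longrightarrow> s m \<le> s n" for m n
    by (auto simp: s_def frac_le simp del: of_nat_Suc)
  have lim_s: "s \<longlonglongrightarrow> 0"
    unfolding s_def[abs_def] using tendsto_minus[OF LIMSEQ_inverse_real_of_nat]
    by (simp add: inverse_eq_divide)
  define Q where "Q n = E (s n)" for n
  have Q: "orth_projection (Q n)" for n by (simp add: Q_def E'(1))
  have chain: "Q m (Q n x) = Q m x" "Q n (Q m x) = Q m x" if "m \<le> n" for m n x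
    using E'(2,3)[OF s(3)[OF that]] by (simp_all add: Q_def)
  obtain P where P: "orth_projection P" "\<And>x. (\<lambda>n. Q n x) \<longlonglongrightarrow> P x"
    "\<And>n x. Q n (P x) = Q n x" "\<And>n x. P (Q n x) = Q n x"
    by (rule increasing_projections_limit[of Q, OF Q chain]) (assumption | (rule that, assumption+))+
  note P' = orth_projection_simps[OF P(1)]
  note linP = bounded_clinear_simps[OF P'(2)]
  have PX: "X (P f) = P (X f)" for f
  proof -
    have "(\<lambda>n. X (Q n f)) \<longlonglongrightarrow> X (P f)" by (rule bounded_clinear_tendsto[OF bX P(2)])
    moreover have "(\<lambda>n. X (Q n f)) \<longlonglongrightarrow> P (X f)"
      unfolding Q_def spectral_family_reduces[OF X E] using P(2)[of "X f"] by (simp add: Q_def)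
    ultimately show ?thesis by (rule LIMSEQ_unique)
  qed
  have nonneg: "0 \<le> Re (cinner (X f) f)" if "P f = 0" for f
  proof -
    have "Q n f = 0" for n
      using P(3)[of n f] that bounded_clinear_simps(3)[OF orth_projection_simps(2)[OF Q]] by metis
    then have *: "s n * (norm f)\<^sup>2 \<le> Re (cinner (X f) f)" for n
      using spectral_family_integral_bounds(2)[OF E, of "s n" f] by (simp add: Q_def)
    have "(\<lambda>n. s n * (norm f)\<^sup>2) \<longlonglongrightarrow> 0 * (norm f)\<^sup>2" by (intro tendsto_mult lim_s tendsto_const)
    from LIMSEQ_le_const2[OF this] * show ?thesis by simp
  qed
  have bound: "Re (cinner (X f) f) \<le> s n * (norm f)\<^sup>2" if "Q n f = f" for n f
    using spectral_family_integral_bounds(1)[OF E, of "s n" f] that by (simp add: Q_def)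
  have nonpos: "Re (cinner (X f) f) \<le> 0" if "P f = f" for f
  proof (rule LIMSEQ_le_const2)
    have "(\<lambda>n. Re (cinner (X (Q n f)) (Q n f))) \<longlonglongrightarrow> Re (cinner (X (P f)) (P f))"
      by (intro tendsto_Re tendsto_cinner bounded_clinear_tendsto[OF bX] P(2))
    then show "(\<lambda>n. Re (cinner (X (Q n f)) (Q n f))) \<longlonglongrightarrow> Re (cinner (X f) f)" using that by simp
    have "Re (cinner (X (Q n f)) (Q n f)) \<le> 0" for n
    proof -
      have "Re (cinner (X (Q n f)) (Q n f)) \<le> s n * (norm (Q n f))\<^sup>2"
        by (rule bound) (rule orth_projection_simps(3)[OF Q])
      also have "\<dots> \<le> 0" using s(1)[of n] by (simp add: mult_nonpos_nonneg)
      finally show ?thesis .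
    qed
    then show "\<exists>N. \<forall>n\<ge>N. Re (cinner (X (Q n f)) (Q n f)) \<le> 0" by blast
  qed
  have meas: "(LINT t|spectral_measure X f. indicat_real {..<0} t) = (norm (P f))\<^sup>2
    \<and> (LINT t|spectral_measure X f. (if t \<ge> 0 then 1 else - 1)) = (norm f)\<^sup>2 - 2 * (norm (P f))\<^sup>2" for f
  proof -
    obtain L0 where L0: "L0 > 0" "\<And>t x. t \<le> - L0 \<Longrightarrow> E t x = 0" "\<And>t x. t \<ge> L0 \<Longrightarrow> E t x = x"
      using E'(6) by blast
    define L where "L = max L0 1"
    have L: "L \<ge> 1" "\<And>t x. t \<le> - L \<Longrightarrow> E t x = 0" "\<And>t x. t \<ge> L \<Longrightarrow> E t x = x"
      using L0 by (auto simp: L_def)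
    let ?F = "\<lambda>t. Re (cinner (E t f) f)"
    have q: "?F t = (norm (E t f))\<^sup>2" for t by (rule orth_projection_simps(5)[OF E'(1)])
    interpret distribution_on ?F "- L" L
      by (rule spectral_family_distribution[OF E'(1,2,4)]) (use L in auto)
    have \<mu>: "spectral_measure X f = interval_measure ?F" by (simp add: spectral_measure_def E_def)
    \<comment> \<open>Continuity from below: the intervals closed at \<open>s n\<close> exhaust the
      interval that is open at 0.\<close>
    have "incseq (\<lambda>n. {- L<..s n})" using s(3) by (force simp: incseq_def)
    then have "(\<lambda>n. measure (interval_measure ?F) {- L<..s n}) \<longlonglongrightarrow>
        measure (interval_measure ?F) (\<Union>n. {- L<..s n})"
      by (intro finite_Lim_measure_incseq) auto
    also have "(\<Union>n. {- L<..s n}) = {- L<..<0}"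
    proof -
      have "\<exists>n. t \<le> s n" if "t < 0" for t
        using order_tendstoD(1)[OF lim_s that] unfolding eventually_sequentially
        by (meson less_imp_le order_refl)
      then show ?thesis by (auto simp: set_eq_iff intro: order_le_less_trans[OF _ s(1)])
    qed
    also have "measure (interval_measure ?F) {- L<..<0} = measure (interval_measure ?F) {..<0}"
      by (rule measure_eq_AE) (use AE_support in \<open>auto elim: eventually_mono\<close>)
    also have "(\<lambda>n. measure (interval_measure ?F) {- L<..s n}) = (\<lambda>n. (norm (Q n f))\<^sup>2)"
    proof
      fix n
      have le: "- L \<le> s n" using L(1) s(2)[of n] by linarith
      show "measure (interval_measure ?F) {- L<..s n} = (norm (Q n f))\<^sup>2"
        unfolding measure_Ioc[OF le] by (simp add: q L(2) Q_def)
    qed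
    finally have m: "measure (interval_measure ?F) {..<0} = (norm (P f))\<^sup>2"
      by (rule LIMSEQ_unique[OF _ tendsto_power[OF tendsto_norm[OF P(2)]]])
    have i: "integrable (interval_measure ?F) (indicat_real {..<0})"
      by (auto intro!: integrable_real_indicator simp: emeasure_eq_measure)
    \<comment> \<open>Counting 0 as positive makes the sign exactly 1 minus twice the indicator of
      the negative half-line.\<close>
    have "(LINT t|interval_measure ?F. (if t \<ge> 0 then 1 else - 1))
        = (LINT t|interval_measure ?F. 1 - 2 * indicat_real {..<0} t)"
      by (rule Bochner_Integration.integral_cong) (auto simp: indicator_def)
    also have "\<dots> = measure (interval_measure ?F) UNIV - 2 * measure (interval_measure ?F) {..<0}"
      using i by simp
    also have "\<dots> = (norm f)\<^sup>2 - 2 * (norm (P f))\<^sup>2"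
      unfolding m measure_space by (simp add: L Re_cinner_self)
    finally show ?thesis unfolding \<mu> using m by simp
  qed
  have q: "Re (cinner (P f) f) = (norm (P f))\<^sup>2" for f by (rule P'(5))
  have fc: "functional_calculus (indicat_real {..<0}) X = P"
    by (rule functional_calculus_eqI[OF P'(1)]) (simp only: q meas)
  have sign: "op_sign X = (\<lambda>f. f - 2 *\<^sub>R P f)"
    unfolding op_sign_def
  proof (rule functional_calculus_eqI)
    show "selfadjoint (\<lambda>f. f - 2 *\<^sub>R P f)"
      by (rule selfadjoint_diff[OF selfadjoint_id selfadjoint_scaleR[OF P'(1)]])
  qed (simp add: meas cinner_diff_left cinner_scaleR_left q Re_cinner_self)
  have index: "\<nu>\<^sub>- X = cdimension (range P)"
    unfolding neg_index_def spectral_subspace_def fc ..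
  have gap: "\<exists>\<delta>>0. \<forall>f. P f = f \<longrightarrow> Re (cinner (X f) f) \<le> - \<delta> * (norm f)\<^sup>2" if fin: "\<nu>\<^sub>- X \<noteq> \<infinity>"
  proof -
    obtain B where B: "finite B" "range P \<subseteq> cspan B"
      using fin unfolding index by (metis cdimension_basis)
    \<comment> \<open>The part of the range of \<open>P\<close> not yet reached by
      \<open>Q n\<close>. These subspaces decrease and intersect in 0; from an index of least
      dimension on they are constant, hence 0.\<close>
    define S where "S n = {f. P f = f \<and> Q n f = 0}" for n
    have linQ: "Q n (x + y) = Q n x + Q n y" "Q n (x - y) = Q n x - Q n y" "Q n 0 = 0"
      "Q n (c *\<^sub>C x) = c *\<^sub>C Q n x" for n x y c
      using bounded_clinear_simps[OF orth_projection_simps(2)[OF Q]] by blast+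
    have sub: "complex_vector.subspace (S n)" for n
      unfolding complex_vector.subspace_def S_def by (auto simp: linP linQ)
    have SB: "S n \<subseteq> cspan B" for n
    proof
      fix f assume "f \<in> S n"
      then have "f = P f" by (simp add: S_def)
      then show "f \<in> cspan B" using B(2) by blast
    qed
    obtain n where n: "\<And>m. cdim_nat (S n) \<le> cdim_nat (S m)"
      using ex_has_least_nat[of "\<lambda>_. True" 0 "\<lambda>n. cdim_nat (S n)"] by auto
    have "f = 0" if f: "f \<in> S n" for f
    proof -
      have "Q m f = 0" if "m \<ge> n" for m
      proof -
        have "S m \<subseteq> S n"
        proof
          fix g assume g: "g \<in> S m"
          have "Q n (Q m g) = Q n g" by (rule chain(1)[OF that])
          then show "g \<in> S n" using g by (simp add: S_def linQ(3))
        qed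
        from subspace_eq_of_cdim_le[OF this B(1) SB sub n] f show ?thesis by (auto simp: S_def)
      qed
      then have "(\<lambda>m. Q m f) \<longlonglongrightarrow> 0"
        by (intro tendsto_eventually) (auto simp: eventually_sequentially)
      then have "P f = 0" using LIMSEQ_unique P(2) by blast
      then show ?thesis using f by (simp add: S_def)
    qed
    moreover have "f - Q n f \<in> S n" if "P f = f" for f
      using that by (simp add: S_def linP linQ P(4) orth_projection_simps(3)[OF Q])
    ultimately have "Q n f = f" if "P f = f" for f
      using that by (metis right_minus_eq)
    then have "\<forall>f. P f = f \<longrightarrow> Re (cinner (X f) f) \<le> - (- s n) * (norm f)\<^sup>2" using bound by simp
    moreover have "- s n > 0" using s(1) by simp
    ultimately show ?thesis by blast
  qed
  show ?thesis using P(1) sign index PX nonneg nonpos gap by blast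
qed

section \<open>Operators with the same number of negative squares\<close>

lemma power2_sum_le: "(a + b)\<^sup>2 \<le> 2 * a\<^sup>2 + 2 * b\<^sup>2" for a b :: real
  using zero_le_power2[of "a - b"] by (simp add: power2_eq_square algebra_simps)

text \<open>For \<open>f\<close> orthogonal to the negative subspace \<open>ran P\<close> of \<open>X\<close>, the form of \<open>Y = X - T\<^sup>* T\<close> cannot be
  negative on the span of \<open>f\<close> and \<open>ran P\<close>, whose dimension exceeds \<open>\<nu>\<^sub>- Y\<close>. So some \<open>f + h\<close> with \<open>h\<close> in
  \<open>ran P\<close> is nonnegative for \<open>Y\<close>.\<close>

lemma equal_index_bound:
  fixes X Y P Q :: "'a::chilbert_space \<Rightarrow> 'a" and T :: "'a \<Rightarrow> 'b::complex_inner"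
  assumes X: "selfadjoint X" and Y: "bounded_clinear Y" and T: "bounded_clinear T"
    and form: "\<And>f. Re (cinner (Y f) f) = Re (cinner (X f) f) - (norm (T f))\<^sup>2"
    and P: "orth_projection P" and PX: "\<And>f. X (P f) = P (X f)"
    and gap: "\<delta> > 0" "\<And>f. P f = f \<Longrightarrow> Re (cinner (X f) f) \<le> - \<delta> * (norm f)\<^sup>2"
    and Q: "bounded_clinear Q" and Qpos: "\<And>f. Q f = 0 \<Longrightarrow> 0 \<le> Re (cinner (Y f) f)"
    and dim: "cdimension (range P) = cdimension (range Q)" "cdimension (range P) \<noteq> \<infinity>"
  shows "\<exists>C\<ge>0. \<forall>f. P f = 0 \<longrightarrow> (norm (T f))\<^sup>2 \<le> C * Re (cinner (X f) f)"
proof -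
  note linX = bounded_clinear_simps[OF selfadjoint_bounded_clinear[OF X]]
  note linY = bounded_clinear_simps[OF Y]
  note linT = bounded_clinear_simps[OF T]
  note linQ = bounded_clinear_simps[OF Q]
  note P' = orth_projection_simps[OF P]
  note linP = bounded_clinear_simps[OF P'(2)]
  obtain K where K: "K > 0" "\<And>x. norm (T x) \<le> K * norm x" using bounded_clinear_bound[OF T] by blast
  have ex: "\<exists>h. P h = h \<and> 0 \<le> Re (cinner (Y (f + h)) (f + h))" if f: "P f = 0" "f \<noteq> 0" for f
  proof (rule ccontr)
    assume no: "\<not> ?thesis"
    obtain B where B: "finite B" "B \<subseteq> range P" "\<not> cdependent B" "range P \<subseteq> cspan B"
      "enat (card B) = cdimension (range P)"
      using cdimension_basis[OF dim(2)] by metis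
    obtain B' where B': "finite B'" "B' \<subseteq> range Q" "\<not> cdependent B'" "range Q \<subseteq> cspan B'"
      "enat (card B') = cdimension (range Q)"
      using cdimension_basis[of "range Q"] dim by metis
    have "complex_vector.subspace {f. P f = f}"
      unfolding complex_vector.subspace_def by (auto simp: linP)
    moreover have "B \<subseteq> {f. P f = f}" using B(2) P'(3) by auto
    ultimately have span: "P h = h" if "h \<in> cspan B" for h
      using complex_vector.span_minimal[of B "{f. P f = f}"] that by blast
    have fB: "f \<notin> cspan B" using span f by metis
    have ind: "\<not> cdependent (insert f B)"
      using complex_vector.independent_insertI[OF fB B(3)] .
    have card: "card (insert f B) = Suc (card B)"
      using card_insert_disjoint[OF B(1)] fB complex_vector.span_base[of f B] by blast
    \<comment> \<open>This makes \<open>Q\<close> injective on the span of \<open>f\<close> and the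
      range of \<open>P\<close>: a vector killed by \<open>Q\<close> has nonnegative
      \<open>Y\<close>-form, whereas under \<open>no\<close> and the gap every nonzero vector of the
      span has a negative one. So the range of \<open>Q\<close> would have a larger dimension than
      that of \<open>P\<close>.\<close>
    have null: "w = 0" if w: "w \<in> cspan (insert f B)" "Q w = 0" for w
    proof -
      obtain c where c: "w - c *\<^sub>C f \<in> cspan B"
        using w(1) unfolding complex_vector.span_insert by blast
      define h where "h = w - c *\<^sub>C f"
      have h: "P h = h" using span c by (simp add: h_def)
      have pos: "0 \<le> Re (cinner (Y w) w)" using Qpos w(2) by blast
      show "w = 0"
      proof (cases "c = 0")
        case True
        then have wh: "P w = w" using h by (simp add: h_def)
        have "\<delta> * (norm w)\<^sup>2 \<le> 0"
          using gap(2)[OF wh] pos form[of w] zero_le_power2[of "norm (T w)"] by linarith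
        then show ?thesis using gap(1) by (simp add: mult_le_0_iff)
      next
        case False
        let ?g = "inverse c *\<^sub>C h"
        have "P ?g = ?g" by (simp add: linP h)
        then have "Re (cinner (Y (f + ?g)) (f + ?g)) < 0" using no by force
        moreover have "w = c *\<^sub>C (f + ?g)"
          using False by (simp add: scaleC_add_right scaleC_scaleC scaleC_one h_def)
        then have "cinner (Y w) w = c * cnj c * cinner (Y (f + ?g)) (f + ?g)"
          by (simp only: linY(5) cinner_scaleC_left cinner_scaleC_right mult_ac)
        then have "Re (cinner (Y w) w) = (cmod c)\<^sup>2 * Re (cinner (Y (f + ?g)) (f + ?g))"
          by (simp add: complex_norm_square[symmetric] del: of_real_power)
        moreover have "(cmod c)\<^sup>2 > 0" using False by simp
        ultimately have "Re (cinner (Y w) w) < 0" by (simp add: mult_pos_neg)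
        then show ?thesis using pos by simp
      qed
    qed
    interpret pair: vector_space_pair "scaleC :: complex \<Rightarrow> 'a \<Rightarrow> 'a" "scaleC :: complex \<Rightarrow> 'a \<Rightarrow> 'a"
      by unfold_locales
    have lin: "Vector_Spaces.linear scaleC scaleC Q"
      by unfold_locales (auto simp: linQ)
    have inj: "inj_on Q (cspan (insert f B))"
    proof (rule inj_onI)
      fix u v assume "u \<in> cspan (insert f B)" "v \<in> cspan (insert f B)" "Q u = Q v"
      then have "u - v \<in> cspan (insert f B)" "Q (u - v) = 0"
        by (simp_all add: linQ complex_vector.span_diff)
      then have "u - v = 0" by (rule null)
      then show "u = v" by simp
    qed
    have "\<not> cdependent (Q ` insert f B)"
      using pair.linear_independent_injective_image[OF lin] ind inj
      unfolding cdependent_def cspan_def by blast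
    moreover have "Q ` insert f B \<subseteq> cspan B'" using B'(4) by blast
    ultimately have "card (Q ` insert f B) \<le> card B'"
      using complex_vector.independent_span_bound[OF B'(1)] by blast
    moreover have "card (Q ` insert f B) = card (insert f B)"
      by (rule card_image) (rule inj_on_subset[OF inj complex_vector.span_superset])
    ultimately show False using card B(5) B'(5) dim(1) by (metis Suc_n_not_le_n enat.inject)
  qed
  \<comment> \<open>\<open>T f\<close> is split as \<open>T (f + h) - T h\<close>. By
    \<open>main\<close> below, the form of \<open>X\<close> at \<open>f\<close> bounds the square of
    the first term, and \<open>K\<^sup>2 / \<delta>\<close> times the form that of the second;
    \<open>power2_sum_le\<close> doubles both.\<close>
  have "(norm (T f))\<^sup>2 \<le> (2 + 2 * K\<^sup>2 / \<delta>) * Re (cinner (X f) f)" if f: "P f = 0" for f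
  proof (cases "f = 0")
    case True
    then show ?thesis by (simp add: linT(3))
  next
    case False
    obtain h where h: "P h = h" "0 \<le> Re (cinner (Y (f + h)) (f + h))" using ex[OF f False] by blast
    \<comment> \<open>As \<open>X\<close> commutes with \<open>P\<close>, the vectors
      \<open>f\<close> and \<open>h\<close> are orthogonal for the form of \<open>X\<close> as
      well.\<close>
    have 1: "cinner (X f) h = 0"
      using P'(4)[of "X f" h] h(1) PX[of f] f by (simp add: linX)
    then have 2: "cinner (X h) f = 0"
      using selfadjoint_cinner[OF X, of h f] cinner_commute[of h "X f"] by simp
    have "Re (cinner (X (f + h)) (f + h)) = Re (cinner (X f) f) + Re (cinner (X h) h)"
      by (simp add: linX(1) cinner_add_left cinner_add_right 1 2)
    then have main: "\<delta> * (norm h)\<^sup>2 + (norm (T (f + h)))\<^sup>2 \<le> Re (cinner (X f) f)"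
      using h(2) form[of "f + h"] gap(2)[OF h(1)] by linarith
    have "norm (T f) \<le> norm (T (f + h)) + K * norm h"
      using norm_triangle_ineq4[of "T (f + h)" "T h"] K(2)[of h] by (simp add: linT)
    then have "(norm (T f))\<^sup>2 \<le> (norm (T (f + h)) + K * norm h)\<^sup>2" by (rule power_mono) simp
    also have "\<dots> \<le> 2 * (norm (T (f + h)))\<^sup>2 + 2 * (K * norm h)\<^sup>2" by (rule power2_sum_le)
    also have "\<dots> \<le> 2 * Re (cinner (X f) f) + 2 * (K\<^sup>2 * (Re (cinner (X f) f) / \<delta>))"
    proof -
      have "(norm (T (f + h)))\<^sup>2 \<le> Re (cinner (X f) f)"
        using main gap(1) by (smt (verit) mult_nonneg_nonneg zero_le_power2)
      moreover have "\<delta> * (norm h)\<^sup>2 \<le> Re (cinner (X f) f)"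
        using main zero_le_power2[of "norm (T (f + h))"] by linarith
      then have "(norm h)\<^sup>2 \<le> Re (cinner (X f) f) / \<delta>"
        using gap(1) by (simp add: pos_le_divide_eq mult.commute)
      then have "(K * norm h)\<^sup>2 \<le> K\<^sup>2 * (Re (cinner (X f) f) / \<delta>)"
        unfolding power_mult_distrib by (rule mult_left_mono) simp
      ultimately show ?thesis by simp
    qed
    finally show ?thesis by (simp add: algebra_simps)
  qed
  moreover have "0 \<le> 2 + 2 * K\<^sup>2 / \<delta>" using gap(1) by simp
  ultimately show ?thesis by blast
qed

text \<open>\<open>I - 2 P\<close> is a selfadjoint involution that commutes with \<open>X\<close>
  and reverses the sign exactly where the form is nonpositive, so its product with \<open>X\<close>
  is a positive root of \<open>X \<circ> X\<close>.\<close>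

lemma op_abs_negative_projection:
  fixes X :: "'a::chilbert_space \<Rightarrow> 'a"
  assumes X: "selfadjoint X" and P: "orth_projection P" and PX: "\<And>f. X (P f) = P (X f)"
    and nonneg: "\<And>f. P f = 0 \<Longrightarrow> 0 \<le> Re (cinner (X f) f)"
    and nonpos: "\<And>f. P f = f \<Longrightarrow> Re (cinner (X f) f) \<le> 0"
  shows "op_abs X = (\<lambda>f. X f - 2 *\<^sub>R X (P f))"
    and "Re (cinner (op_abs X f) f) = Re (cinner (X (f - P f)) (f - P f)) - Re (cinner (X (P f)) (P f))"
proof -
  note linX = bounded_clinear_simps[OF selfadjoint_bounded_clinear[OF X]]
  note P' = orth_projection_simps[OF P]
  note linP = bounded_clinear_simps[OF P'(2)]
  let ?A = "\<lambda>f. X f - 2 *\<^sub>R X (P f)"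
  have form: "Re (cinner (?A f) f) = Re (cinner (X (f - P f)) (f - P f)) - Re (cinner (X (P f)) (P f))" for f
  proof -
    have "cinner (X (P f)) (P f) = cinner (X (P f)) f" "cinner (X f) (P f) = cinner (X (P f)) f"
      using P'(4)[of "X (P f)" f] P'(4)[of "X f" f] PX P'(3) by metis+
    then show ?thesis by (simp add: linX(2) cinner_diff_left cinner_diff_right cinner_scaleR_left)
  qed
  have "selfadjoint (\<lambda>f. X (P f))" by (rule selfadjoint_commuting_compose[OF X P'(1) PX])
  then have "selfadjoint ?A" by (intro selfadjoint_diff selfadjoint_scaleR X)
  moreover have "0 \<le> Re (cinner (?A f) f)" for f
    using nonneg[of "f - P f"] nonpos[of "P f"] unfolding form by (simp add: linP P'(3))
  ultimately have "positive_op ?A" by (simp add: positive_op_def)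
  moreover have "?A (?A f) = (X \<circ> X) f" for f
    by (simp add: linX linP PX P'(3) scaleR_2)
  ultimately show eq: "op_abs X = ?A" unfolding op_abs_def by (rule op_sqrt_eqI)
  show "Re (cinner (op_abs X f) f) = Re (cinner (X (f - P f)) (f - P f)) - Re (cinner (X (P f)) (P f))"
    unfolding eq by (rule form)
qed

text \<open>The reflected vector \<open>s = (I - 2 P) g\<close> satisfies |X| s = X g and has the
  same |X|-form as \<open>g\<close>. So the mixed form of \<open>X\<close> obeys the Cauchy-Schwarz
  inequality of |X|.\<close>

lemma op_abs_form_Cauchy_Schwarz:
  fixes X :: "'a::chilbert_space \<Rightarrow> 'a"
  assumes X: "selfadjoint X" and P: "orth_projection P" and PX: "\<And>f. X (P f) = P (X f)"
    and nonneg: "\<And>f. P f = 0 \<Longrightarrow> 0 \<le> Re (cinner (X f) f)"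
    and nonpos: "\<And>f. P f = f \<Longrightarrow> Re (cinner (X f) f) \<le> 0"
  shows "(cmod (cinner f (X g)))\<^sup>2 \<le> Re (cinner (op_abs X f) f) * Re (cinner (op_abs X g) g)"
proof -
  note linX = bounded_clinear_simps[OF selfadjoint_bounded_clinear[OF X]]
  note P' = orth_projection_simps[OF P]
  note linP = bounded_clinear_simps[OF P'(2)]
  note A = op_abs_negative_projection[OF assms]
  have pos: "positive_op (op_abs X)" by (rule op_abs(1)[OF X])
  define s where "s = g - 2 *\<^sub>R P g"
  have As: "op_abs X s = X g"
    by (simp add: A(1) s_def linX linP P'(3) scaleR_2)
  have "cinner (X g) (P g) = cinner (X (P g)) g"
    using P'(4)[of "X g" g] PX by metis
  then have "cinner (op_abs X s) s = cinner (op_abs X g) g"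
    unfolding As by (simp add: A(1) s_def cinner_algebra)
  moreover have "cinner f (X g) = cinner (op_abs X f) s"
    unfolding As[symmetric] by (rule selfadjoint_cinner[OF positive_op_selfadjoint[OF pos], symmetric])
  ultimately show ?thesis using positive_op_Cauchy_Schwarz[OF pos, of f s] by simp
qed

text \<open>The |Y|-form exceeds the \<open>Y\<close>-form by twice the negative part at
  \<open>Q f\<close>. The gap gives \<open>\<delta>\<close> times the squared norm of
  \<open>Q f\<close> at most the norm of \<open>Y f\<close> times that of \<open>Q f\<close>, so the
  negative part is bounded by the squared norm of \<open>Y f\<close> over
  \<open>\<delta>\<close>.\<close>

lemma op_abs_form_le:
  fixes Y :: "'a::chilbert_space \<Rightarrow> 'a"
  assumes Y: "selfadjoint Y" and Q: "orth_projection Q" and QY: "\<And>f. Y (Q f) = Q (Y f)"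
    and nonneg: "\<And>f. Q f = 0 \<Longrightarrow> 0 \<le> Re (cinner (Y f) f)"
    and gap: "\<delta> > 0" "\<And>f. Q f = f \<Longrightarrow> Re (cinner (Y f) f) \<le> - \<delta> * (norm f)\<^sup>2"
  shows "Re (cinner (op_abs Y f) f) \<le> \<bar>Re (cinner (Y f) f)\<bar> + 2 / \<delta> * (norm (Y f))\<^sup>2"
proof -
  note linY = bounded_clinear_simps[OF selfadjoint_bounded_clinear[OF Y]]
  note Q' = orth_projection_simps[OF Q]
  have nonpos: "Re (cinner (Y f) f) \<le> 0" if "Q f = f" for f
  proof -
    have "- \<delta> * (norm f)\<^sup>2 \<le> 0" using gap(1) by simp
    then show ?thesis using gap(2)[OF that] by linarith
  qed
  let ?n = "Q f"
  have gapn: "\<delta> * (norm ?n)\<^sup>2 \<le> - Re (cinner (Y ?n) ?n)" using gap(2)[of ?n] Q'(3) by simp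
  have "- Re (cinner (Y ?n) ?n) \<le> norm (Y ?n) * norm ?n" using Re_cinner_le[of "Y ?n" ?n] by linarith
  also have "norm (Y ?n) \<le> norm (Y f)" unfolding QY by (rule Q'(7))
  then have "norm (Y ?n) * norm ?n \<le> norm (Y f) * norm ?n" by (rule mult_right_mono) simp
  finally have le: "- Re (cinner (Y ?n) ?n) \<le> norm (Y f) * norm ?n" .
  have "norm ?n \<le> norm (Y f) / \<delta>"
  proof (cases "?n = 0")
    case False
    have "\<delta> * norm ?n * norm ?n \<le> norm (Y f) * norm ?n"
      using gapn le by (simp add: power2_eq_square)
    then show ?thesis using False gap(1) by (simp add: pos_le_divide_eq mult.commute)
  qed (use gap(1) in simp)
  then have "norm (Y f) * norm ?n \<le> norm (Y f) * (norm (Y f) / \<delta>)" by (rule mult_left_mono) simp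
  with le have "- Re (cinner (Y ?n) ?n) \<le> (norm (Y f))\<^sup>2 / \<delta>" by (simp add: power2_eq_square)
  moreover have "cinner (Y (Q f)) f = cinner (Y ?n) ?n"
    using Q'(4)[of "Y ?n" f] QY Q'(3) by metis
  then have "Re (cinner (op_abs Y f) f) = Re (cinner (Y f) f) - 2 * Re (cinner (Y ?n) ?n)"
    by (simp add: op_abs_negative_projection(1)[OF Y Q QY nonneg nonpos] cinner_algebra)
  ultimately show ?thesis by simp
qed

lemma closure_range_sequence:
  fixes D :: "'a \<Rightarrow> 'b::metric_space"
  assumes "y \<in> closure (range D)"
  obtains x where "(\<lambda>n. D (x n)) \<longlonglongrightarrow> y"
proof -
  obtain z where z: "\<And>n. z n \<in> range D" "z \<longlonglongrightarrow> y" using assms unfolding closure_sequential by blast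
  then have "\<forall>n. \<exists>x. z n = D x" by blast
  then obtain x where "\<And>n. z n = D (x n)" by metis
  then have "z = (\<lambda>n. D (x n))" by auto
  then show ?thesis using z(2) that by blast
qed

text \<open>For selfadjoint \<open>D\<close> the closure of the range is the orthogonal complement
  of the kernel; the two equations for \<open>R\<close> express this.\<close>

lemma closure_range_projection:
  fixes D :: "'a::chilbert_space \<Rightarrow> 'a"
  assumes D: "selfadjoint D"
  shows "\<exists>R. orth_projection R \<and> range R = closure (range D) \<and> (\<forall>y. D (R y) = D y) \<and> (\<forall>k. D k = 0 \<longrightarrow> R k = 0)"
proof -
  have bD: "bounded_clinear D" using D by (rule selfadjoint_bounded_clinear)
  note linD = bounded_clinear_simps[OF bD]
  have seq: "\<exists>x. (\<lambda>n. D (x n)) \<longlonglongrightarrow> y" if "y \<in> closure (range D)" for y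
    using closure_range_sequence[OF that] by blast
  have "y + z \<in> closure (range D)" if yz: "y \<in> closure (range D)" "z \<in> closure (range D)" for y z
  proof -
    obtain u v where "(\<lambda>n. D (u n)) \<longlonglongrightarrow> y" "(\<lambda>n. D (v n)) \<longlonglongrightarrow> z" using seq yz by blast
    then have "(\<lambda>n. D (u n + v n)) \<longlonglongrightarrow> y + z" unfolding linD by (rule tendsto_add)
    then show ?thesis unfolding closure_sequential by (intro exI[of _ "\<lambda>n. D (u n + v n)"]) auto
  qed
  moreover have "c *\<^sub>C y \<in> closure (range D)" if y: "y \<in> closure (range D)" for c y
  proof -
    obtain u where "(\<lambda>n. D (u n)) \<longlonglongrightarrow> y" using seq y by blast
    then have "(\<lambda>n. D (c *\<^sub>C u n)) \<longlonglongrightarrow> c *\<^sub>C y"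
      unfolding linD by (rule bounded_clinear_tendsto[OF bounded_clinear_scaleC])
    then show ?thesis unfolding closure_sequential by (intro exI[of _ "\<lambda>n. D (c *\<^sub>C u n)"]) auto
  qed
  moreover have "0 \<in> closure (range D)"
    using closure_subset[of "range D"] linD(3) rangeI[of D 0] by auto
  ultimately obtain R where R: "orth_projection R" "range R = closure (range D)"
    using orth_projection_exists[OF closed_closure] by metis
  note R' = orth_projection_simps[OF R(1)]
  note linR = bounded_clinear_simps[OF R'(2)]
  have RD: "R (D x) = D x" for x
  proof -
    have "D x \<in> range R" unfolding R(2) using closure_subset[of "range D"] by blast
    then show ?thesis using R'(3) by auto
  qed
  have "D (R y) = D y" for y
  proof -
    let ?k = "y - R y"
    have "cinner (D ?k) (D ?k) = cinner ?k (D (D ?k))" by (rule selfadjoint_cinner[OF D])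
    also have "\<dots> = cinner ?k (R (D (D ?k)))" by (simp only: RD)
    also have "\<dots> = cinner (R ?k) (D (D ?k))" by (rule R'(4)[symmetric])
    also have "\<dots> = 0" by (simp add: linR R'(3))
    finally show ?thesis by (simp add: linD)
  qed
  moreover have "R k = 0" if k: "D k = 0" for k
  proof -
    have "R k \<in> closure (range D)" using R(2) by blast
    then obtain x where x: "(\<lambda>n. D (x n)) \<longlonglongrightarrow> R k" using seq by blast
    have "(\<lambda>n. cinner (D (x n)) k) \<longlonglongrightarrow> cinner (R k) k" by (intro tendsto_cinner x tendsto_const)
    then have "(\<lambda>n::nat. 0::complex) \<longlonglongrightarrow> cinner (R k) k"
      by (simp add: selfadjoint_cinner[OF D] k)
    then have "cinner (R k) k = 0" using LIMSEQ_unique tendsto_const by blast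
    then show ?thesis using R'(5)[of k] by simp
  qed
  ultimately show ?thesis using R by blast
qed

section \<open>The extremal extensions\<close>

text \<open>The bound makes \<open>D f \<mapsto> T f\<close> well defined and continuous, hence
  extendable to the closure of the range of \<open>D\<close>. The Moore-Penrose domain also contains
  the kernel of \<open>D\<close>, so it is dense and the closed graph belongs to an everywhere
  defined operator.\<close>

lemma closure_op_moore_penrose:
  fixes D :: "'a::chilbert_space \<Rightarrow> 'a" and T :: "'a \<Rightarrow> 'b::chilbert_space"
  assumes D: "selfadjoint D" and T: "bounded_clinear T" and bound: "\<And>f. norm (T f) \<le> C * norm (D f)"
    and V_def: "V = closure_op (moore_penrose D O op_graph T)"
  shows "bounded_clinear V" "V (D f) = T f" "D k = 0 \<Longrightarrow> V k = 0"
proof -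
  have bD: "bounded_clinear D" using D by (rule selfadjoint_bounded_clinear)
  note linD = bounded_clinear_simps[OF bD]
  note linT = bounded_clinear_simps[OF T]
  obtain R where R: "orth_projection R" "range R = closure (range D)" "\<And>y. D (R y) = D y"
    "\<And>k. D k = 0 \<Longrightarrow> R k = 0"
    using closure_range_projection[OF D] by blast
  note R' = orth_projection_simps[OF R(1)]
  note linR = bounded_clinear_simps[OF R'(2)]
  have RD: "R (D x) = D x" for x
  proof -
    have "D x \<in> range R" unfolding R(2) using closure_subset[of "range D"] by blast
    then show ?thesis using R'(3) by auto
  qed
  have TD0: "T x = 0" if "D x = 0" for x using bound[of x] that by simp
  \<comment> \<open>The closed graph in sequential form; passing through \<open>R y\<close> builds
    in the value 0 on the kernel of \<open>D\<close>.\<close>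
  define rel where "rel y v \<longleftrightarrow> (\<exists>x. (\<lambda>n. D (x n)) \<longlonglongrightarrow> R y \<and> (\<lambda>n. T (x n)) \<longlonglongrightarrow> v)" for y v
  have rel_bound: "norm v \<le> C * norm (R y)" if rels: "rel y v" for y v
  proof -
    obtain x where x: "(\<lambda>n. D (x n)) \<longlonglongrightarrow> R y" "(\<lambda>n. T (x n)) \<longlonglongrightarrow> v"
      using rels unfolding rel_def by blast
    show ?thesis
    proof (rule LIMSEQ_le)
      show "(\<lambda>n. norm (T (x n))) \<longlonglongrightarrow> norm v" by (intro tendsto_norm x)
      show "(\<lambda>n. C * norm (D (x n))) \<longlonglongrightarrow> C * norm (R y)"
        by (intro tendsto_mult tendsto_norm tendsto_const x)
    qed (use bound in blast)
  qed
  have rel_diff: "rel (y - z) (v - w)" if rels: "rel y v" "rel z w" for y z v w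
  proof -
    obtain x x' where x: "(\<lambda>n. D (x n)) \<longlonglongrightarrow> R y" "(\<lambda>n. T (x n)) \<longlonglongrightarrow> v"
      "(\<lambda>n. D (x' n)) \<longlonglongrightarrow> R z" "(\<lambda>n. T (x' n)) \<longlonglongrightarrow> w"
      using rels unfolding rel_def by blast
    show ?thesis unfolding rel_def
      by (intro exI[of _ "\<lambda>n. x n - x' n"]) (auto simp: linD linT linR intro!: tendsto_diff x)
  qed
  have rel_add: "rel (y + z) (v + w)" if rels: "rel y v" "rel z w" for y z v w
  proof -
    obtain x x' where x: "(\<lambda>n. D (x n)) \<longlonglongrightarrow> R y" "(\<lambda>n. T (x n)) \<longlonglongrightarrow> v"
      "(\<lambda>n. D (x' n)) \<longlonglongrightarrow> R z" "(\<lambda>n. T (x' n)) \<longlonglongrightarrow> w"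
      using rels unfolding rel_def by blast
    show ?thesis unfolding rel_def
      by (intro exI[of _ "\<lambda>n. x n + x' n"]) (auto simp: linD linT linR intro!: tendsto_add x)
  qed
  have rel_scale: "rel (c *\<^sub>C y) (c *\<^sub>C v)" if rels: "rel y v" for c y v
  proof -
    obtain x where x: "(\<lambda>n. D (x n)) \<longlonglongrightarrow> R y" "(\<lambda>n. T (x n)) \<longlonglongrightarrow> v"
      using rels unfolding rel_def by blast
    from bounded_clinear_tendsto[OF bounded_clinear_scaleC x(1)]
      bounded_clinear_tendsto[OF bounded_clinear_scaleC x(2)]
    show ?thesis unfolding rel_def
      by (intro exI[of _ "\<lambda>n. c *\<^sub>C x n"]) (simp add: linD linT linR)
  qed
  have rel_D: "rel (D x + k) (T x)" if "D k = 0" for x k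
    unfolding rel_def using R(4)[OF that]
    by (intro exI[of _ "\<lambda>n. x"]) (simp add: linR RD)
  have rel_unique: "v = w" if "rel y v" "rel y w" for y v w
    using rel_bound[OF rel_diff[OF that]] by (simp add: linR)
  have rel_exists: "\<exists>v. rel y v" for y
  proof -
    have "R y \<in> closure (range D)" using R(2) by blast
    then obtain x where x: "(\<lambda>n. D (x n)) \<longlonglongrightarrow> R y" by (rule closure_range_sequence)
    then have CD: "Cauchy (\<lambda>n. D (x n))" by (rule LIMSEQ_imp_Cauchy)
    have "Cauchy (\<lambda>n. T (x n))"
    proof (rule CauchyI)
      fix e :: real assume "e > 0"
      then have "e / (\<bar>C\<bar> + 1) > 0" by simp
      from CauchyD[OF CD this] obtain M where
        M: "\<And>m n. m \<ge> M \<Longrightarrow> n \<ge> M \<Longrightarrow> norm (D (x m) - D (x n)) < e / (\<bar>C\<bar> + 1)" by blast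
      have "norm (T (x m) - T (x n)) < e" if "m \<ge> M" "n \<ge> M" for m n
      proof -
        have "norm (T (x m) - T (x n)) \<le> C * norm (D (x m) - D (x n))"
          using bound[of "x m - x n"] by (simp add: linT linD)
        also have "\<dots> \<le> (\<bar>C\<bar> + 1) * norm (D (x m) - D (x n))" by (rule mult_right_mono) auto
        also have "\<dots> < e" using M[OF that] by (simp add: pos_less_divide_eq mult.commute)
        finally show ?thesis .
      qed
      then show "\<exists>M. \<forall>m\<ge>M. \<forall>n\<ge>M. norm (T (x m) - T (x n)) < e" by blast
    qed
    then show ?thesis using x Cauchy_convergent unfolding convergent_def rel_def by blast
  qed
  define W where "W y = (SOME v. rel y v)" for y
  have W: "rel y (W y)" for y unfolding W_def by (rule someI_ex[OF rel_exists])
  have W_eq: "W y = v" if "rel y v" for y v using rel_unique W that by blast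
  have bW: "bounded_clinear W"
  proof (rule bounded_clinearI[where K = "\<bar>C\<bar>"])
    fix x
    have "norm (W x) \<le> C * norm (R x)" by (rule rel_bound[OF W])
    also have "\<dots> \<le> \<bar>C\<bar> * norm x" by (intro mult_mono R'(7)) auto
    finally show "norm (W x) \<le> norm x * \<bar>C\<bar>" by (simp add: mult.commute)
  qed (intro W_eq rel_add rel_scale W)+
  let ?G = "moore_penrose D O op_graph T"
  have G1: "\<exists>x k. p = (D x + k, T x) \<and> D k = 0" if "p \<in> ?G" for p
    using that by (auto simp: moore_penrose_def op_graph_def op_ker_def)
  \<comment> \<open>The Moore-Penrose inverse returns \<open>R x\<close> instead of
    \<open>x\<close>; \<open>T\<close> does not see the difference because it vanishes on the kernel
    of \<open>D\<close>.\<close>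
  have G2: "(D x + k, T x) \<in> ?G" if k: "D k = 0" for x k
  proof -
    have "R x \<in> orth_compl (op_ker D)"
      by (auto simp: orth_compl_def op_ker_def R'(4) R(4))
    moreover have "T (R x) = T x"
      using TD0[of "x - R x"] by (simp add: linD linT R(3))
    ultimately have "(D (R x) + k, R x) \<in> moore_penrose D" "(R x, T x) \<in> op_graph T"
      using k unfolding moore_penrose_def op_graph_def op_ker_def by force+
    then show ?thesis unfolding R(3) by (rule relcompI)
  qed
  have graph: "op_graph W = closure ?G"
  proof
    have "closed {p :: 'a \<times> 'b. W (fst p) = snd p}"
      by (intro closed_Collect_eq continuous_on_snd continuous_on_id
          bounded_linear.continuous_on[OF bounded_clinear_imp[OF bW]] continuous_on_fst)
    moreover have "?G \<subseteq> {p. W (fst p) = snd p}" using G1 W_eq rel_D by fastforce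
    ultimately have "closure ?G \<subseteq> {p. W (fst p) = snd p}" by (rule closure_minimal[rotated])
    then show "closure ?G \<subseteq> op_graph W" by (auto simp: op_graph_def)
    show "op_graph W \<subseteq> closure ?G"
    proof
      fix p assume "p \<in> op_graph W"
      then obtain y where p: "p = (y, W y)" by (auto simp: op_graph_def)
      obtain x where x: "(\<lambda>n. D (x n)) \<longlonglongrightarrow> R y" "(\<lambda>n. T (x n)) \<longlonglongrightarrow> W y"
        using W[of y] unfolding rel_def by blast
      \<comment> \<open>\<open>y - R y\<close> lies in the kernel of \<open>D\<close>; adding it
        keeps the approximants in the Moore-Penrose domain and moves their limit from
        \<open>R y\<close> to \<open>y\<close>.\<close>
      have "(\<lambda>n. D (x n) + (y - R y)) \<longlonglongrightarrow> R y + (y - R y)"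
        by (intro tendsto_add x tendsto_const)
      then have "(\<lambda>n. (D (x n) + (y - R y), T (x n))) \<longlonglongrightarrow> (y, W y)"
        by (intro tendsto_Pair x) simp
      moreover have "(D (x n) + (y - R y), T (x n)) \<in> ?G" for n
        by (rule G2) (simp add: linD R(3))
      ultimately show "p \<in> closure ?G"
        unfolding closure_sequential p by (intro exI[of _ "\<lambda>n. (D (x n) + (y - R y), T (x n))"]) blast
    qed
  qed
  have "V = W"
    unfolding V_def closure_op_def
  proof (rule the_equality)
    show "op_graph W = closure ?G" by (rule graph)
    fix V' assume "op_graph V' = closure ?G"
    then have "op_graph V' = op_graph W" using graph by simp
    then show "V' = W" by (auto simp: op_graph_def set_eq_iff fun_eq_iff)
  qed
  then show "bounded_clinear V" "V (D f) = T f" "D k = 0 \<Longrightarrow> V k = 0"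
    using bW W_eq[OF rel_D[of 0 f]] W_eq[OF rel_D[of k 0]] by (simp_all add: linD linT)
qed

text \<open>As \<open>V\<close> vanishes on the kernel of \<open>D\<close>, it satisfies V = V R for
  the projection \<open>R\<close> onto the closure of the range; taking adjoints, \<open>R\<close>
  fixes the range of the adjoint.\<close>

lemma range_cadjoint_closure:
  fixes D :: "'a::chilbert_space \<Rightarrow> 'a" and V :: "'a \<Rightarrow> 'b::complex_inner"
  assumes D: "selfadjoint D" and V: "bounded_clinear V" and ker: "\<And>k. D k = 0 \<Longrightarrow> V k = 0"
  shows "cadjoint V g \<in> closure (range D)"
proof -
  obtain R where R: "orth_projection R" "range R = closure (range D)" "\<And>y. D (R y) = D y"
    using closure_range_projection[OF D] by blast
  note R' = orth_projection_simps[OF R(1)]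
  have "cinner (R (cadjoint V g)) z = cinner (cadjoint V g) z" for z
  proof -
    have "D (z - R z) = 0"
      by (simp add: bounded_clinear_simps[OF selfadjoint_bounded_clinear[OF D]] R(3))
    then have "V z = V (R z)" using ker bounded_clinear_simps(2)[OF V, of z "R z"] by simp
    then show ?thesis by (simp add: R'(4) cinner_cadjoint'[OF V])
  qed
  then have "R (cadjoint V g) = cadjoint V g" by (rule cinner_ext_left)
  then show ?thesis using R(2) by (metis rangeI)
qed

text \<open>In the difference of the lower right corners \<open>T11\<close> cancels, and twice I - V
  J S remains, where \<open>S\<close> is the adjoint of \<open>V\<close>.\<close>

lemma T_m_eq_T_M_iff:
  fixes T11 :: "'a::chilbert_space \<Rightarrow> 'a" and T21 :: "'a \<Rightarrow> 'b::chilbert_space"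
  assumes V: "bounded_clinear (V_op T11 T21)"
  shows "T_m T11 T21 = T_M T11 T21 \<longleftrightarrow>
    (\<forall>g. V_op T11 T21 (J_op T11 (cadjoint (V_op T11 T21) g)) = g)"
proof -
  let ?V = "V_op T11 T21"
  note linV = bounded_clinear_simps[OF V]
  let ?v = "\<lambda>g. J_op T11 (cadjoint ?V g)"
  have "T_m T11 T21 = T_M T11 T21 \<longleftrightarrow>
      (\<forall>g. - g + ?V (?v g - T11 (?v g)) = g - ?V (?v g + T11 (?v g)))"
    by (auto simp: T_m_def T_M_def block_op_def Let_def fun_eq_iff)
  also have "\<dots> \<longleftrightarrow> (\<forall>g. ?V (?v g) = g)"
  proof -
    have "- g + ?V (?v g - T11 (?v g)) = g - ?V (?v g + T11 (?v g)) \<longleftrightarrow> 2 *\<^sub>R ?V (?v g) = 2 *\<^sub>R g" for g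
      by (simp add: linV scaleR_2 algebra_simps)
    then show ?thesis by simp
  qed
  finally show ?thesis .
qed

section \<open>Factorization through \<open>D\<close> and the supremum criterion\<close>

theorem theorem6p9:
  fixes T1 :: "'a::chilbert_space \<Rightarrow> 'a \<times> 'b::chilbert_space"
    and T11 :: "'a \<Rightarrow> 'a"
    and T21 :: "'a \<Rightarrow> 'b"
  assumes "bounded_clinear T1"
    and "T1 = (\<lambda>f. (T11 f, T21 f))"
    and "selfadjoint T11"
    and "\<nu>\<^sub>- (\<lambda>f. f - T11 (T11 f)) < \<infinity>"
    and "\<nu>\<^sub>- (\<lambda>f. f - T11 (T11 f)) = \<nu>\<^sub>- (\<lambda>f. f - cadjoint T1 (T1 f))"
  shows "T_m T11 T21 = T_M T11 T21 \<longleftrightarrow>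
    (\<forall>\<phi>::'b. \<phi> \<noteq> 0 \<longrightarrow>
      \<not> (\<exists>C::real. 0 \<le> C \<and>
           (\<forall>f. (cmod (cinner (T1 f) (0, \<phi>)))\<^sup>2
                  \<le> C * Re (cinner (op_abs (\<lambda>h. h - cadjoint T1 (T1 h)) f) f))))"
proof -
  let ?A = T11 and ?T = T21
  note sA = assms(3)
  have T: "bounded_clinear ?T"
  proof -
    obtain K where K: "\<And>x. norm (T1 x) \<le> K * norm x" using bounded_clinear_bound[OF assms(1)] by blast
    have "norm (?T x) \<le> norm x * K" for x
      using K[of x] norm_snd_le[of "?T x" "?A x"] by (simp add: assms(2) mult.commute)
    moreover have "?T (x + y) = ?T x + ?T y" "?T (c *\<^sub>C x) = c *\<^sub>C ?T x" for x y c
      using bounded_clinear_simps(1,5)[OF assms(1)] by (simp_all add: assms(2) scaleC_prod_def)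
    ultimately show ?thesis by (intro bounded_clinearI)
  qed
  define X where "X f = f - ?A (?A f)" for f
  have X: "selfadjoint X" unfolding X_def[abs_def] by (intro selfadjoint_diff selfadjoint_id selfadjoint_square sA)
  note bX = selfadjoint_bounded_clinear[OF X]
  note linX = bounded_clinear_simps[OF bX]
  define Y where "Y f = f - cadjoint T1 (T1 f)" for f
  have YX: "Y f = X f - cadjoint ?T (?T f)" for f
  proof -
    have "cadjoint T1 = (\<lambda>(f, g). ?A f + cadjoint ?T g)"
      by (rule cadjoint_eqI)
        (auto simp: assms(2) cinner_prod_def cinner_add_right selfadjoint_cinner[OF sA] cinner_cadjoint[OF T])
    then show ?thesis by (simp add: Y_def X_def assms(2))
  qed
  have bTT: "bounded_clinear (\<lambda>f. cadjoint ?T (?T f))"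
    by (rule bounded_clinear_compose[OF bounded_clinear_cadjoint[OF T] T])
  have "selfadjoint (\<lambda>f. cadjoint ?T (?T f))"
    by (rule selfadjointI[OF bTT]) (simp add: cinner_cadjoint[OF T, symmetric] cinner_cadjoint'[OF T])
  then have Y: "selfadjoint Y" unfolding YX[abs_def] by (intro selfadjoint_diff X)
  note bY = selfadjoint_bounded_clinear[OF Y]
  note linY = bounded_clinear_simps[OF bY]
  have form: "Re (cinner (Y f) f) = Re (cinner (X f) f) - (norm (?T f))\<^sup>2" for f
    by (simp add: YX cinner_diff_left cinner_cadjoint'[OF T] Re_cinner_self)
  have \<nu>: "\<nu>\<^sub>- X \<noteq> \<infinity>" "\<nu>\<^sub>- X = \<nu>\<^sub>- Y"
    using assms(4,5) by (simp_all add: X_def[abs_def] Y_def[abs_def])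
  obtain P where P: "orth_projection P" "op_sign X = (\<lambda>f. f - 2 *\<^sub>R P f)" "\<nu>\<^sub>- X = cdimension (range P)"
    and allP: "\<forall>f. X (P f) = P (X f)" "\<forall>f. P f = 0 \<longrightarrow> 0 \<le> Re (cinner (X f) f)"
      "\<forall>f. P f = f \<longrightarrow> Re (cinner (X f) f) \<le> 0"
      "\<nu>\<^sub>- X \<noteq> \<infinity> \<longrightarrow> (\<exists>\<delta>>0. \<forall>f. P f = f \<longrightarrow> Re (cinner (X f) f) \<le> - \<delta> * (norm f)\<^sup>2)"
    using negative_spectral_projection[OF X] by (elim exE conjE) (rule that, assumption+)
  have PX: "X (P f) = P (X f)" and Ppos: "P f = 0 \<Longrightarrow> 0 \<le> Re (cinner (X f) f)"
    and Pneg: "P f = f \<Longrightarrow> Re (cinner (X f) f) \<le> 0" for f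
    using allP(1-3) by blast+
  obtain Q where Q: "orth_projection Q" "op_sign Y = (\<lambda>f. f - 2 *\<^sub>R Q f)" "\<nu>\<^sub>- Y = cdimension (range Q)"
    and allQ: "\<forall>f. Y (Q f) = Q (Y f)" "\<forall>f. Q f = 0 \<longrightarrow> 0 \<le> Re (cinner (Y f) f)"
      "\<forall>f. Q f = f \<longrightarrow> Re (cinner (Y f) f) \<le> 0"
      "\<nu>\<^sub>- Y \<noteq> \<infinity> \<longrightarrow> (\<exists>\<delta>>0. \<forall>f. Q f = f \<longrightarrow> Re (cinner (Y f) f) \<le> - \<delta> * (norm f)\<^sup>2)"
    using negative_spectral_projection[OF Y] by (elim exE conjE) (rule that, assumption+)
  have QY: "Y (Q f) = Q (Y f)" and Qpos: "Q f = 0 \<Longrightarrow> 0 \<le> Re (cinner (Y f) f)"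
    and Qneg: "Q f = f \<Longrightarrow> Re (cinner (Y f) f) \<le> 0" for f
    using allQ(1-3) by blast+
  obtain \<delta> where \<delta>: "\<delta> > 0" "\<And>f. P f = f \<Longrightarrow> Re (cinner (X f) f) \<le> - \<delta> * (norm f)\<^sup>2"
    using allP(4) \<nu>(1) by blast
  obtain \<epsilon> where \<epsilon>: "\<epsilon> > 0" "\<And>f. Q f = f \<Longrightarrow> Re (cinner (Y f) f) \<le> - \<epsilon> * (norm f)\<^sup>2"
    using allQ(4) \<nu> by auto
  note P' = orth_projection_simps[OF P(1)]
  note linP = bounded_clinear_simps[OF P'(2)]
  note Q' = orth_projection_simps[OF Q(1)]
  define J where "J = J_op ?A"
  have J_eq: "J f = f - 2 *\<^sub>R P f" for f
    using P(2) by (simp add: J_def J_op_def X_def[abs_def])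
  have J: "selfadjoint J" unfolding J_eq[abs_def]
    by (rule selfadjoint_diff[OF selfadjoint_id selfadjoint_scaleR[OF P'(1)]])
  note bJ = selfadjoint_bounded_clinear[OF J]
  note linJ = bounded_clinear_simps[OF bJ]
  have JJ: "J (J f) = f" for f by (simp add: J_eq linP P'(3) scaleR_2)
  note absX = op_abs_negative_projection[OF X P(1) PX Ppos Pneg]
  define D where "D = D_op ?A"
  have D_sqrt: "D = op_sqrt (op_abs X)" by (simp add: D_def D_op_def X_def[abs_def])
  note Dfacts = op_sqrt[OF op_abs(1)[OF X], folded D_sqrt]
  have D: "selfadjoint D" using Dfacts(1) by (rule positive_op_selfadjoint)
  note bD = selfadjoint_bounded_clinear[OF D]
  note linD = bounded_clinear_simps[OF bD]
  \<comment> \<open>\<open>J\<close> commutes with |X| and hence with its positive root.\<close>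
  have JD: "J (D f) = D (J f)" for f
    by (rule Dfacts(3)[OF bJ]) (simp add: absX(1) J_eq linX linP PX)
  have XD: "X f = D (J (D f))" for f
    by (simp add: JD[symmetric] Dfacts(2) absX(1) linJ) (simp add: J_eq linX linP PX P'(3) scaleR_2)
  have normD: "(norm (D f))\<^sup>2 = Re (cinner (X (f - P f)) (f - P f)) - Re (cinner (X (P f)) (P f))" for f
  proof -
    have "(norm (D f))\<^sup>2 = Re (cinner (op_abs X f) f)"
      by (simp add: Re_cinner_self[symmetric] selfadjoint_cinner[OF D, of "D f", symmetric] Dfacts(2))
    then show ?thesis using absX(2) by simp
  qed
  have "\<exists>C. \<forall>f. norm (?T f) \<le> C * norm (D f)"
  proof -
    obtain C where C: "C \<ge> 0" "\<And>f. P f = 0 \<Longrightarrow> (norm (?T f))\<^sup>2 \<le> C * Re (cinner (X f) f)"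
      using equal_index_bound[OF X bY T form P(1) PX \<delta> Q'(2) Qpos] P(3) Q(3) \<nu> by auto
    obtain K where K: "K > 0" "\<And>x. norm (?T x) \<le> K * norm x" using bounded_clinear_bound[OF T] by blast
    \<comment> \<open>\<open>C\<close> serves the complement of the range of \<open>P\<close>. On
      that range the norm bound \<open>K\<close> suffices, since the gap bounds the squared norm by
      the negated form over \<open>\<delta>\<close>. The factors 2 come from
      \<open>power2_sum_le\<close>.\<close>
    define M where "M = 2 * C + 2 * K\<^sup>2 / \<delta>"
    have M: "M \<ge> 0" using C(1) \<delta>(1) by (simp add: M_def)
    have "norm (?T f) \<le> sqrt M * norm (D f)" for f
    proof -
      let ?u = "f - P f" and ?v = "P f"
      let ?a = "Re (cinner (X ?u) ?u)" and ?b = "- Re (cinner (X ?v) ?v)"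
      have u: "P ?u = 0" and v: "P ?v = ?v" by (simp_all add: linP P'(3))
      have a: "0 \<le> ?a" and b: "0 \<le> ?b" using Ppos[OF u] Pneg[OF v] by simp_all
      have "norm (?T f) \<le> norm (?T ?u) + norm (?T ?v)"
        using norm_triangle_ineq[of "?T ?u" "?T ?v"] by (simp add: bounded_clinear_simps[OF T])
      then have "(norm (?T f))\<^sup>2 \<le> (norm (?T ?u) + norm (?T ?v))\<^sup>2" by (rule power_mono) simp
      also have "\<dots> \<le> 2 * (norm (?T ?u))\<^sup>2 + 2 * (norm (?T ?v))\<^sup>2" by (rule power2_sum_le)
      also have "\<dots> \<le> 2 * (C * ?a) + 2 * (K\<^sup>2 / \<delta> * ?b)"
      proof -
        have "(norm (?T ?v))\<^sup>2 \<le> (K * norm ?v)\<^sup>2" by (intro power_mono K) simp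
        also have "\<dots> = K\<^sup>2 / \<delta> * (\<delta> * (norm ?v)\<^sup>2)" using \<delta>(1) by (simp add: power_mult_distrib)
        also have "\<dots> \<le> K\<^sup>2 / \<delta> * ?b"
        proof (rule mult_left_mono)
          show "\<delta> * (norm ?v)\<^sup>2 \<le> ?b" using \<delta>(2)[OF v] by linarith
          show "0 \<le> K\<^sup>2 / \<delta>" using \<delta>(1) by simp
        qed
        finally show ?thesis using C(2)[OF u] by linarith
      qed
      also have "\<dots> \<le> M * ?a + M * ?b"
      proof (rule add_mono)
        have "2 * C \<le> M" "2 * K\<^sup>2 / \<delta> \<le> M" using C(1) \<delta>(1) by (simp_all add: M_def)
        then show "2 * (C * ?a) \<le> M * ?a" "2 * (K\<^sup>2 / \<delta> * ?b) \<le> M * ?b"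
          using mult_right_mono[OF _ a, of "2 * C" M] mult_right_mono[OF _ b, of "2 * K\<^sup>2 / \<delta>" M]
          by (simp_all only: mult.assoc[symmetric] times_divide_eq_right)
      qed
      also have "\<dots> = (sqrt M * norm (D f))\<^sup>2"
        using M by (simp add: normD power_mult_distrib algebra_simps)
      finally show ?thesis by (rule power2_le_imp_le) (use M in simp)
    qed
    then show ?thesis by blast
  qed
  then obtain C where C: "\<And>f. norm (?T f) \<le> C * norm (D f)" by blast
  define V where "V = V_op ?A ?T"
  have "V = closure_op (moore_penrose D O op_graph ?T)" by (simp add: V_def V_op_def D_def)
  note V = closure_op_moore_penrose[OF D T C this]
  note linV = bounded_clinear_simps[OF V(1)]
  define S where "S = cadjoint V"
  have S: "cinner (V x) y = cinner x (S y)" "cinner (S y) x = cinner y (V x)" for x y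
    unfolding S_def by (rule cinner_cadjoint[OF V(1)], rule cinner_cadjoint'[OF V(1)])
  have bS: "bounded_clinear S" unfolding S_def by (rule bounded_clinear_cadjoint[OF V(1)])
  note linS = bounded_clinear_simps[OF bS]
  have TS: "cadjoint ?T g = D (S g)" for g
  proof -
    have "cadjoint ?T = (\<lambda>g. D (S g))"
      by (rule cadjoint_eqI) (simp add: V(2)[symmetric] S(1) selfadjoint_cinner[OF D])
    then show ?thesis by simp
  qed
  define K where "K u = J u - S (V u)" for u
  have bK: "bounded_clinear K" unfolding K_def[abs_def]
    by (rule bounded_clinear_diff[OF bJ bounded_clinear_compose[OF bS V(1)]])
  have YK: "Y f = D (K (D f))" for f
    by (simp add: YX XD TS K_def V(2) linD)
  let ?q = "\<lambda>f. Re (cinner (op_abs Y f) f)"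
  have CS: "(cmod (cinner f (Y g)))\<^sup>2 \<le> ?q f * ?q g" for f g
    by (rule op_abs_form_Cauchy_Schwarz[OF Y Q(1) QY Qpos Qneg])
  \<comment> \<open>The constant \<open>2 / \<epsilon>\<close> of \<open>op_abs_form_le\<close>
    times \<open>N\<^sup>2\<close>, because \<open>Y f = D (K (D f))\<close> and \<open>N\<close>
    bounds \<open>D\<close>.\<close>
  obtain c where c: "c \<ge> 0" "\<And>f. ?q f \<le> \<bar>Re (cinner (K (D f)) (D f))\<bar> + c * (norm (K (D f)))\<^sup>2"
  proof -
    obtain N where N: "N > 0" "\<And>x. norm (D x) \<le> N * norm x" using bounded_clinear_bound[OF bD] by blast
    have "?q f \<le> \<bar>Re (cinner (K (D f)) (D f))\<bar> + 2 / \<epsilon> * N\<^sup>2 * (norm (K (D f)))\<^sup>2" for f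
    proof -
      have "(norm (Y f))\<^sup>2 \<le> (N * norm (K (D f)))\<^sup>2" unfolding YK by (intro power_mono N) simp
      then have "2 / \<epsilon> * (norm (Y f))\<^sup>2 \<le> 2 / \<epsilon> * (N * norm (K (D f)))\<^sup>2"
        using \<epsilon>(1) by (intro mult_left_mono) auto
      moreover have "cinner (Y f) f = cinner (K (D f)) (D f)"
        unfolding YK by (rule selfadjoint_cinner[OF D])
      ultimately show ?thesis
        using op_abs_form_le[OF Y Q(1) QY Qpos \<epsilon>, of f] by (simp add: power_mult_distrib)
    qed
    moreover have "0 \<le> 2 / \<epsilon> * N\<^sup>2" using \<epsilon>(1) by simp
    ultimately show ?thesis using that by blast
  qed
  \<comment> \<open>A majorant of the |Y|-form that depends continuously on \<open>D f\<close>
    alone, so it makes sense at limits outside the range of \<open>D\<close>.\<close>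
  define bnd where "bnd u = \<bar>Re (cinner (K u) u)\<bar> + c * (norm (K u))\<^sup>2" for u
  have bnd_lim: "(\<lambda>n. bnd (u n)) \<longlonglongrightarrow> bnd w" if "u \<longlonglongrightarrow> w" for u :: "nat \<Rightarrow> 'a" and w
    unfolding bnd_def by (intro tendsto_intros tendsto_cinner bounded_clinear_tendsto[OF bK] that)
  have q_le: "?q f \<le> bnd (D f)" for f unfolding bnd_def by (rule c(2))
  have q_nonneg: "0 \<le> ?q f" for f by (rule positive_op_form[OF op_abs(1)[OF Y]])
  \<comment> \<open>\<open>J\<close> commutes with \<open>D\<close> and so preserves the closure of
    its range.\<close>
  have approx: "\<exists>x. (\<lambda>n. D (x n)) \<longlonglongrightarrow> J (S g)" for g
  proof -
    have "S g \<in> closure (range D)" unfolding S_def by (rule range_cadjoint_closure[OF D V(1) V(3)])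
    then obtain x where "(\<lambda>n. D (x n)) \<longlonglongrightarrow> S g" by (rule closure_range_sequence)
    from bounded_clinear_tendsto[OF bJ this] show ?thesis unfolding JD by (rule exI[of _ "\<lambda>n. J (x n)"])
  qed
  have KJS: "K (J (S g)) = S (g - V (J (S g)))" for g
    by (simp add: K_def JJ linS)
  have lhs: "cinner (T1 f) (0, \<phi>) = cinner (?T f) \<phi>" for f \<phi>
    by (simp add: assms(2) cinner_prod_def)
  have key: "(\<forall>g. V (J (S g)) = g) \<longleftrightarrow>
    (\<forall>\<phi>. \<phi> \<noteq> 0 \<longrightarrow> \<not> (\<exists>C\<ge>0. \<forall>f. (cmod (cinner (?T f) \<phi>))\<^sup>2 \<le> C * ?q f))"
  proof
    assume I: "\<forall>g. V (J (S g)) = g"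
    show "\<forall>\<phi>. \<phi> \<noteq> 0 \<longrightarrow> \<not> (\<exists>C\<ge>0. \<forall>f. (cmod (cinner (?T f) \<phi>))\<^sup>2 \<le> C * ?q f)"
    proof (intro allI impI notI)
      fix \<phi> :: 'b
      assume "\<phi> \<noteq> 0" and "\<exists>C\<ge>0. \<forall>f. (cmod (cinner (?T f) \<phi>))\<^sup>2 \<le> C * ?q f"
      then obtain C where C: "C \<ge> 0" "\<And>f. (cmod (cinner (?T f) \<phi>))\<^sup>2 \<le> C * ?q f" by blast
      obtain x where x: "(\<lambda>n. D (x n)) \<longlonglongrightarrow> J (S \<phi>)" using approx by blast
      \<comment> \<open>Along \<open>x\<close> the majorant of the denominator now tends to 0,
        whereas \<open>cinner (?T (x n)) \<phi>\<close> tends to the value of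
        \<open>cinner (V (J (S \<phi>))) \<phi>\<close>, which is
        \<open>cinner \<phi> \<phi>\<close>.\<close>
      have "K (J (S \<phi>)) = 0" by (simp add: KJS I linS)
      then have "bnd (J (S \<phi>)) = 0" by (simp add: bnd_def)
      then have lim0: "(\<lambda>n. C * bnd (D (x n))) \<longlonglongrightarrow> 0"
        using tendsto_mult[OF tendsto_const[of C] bnd_lim[OF x]] by simp
      have "(\<lambda>n. cinner (D (x n)) (S \<phi>)) \<longlonglongrightarrow> cinner (J (S \<phi>)) (S \<phi>)"
        by (intro tendsto_cinner x tendsto_const)
      then have lim: "(\<lambda>n. (cmod (cinner (?T (x n)) \<phi>))\<^sup>2) \<longlonglongrightarrow> (cmod (cinner \<phi> \<phi>))\<^sup>2"
        using I by (intro tendsto_power tendsto_norm) (simp add: S(1)[symmetric] V(2))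
      have "(cmod (cinner (?T (x n)) \<phi>))\<^sup>2 \<le> C * bnd (D (x n))" for n
        using C(2)[of "x n"] mult_left_mono[OF q_le C(1), of "x n"] by linarith
      then have "(cmod (cinner \<phi> \<phi>))\<^sup>2 \<le> 0" by (intro LIMSEQ_le[OF lim lim0]) blast
      then show False using \<open>\<phi> \<noteq> 0\<close> by simp
    qed
  next
    assume sup: "\<forall>\<phi>. \<phi> \<noteq> 0 \<longrightarrow> \<not> (\<exists>C\<ge>0. \<forall>f. (cmod (cinner (?T f) \<phi>))\<^sup>2 \<le> C * ?q f)"
    show "\<forall>g. V (J (S g)) = g"
    proof (rule ccontr)
      assume "\<not> ?thesis"
      then obtain g where "V (J (S g)) \<noteq> g" by blast
      then have g: "g - V (J (S g)) \<noteq> 0" by auto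
      \<comment> \<open>The defect vector itself is the witness: by \<open>KJS\<close>,
        \<open>cinner (?T f) \<phi>\<close> is the limit of \<open>cinner f (Y (x n))\<close>, and
        \<open>CS\<close> bounds the supremum at \<open>\<phi>\<close> by
        \<open>bnd w\<close>.\<close>
      define \<phi> where "\<phi> = g - V (J (S g))"
      define w where "w = J (S g)"
      have S\<phi>: "S \<phi> = K w" by (simp add: \<phi>_def w_def KJS)
      obtain x where x: "(\<lambda>n. D (x n)) \<longlonglongrightarrow> w" using approx unfolding w_def by blast
      have "(cmod (cinner (?T f) \<phi>))\<^sup>2 \<le> bnd w * ?q f" for f
      proof (rule LIMSEQ_le)
        have "cinner (?T f) \<phi> = cinner f (D (K w))"
          using TS by (simp add: cinner_cadjoint[OF T] S\<phi>)
        then show "(\<lambda>n. (cmod (cinner f (Y (x n))))\<^sup>2) \<longlonglongrightarrow> (cmod (cinner (?T f) \<phi>))\<^sup>2"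
          unfolding YK by (simp only:)
            (intro tendsto_power tendsto_norm tendsto_cinner tendsto_const
              bounded_clinear_tendsto[OF bD] bounded_clinear_tendsto[OF bK] x)
        show "(\<lambda>n. bnd (D (x n)) * ?q f) \<longlonglongrightarrow> bnd w * ?q f"
          by (intro tendsto_mult bnd_lim x tendsto_const)
        have "(cmod (cinner f (Y (x n))))\<^sup>2 \<le> bnd (D (x n)) * ?q f" for n
          using CS[of f "x n"] mult_right_mono[OF q_le q_nonneg, of "x n" f] by (simp add: mult.commute)
        then show "\<exists>N. \<forall>n\<ge>N. (cmod (cinner f (Y (x n))))\<^sup>2 \<le> bnd (D (x n)) * ?q f" by blast
      qed
      moreover have "bnd w \<ge> 0" using c(1) by (simp add: bnd_def)
      ultimately show False using sup g unfolding \<phi>_def by blast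
    qed
  qed
  have "T_m ?A ?T = T_M ?A ?T \<longleftrightarrow> (\<forall>g. V (J (S g)) = g)"
    using T_m_eq_T_M_iff[of ?A ?T] V(1) by (simp add: V_def J_def S_def)
  then show ?thesis
    unfolding key lhs Y_def[abs_def] .
qed

end
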